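(* Let $T\ge 1$, $N_m,N_c\ge 0$, matrices $A\in\mathbb{R}^{n_x\times n_x}$, $B\in\mathbb{R}^{n_x\times n_u}$, $C\in\mathbb{R}^{n_y\times n_x}$, $D\in\mathbb{R}^{n_z\times n_x}$, a vector $d\in\mathbb{R}^{n_z}$, and (not necessarily bounded) convex polyhedra $\mathcal{X}_0,\mathcal{W}\subseteq\mathbb{R}^{n_x}$, $\mathcal{V}\subseteq\mathbb{R}^{n_y}$, $\mathcal{U}\subseteq\mathbb{R}^{n_u}$, $\mathcal{Z}\subseteq\mathbb{R}^{n_z}$ be given in H-representation, with $\mathcal{X}_0,\mathcal{W},\mathcal{V}$ nonempty. Let the Safety Problem be as defined in the context. Then the Safety Problem is feasible if and only if the following mixed integer linear program (MILP) is feasible: Find $\sigma^m=(\sigma^m_t)_{t=0}^{T-1}$, $\sigma^c=(\sigma^c_t)_{t=0}^{T-1}$, $Q\in\mathbb{R}^{Tn_u\times Tn_y}$, $r\in\mathbb{R}^{Tn_u}$, $\Lambda\in\mathbb{R}_+^{(T+1)n_{\mathcal{Z}}\times(T(n_{\mathcal{W}}+n_{\mathcal{V}})+n_{\mathcal{X}_0})}$, $\Gamma\in\mathbb{R}_+^{Tn_{\mathcal{U}}\times(T(n_{\mathcal{W}}+n_{\mathcal{V}})+n_{\mathcal{X}_0})}$ such that (i) $\sigma^m_t,\sigma^c_t\in\{0,1\}$ for $t=0,\dots,T-1$; (ii) $\sum_{t=0}^{T-1}\sigma^m_t\le N_m$ and $\sum_{t=0}^{T-1}\sigma^c_t\le N_c$;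 (iii) $Q$ is block lower triangular with blocks of size $n_u\times n_y$; (iv) $\Lambda\, G=(I_{T+1}\otimes H_{\mathcal{Z}})\begin{bmatrix}P_{zw}&P_{zv}&P_{zx_0}\end{bmatrix}$ and $\Lambda\, g\le \mathbb{1}_{T+1}\otimes h_{\mathcal{Z}}-(I_{T+1}\otimes H_{\mathcal{Z}})\tilde z$; (v) $\Gamma\, G=(I_{T}\otimes H_{\mathcal{U}})\begin{bmatrix}P_{uw}&P_{uv}&P_{ux_0}\end{bmatrix}$ and $\Gamma\, g\le \mathbb{1}_{T}\otimes h_{\mathcal{U}}-(I_{T}\otimes H_{\mathcal{U}})\tilde u$; (vi) for every $\tau=0,\dots,T-1$: $\sigma^m_\tau=0\Rightarrow Q_{:,\mathcal{J}_\tau}=0$; (vii) for every $t=0,\dots,T-1$: $\sigma^c_t=0\Rightarrow\left(Q_{\mathcal{I}_t,:}=Q_{\mathcal{I}_{t-1},:}\text{ and } r_{\mathcal{I}_t}=r_{\mathcal{I}_{t-1}}\right)$, with the conventions $Q_{\mathcal{I}_{-1},:}=0$ and $r_{\mathcal{I}_{-1}}=0$. Moreover, the feasible values of $\sigma^m$ and $\sigma^c$ are the same for both problems, and the feasible $Q$ and $r$ of the MILP are linked by the transformations $$F=(I+Q\bar C S)^{-1}Q,\qquad f=(I+Q\bar C S)^{-1}r$$ to the feasible values of $\{f_t\}_{t=0}^{T-1}$ and $\{F_{(t,\tau)}\}_{0\le\tau\le t\le T-1}$ (the blocks of $f$ and $F$) for the Safety Problem.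
   Context: Safety Problem. Find schedules $\sigma^m_t,\sigma^c_t\in\{0,1\}$ ($t=0,\dots,T-1$), offsets $f_t\in\mathbb{R}^{n_u}$ ($t=0,\dots,T-1$) and gains $F_{(t,\tau)}\in\mathbb{R}^{n_u\times n_y}$ ($0\le\tau\le t\le T-1$) such that $\sum_{t=0}^{T-1}\sigma^m_t\le N_m$, $\sum_{t=0}^{T-1}\sigma^c_t\le N_c$, and for all $w_t\in\mathcal{W}$, $v_t\in\mathcal{V}$ ($t=0,\dots,T-1$) and all $x_0\in\mathcal{X}_0$, the trajectories generated by $$x_{t+1}=Ax_t+Bu_t+w_t,\qquad y_t=\begin{cases}Cx_t+v_t,&\sigma^m_t=1\\ \emptyset\ (\text{no measurement}),&\sigma^m_t=0\end{cases},\qquad z_t=Dx_t+d,$$ $$u_t=\begin{cases}f_t+\sum_{\tau\le t,\ \sigma^m_\tau=1}F_{(t,\tau)}y_\tau,&\sigma^c_t=1\\ u_{t-1},&\sigma^c_t=0\end{cases},\qquad u_{-1}=0,$$ satisfy $z_t\in\mathcal{Z}$ for $t=0,\dots,T$ and $u_t\in\mathcal{U}$ for $t=0,\dots,T-1$. Polyhedra. For $\mathcal{A}\in\{\mathcal{X}_0,\mathcal{W},\mathcal{V},\mathcal{U},\mathcal{Z}\}$ the H-representation is $\mathcal{A}=\{x: H_{\mathcal{A}}x\le h_{\mathcal{A}}\}$, and $n_{\mathcal{A}}$ is the number of rows of $H_{\mathcal{A}}$ and of $h_{\mathcal{A}}$. Vector inequalities are element-wise; $\mathbb{R}_+^{m\times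 n}$ denotes real matrices with nonnegative entries; $\otimes$ is the Kronecker product; $\mathbb{1}_n$ is the all-ones vector. Matrices. $\bar C=\begin{bmatrix}I_T\otimes C & 0_{Tn_y\times n_x}\end{bmatrix}$, $\bar D=I_{T+1}\otimes D$, $\bar d=\mathbb{1}_{T+1}\otimes d$, $J=\begin{bmatrix} I \\ A \\ \vdots \\ A^T \end{bmatrix}$. $H$ is the $(T+1)\times T$ block matrix with blocks in $\mathbb{R}^{n_x\times n_x}$, with block rows $i=0,\dots,T$ and block columns $j=0,\dots,T-1$, whose $(i,j)$ block is $A^{i-1-j}$ if $i>j$ and $0$ otherwise; $S$ is the $(T+1)\times T$ block matrix with blocks in $\mathbb{R}^{n_x\times n_u}$ whose $(i,j)$ block is $A^{i-1-j}B$ if $i>j$ and $0$ otherwise. In terms of $Q$ and $r$, $$P_{zw}=\bar D(H+SQ\bar CH),\quad P_{zv}=\bar DSQ,\quad P_{zx_0}=\bar D(I+SQ\bar C)J,$$ $$P_{uw}=Q\bar CH,\quad P_{uv}=Q,\quad P_{ux_0}=Q\bar CJ,\qquad \tilde z=\bar DSr+\bar d,\quad \tilde u=r,$$ and $$G=\begin{bmatrix}I_T\otimes H_{\mathcal{W}}&0&0\\ 0&I_T\otimes H_{\mathcal{V}}&0\\ 0&0&H_{\mathcal{X}_0}\end{bmatrix},\qquad g=\begin{bmatrix}\mathbb{1}_T\otimes h_{\mathcal{W}}\\ \mathbb{1}_T\otimes h_{\mathcal{V}}\\ h_{\mathcal{X}_0}\end{bmatrix}.$$ Indices. $\mathcal{J}_\tau=\{1+\tau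 n_y,\dots,(\tau+1)n_y\}$ and $\mathcal{I}_t=\{1+tn_u,\dots,(t+1)n_u\}$; $M_{:,\mathcal{J}}$ (resp. $M_{\mathcal{I},:}$) is the submatrix of $M$ formed by the columns (resp. rows) with the given indices. Gains in stacked form. $f=\begin{bmatrix}f_0^\top&\cdots&f_{T-1}^\top\end{bmatrix}^\top$ and $F\in\mathbb{R}^{Tn_u\times Tn_y}$ is the block lower triangular matrix whose $(t,\tau)$ block ($t,\tau=0,\dots,T-1$) is $F_{(t,\tau)}$ for $\tau\le t$ and $0$ for $\tau>t$. The map $(Q,r)\mapsto(F,f)$ in the claim, defined for $Q$ block lower triangular with $n_u\times n_y$ blocks, is invertible onto the pairs $(F,f)$ with $F$ block lower triangular with $n_u\times n_y$ blocks; its inverse (the Q-parameterization) is $Q=F(I-\bar CSF)^{-1}$, $r=(I+Q\bar CS)f$. Indicator constraints "$\sigma=0\Rightarrow \ell=0$" with $\sigma$ binary and $\ell$ linear in the continuous variables are regarded as mixed integer linear constraints, via the Big-M formulation $-\sigma\bar M\le\ell\le\sigma\bar M$ with $\bar M$ sufficiently large.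
   Formalization: An exact correspondence with all feasible gains fails, since f_t, F_(t,τ) with σ^c_t=0 and F_(t,τ) with σ^m_τ=0 are unused and arbitrary; every feasible (f,F) is matched by a feasible (Q,r) only in the entries with σ^c_t=1 and (for F) σ^m_τ=1. *)

theory Defs
  imports
    "Jordan_Normal_Form.Gauss_Jordan_Elimination"
    "Jordan_Normal_Form.DL_Submatrix"
begin

section \<open>Matrices\<close>

definition kron_mat :: "real mat \<Rightarrow> real mat \<Rightarrow> real mat" (infixr \<open>\<otimes>\<^sub>m\<close> 75) where
  "A \<otimes>\<^sub>m B = mat (dim_row A * dim_row B) (dim_col A * dim_col B)
     (\<lambda>(i, j). A $$ (i div dim_row B, j div dim_col B) * B $$ (i mod dim_row B, j mod dim_col B))"

definition kron_vec :: "real vec \<Rightarrow> real vec \<Rightarrow> real vec" (infixr \<open>\<otimes>\<^sub>v\<close> 75) where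
  "a \<otimes>\<^sub>v b = vec (dim_vec a * dim_vec b) (\<lambda>i. a $ (i div dim_vec b) * b $ (i mod dim_vec b))"

definition ones_vec :: "nat \<Rightarrow> real vec" where
  "ones_vec n = vec n (\<lambda>_. 1)"

text \<open>Horizontal concatenation, the counterpart of \<open>append_rows\<close>.\<close>

definition append_cols :: "real mat \<Rightarrow> real mat \<Rightarrow> real mat" (infixr \<open>@\<^sub>c\<close> 65) where
  "A @\<^sub>c B = four_block_mat A B (0\<^sub>m 0 (dim_col A)) (0\<^sub>m 0 (dim_col B))"

text \<open>The matrix with \<open>p \<times> q\<close> blocks of size \<open>nr \<times> nc\<close> whose \<open>(i,j)\<close> block is \<open>X i j\<close>.\<close>

definition of_blocks :: "nat \<Rightarrow> nat \<Rightarrow> nat \<Rightarrow> nat \<Rightarrow> (nat \<Rightarrow> nat \<Rightarrow> real mat) \<Rightarrow> real mat" where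
  "of_blocks p q nr nc X = mat (p * nr) (q * nc)
     (\<lambda>(i, j). X (i div nr) (j div nc) $$ (i mod nr, j mod nc))"

text \<open>Indices start at 0, so the \<open>t\<close>-th block of size \<open>n\<close> occupies the positions
  \<open>tn, \<dots>, (t+1)n - 1\<close>.\<close>

definition block_idx :: "nat \<Rightarrow> nat \<Rightarrow> nat set" where
  "block_idx n t = {t * n ..< (t + 1) * n}"

definition vec_block :: "nat \<Rightarrow> nat \<Rightarrow> real vec \<Rightarrow> real vec" where
  "vec_block n t r = vec n (\<lambda>i. r $ (t * n + i))"

definition mat_block :: "nat \<Rightarrow> nat \<Rightarrow> nat \<Rightarrow> nat \<Rightarrow> real mat \<Rightarrow> real mat" where
  "mat_block nr nc t \<tau> M = submatrix M (block_idx nr t) (block_idx nc \<tau>)"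

definition block_lower_triangular :: "nat \<Rightarrow> nat \<Rightarrow> nat \<Rightarrow> real mat \<Rightarrow> bool" where
  "block_lower_triangular T nr nc M \<longleftrightarrow>
     M \<in> carrier_mat (T * nr) (T * nc) \<and>
     (\<forall>t<T. \<forall>\<tau><T. t < \<tau> \<longrightarrow> mat_block nr nc t \<tau> M = 0\<^sub>m nr nc)"

section \<open>Problem data\<close>

text \<open>An H-representation \<open>(H, h)\<close>. The order on vectors is entrywise.\<close>

type_synonym hrep = "real mat \<times> real vec"

definition is_hrep :: "nat \<Rightarrow> hrep \<Rightarrow> bool" where
  "is_hrep n p \<longleftrightarrow> fst p \<in> carrier_mat (dim_vec (snd p)) n"

definition polyhedron :: "nat \<Rightarrow> hrep \<Rightarrow> real vec set" where
  "polyhedron n p = {x \<in> carrier_vec n. fst p *\<^sub>v x \<le> snd p}"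

abbreviation nrows :: "hrep \<Rightarrow> nat" where
  "nrows p \<equiv> dim_row (fst p)"

record safety_problem =
  horizon :: nat
  max_meas :: nat
  max_ctrl :: nat
  nx :: nat
  nu :: nat
  ny :: nat
  nz :: nat
  sysA :: "real mat"
  sysB :: "real mat"
  sysC :: "real mat"
  sysD :: "real mat"
  sysd :: "real vec"
  hX0 :: hrep
  hW :: hrep
  hV :: hrep
  hU :: hrep
  hZ :: hrep

definition well_dimensioned :: "safety_problem \<Rightarrow> bool" where
  "well_dimensioned P \<longleftrightarrow>
     sysA P \<in> carrier_mat (nx P) (nx P) \<and>
     sysB P \<in> carrier_mat (nx P) (nu P) \<and>
     sysC P \<in> carrier_mat (ny P) (nx P) \<and>
     sysD P \<in> carrier_mat (nz P) (nx P) \<and>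
     sysd P \<in> carrier_vec (nz P) \<and>
     is_hrep (nx P) (hX0 P) \<and> is_hrep (nx P) (hW P) \<and> is_hrep (ny P) (hV P) \<and>
     is_hrep (nu P) (hU P) \<and> is_hrep (nz P) (hZ P)"

text \<open>Only the values of a schedule at times \<open>t < horizon P\<close> matter; \<open>\<sigma>m\<close> is the measurement
  schedule and \<open>\<sigma>c\<close> the control schedule.\<close>

definition admissible_schedules :: "safety_problem \<Rightarrow> (nat \<Rightarrow> nat) \<Rightarrow> (nat \<Rightarrow> nat) \<Rightarrow> bool" where
  "admissible_schedules P \<sigma>m \<sigma>c \<longleftrightarrow>
     (\<forall>t<horizon P. \<sigma>m t \<in> {0, 1} \<and> \<sigma>c t \<in> {0, 1}) \<and>
     (\<Sum>t<horizon P. \<sigma>m t) \<le> max_meas P \<and>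
     (\<Sum>t<horizon P. \<sigma>c t) \<le> max_ctrl P"

section \<open>The safety problem\<close>

text \<open>A missing measurement is \<open>None\<close>; \<open>the (y \<tau>)\<close> is only used for \<open>\<sigma>m \<tau> = 1\<close>.
  The signals are determined by \<open>x0\<close>, \<open>w\<close> and \<open>v\<close> at all times constrained below.\<close>

definition trajectory ::
  "safety_problem \<Rightarrow> (nat \<Rightarrow> nat) \<Rightarrow> (nat \<Rightarrow> nat) \<Rightarrow> (nat \<Rightarrow> real vec) \<Rightarrow> (nat \<Rightarrow> nat \<Rightarrow> real mat) \<Rightarrow>
   real vec \<Rightarrow> (nat \<Rightarrow> real vec) \<Rightarrow> (nat \<Rightarrow> real vec) \<Rightarrow>
   (nat \<Rightarrow> real vec) \<Rightarrow> (nat \<Rightarrow> real vec) \<Rightarrow> (nat \<Rightarrow> real vec option) \<Rightarrow> (nat \<Rightarrow> real vec) \<Rightarrow> bool" where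
  "trajectory P \<sigma>m \<sigma>c f F x0 w v x u y z \<longleftrightarrow>
     x 0 = x0 \<and>
     (\<forall>t<horizon P. x (Suc t) = sysA P *\<^sub>v x t + sysB P *\<^sub>v u t + w t) \<and>
     (\<forall>t<horizon P. y t = (if \<sigma>m t = 1 then Some (sysC P *\<^sub>v x t + v t) else None)) \<and>
     (\<forall>t\<le>horizon P. z t = sysD P *\<^sub>v x t + sysd P) \<and>
     (\<forall>t<horizon P. u t =
        (if \<sigma>c t = 1
         then f t + finsum_vec TYPE(real) (nu P) (\<lambda>\<tau>. F t \<tau> *\<^sub>v the (y \<tau>)) {\<tau>. \<tau> \<le> t \<and> \<sigma>m \<tau> = 1}
         else if t = 0 then 0\<^sub>v (nu P) else u (t - 1)))"

definition safety_feasible ::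
  "safety_problem \<Rightarrow> (nat \<Rightarrow> nat) \<Rightarrow> (nat \<Rightarrow> nat) \<Rightarrow> (nat \<Rightarrow> real vec) \<Rightarrow> (nat \<Rightarrow> nat \<Rightarrow> real mat) \<Rightarrow> bool" where
  "safety_feasible P \<sigma>m \<sigma>c f F \<longleftrightarrow>
     admissible_schedules P \<sigma>m \<sigma>c \<and>
     (\<forall>t<horizon P. f t \<in> carrier_vec (nu P) \<and> (\<forall>\<tau>\<le>t. F t \<tau> \<in> carrier_mat (nu P) (ny P))) \<and>
     (\<forall>x0 w v x u y z.
        x0 \<in> polyhedron (nx P) (hX0 P) \<longrightarrow>
        (\<forall>t<horizon P. w t \<in> polyhedron (nx P) (hW P) \<and> v t \<in> polyhedron (ny P) (hV P)) \<longrightarrow>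
        trajectory P \<sigma>m \<sigma>c f F x0 w v x u y z \<longrightarrow>
        (\<forall>t\<le>horizon P. z t \<in> polyhedron (nz P) (hZ P)) \<and>
        (\<forall>t<horizon P. u t \<in> polyhedron (nu P) (hU P)))"

section \<open>The mixed integer linear program\<close>

definition bar_C :: "safety_problem \<Rightarrow> real mat" where
  "bar_C P = (1\<^sub>m (horizon P) \<otimes>\<^sub>m sysC P) @\<^sub>c 0\<^sub>m (horizon P * ny P) (nx P)"

definition bar_D :: "safety_problem \<Rightarrow> real mat" where
  "bar_D P = 1\<^sub>m (horizon P + 1) \<otimes>\<^sub>m sysD P"

definition bar_d :: "safety_problem \<Rightarrow> real vec" where
  "bar_d P = ones_vec (horizon P + 1) \<otimes>\<^sub>v sysd P"

definition mat_J :: "safety_problem \<Rightarrow> real mat" where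
  "mat_J P = of_blocks (horizon P + 1) 1 (nx P) (nx P) (\<lambda>i _. sysA P ^\<^sub>m i)"

definition mat_H :: "safety_problem \<Rightarrow> real mat" where
  "mat_H P = of_blocks (horizon P + 1) (horizon P) (nx P) (nx P)
     (\<lambda>i j. if i > j then sysA P ^\<^sub>m (i - 1 - j) else 0\<^sub>m (nx P) (nx P))"

definition mat_S :: "safety_problem \<Rightarrow> real mat" where
  "mat_S P = of_blocks (horizon P + 1) (horizon P) (nx P) (nu P)
     (\<lambda>i j. if i > j then sysA P ^\<^sub>m (i - 1 - j) * sysB P else 0\<^sub>m (nx P) (nu P))"

definition P_zw :: "safety_problem \<Rightarrow> real mat \<Rightarrow> real mat" where
  "P_zw P Q = bar_D P * (mat_H P + mat_S P * Q * bar_C P * mat_H P)"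

definition P_zv :: "safety_problem \<Rightarrow> real mat \<Rightarrow> real mat" where
  "P_zv P Q = bar_D P * mat_S P * Q"

definition P_zx0 :: "safety_problem \<Rightarrow> real mat \<Rightarrow> real mat" where
  "P_zx0 P Q = bar_D P * (1\<^sub>m ((horizon P + 1) * nx P) + mat_S P * Q * bar_C P) * mat_J P"

definition P_uw :: "safety_problem \<Rightarrow> real mat \<Rightarrow> real mat" where
  "P_uw P Q = Q * bar_C P * mat_H P"

definition P_uv :: "safety_problem \<Rightarrow> real mat \<Rightarrow> real mat" where
  "P_uv P Q = Q"

definition P_ux0 :: "safety_problem \<Rightarrow> real mat \<Rightarrow> real mat" where
  "P_ux0 P Q = Q * bar_C P * mat_J P"

definition tilde_z :: "safety_problem \<Rightarrow> real vec \<Rightarrow> real vec" where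
  "tilde_z P r = bar_D P * mat_S P *\<^sub>v r + bar_d P"

definition tilde_u :: "safety_problem \<Rightarrow> real vec \<Rightarrow> real vec" where
  "tilde_u P r = r"

definition mat_G :: "safety_problem \<Rightarrow> real mat" where
  "mat_G P = diag_block_mat
     [1\<^sub>m (horizon P) \<otimes>\<^sub>m fst (hW P), 1\<^sub>m (horizon P) \<otimes>\<^sub>m fst (hV P), fst (hX0 P)]"

definition vec_g :: "safety_problem \<Rightarrow> real vec" where
  "vec_g P = (ones_vec (horizon P) \<otimes>\<^sub>v snd (hW P)) @\<^sub>v (ones_vec (horizon P) \<otimes>\<^sub>v snd (hV P)) @\<^sub>v snd (hX0 P)"

text \<open>Nonnegativity of the multipliers is expressed by the entrywise order on matrices.\<close>

definition milp_feasible ::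
  "safety_problem \<Rightarrow> (nat \<Rightarrow> nat) \<Rightarrow> (nat \<Rightarrow> nat) \<Rightarrow> real mat \<Rightarrow> real vec \<Rightarrow> real mat \<Rightarrow> real mat \<Rightarrow> bool" where
  "milp_feasible P \<sigma>m \<sigma>c Q r \<Lambda> \<Gamma> \<longleftrightarrow>
     (let T = horizon P;
          m = T * (nrows (hW P) + nrows (hV P)) + nrows (hX0 P);
          HHZ = 1\<^sub>m (T + 1) \<otimes>\<^sub>m fst (hZ P);
          HHU = 1\<^sub>m T \<otimes>\<^sub>m fst (hU P)
      in
        r \<in> carrier_vec (T * nu P) \<and>
        \<Lambda> \<in> carrier_mat ((T + 1) * nrows (hZ P)) m \<and> 0\<^sub>m ((T + 1) * nrows (hZ P)) m \<le> \<Lambda> \<and>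
        \<Gamma> \<in> carrier_mat (T * nrows (hU P)) m \<and> 0\<^sub>m (T * nrows (hU P)) m \<le> \<Gamma> \<and>
        admissible_schedules P \<sigma>m \<sigma>c \<and>
        block_lower_triangular T (nu P) (ny P) Q \<and>
        \<Lambda> * mat_G P = HHZ * (P_zw P Q @\<^sub>c P_zv P Q @\<^sub>c P_zx0 P Q) \<and>
        \<Lambda> *\<^sub>v vec_g P \<le> ones_vec (T + 1) \<otimes>\<^sub>v snd (hZ P) - HHZ *\<^sub>v tilde_z P r \<and>
        \<Gamma> * mat_G P = HHU * (P_uw P Q @\<^sub>c P_uv P Q @\<^sub>c P_ux0 P Q) \<and>
        \<Gamma> *\<^sub>v vec_g P \<le> ones_vec T \<otimes>\<^sub>v snd (hU P) - HHU *\<^sub>v tilde_u P r \<and>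
        (\<forall>\<tau><T. \<sigma>m \<tau> = 0 \<longrightarrow> submatrix Q UNIV (block_idx (ny P) \<tau>) = 0\<^sub>m (T * nu P) (ny P)) \<and>
        (\<forall>t<T. \<sigma>c t = 0 \<longrightarrow>
           submatrix Q (block_idx (nu P) t) UNIV =
             (if t = 0 then 0\<^sub>m (nu P) (T * ny P) else submatrix Q (block_idx (nu P) (t - 1)) UNIV) \<and>
           vec_block (nu P) t r =
             (if t = 0 then 0\<^sub>v (nu P) else vec_block (nu P) (t - 1) r)))"

section \<open>From \<open>(Q, r)\<close> to the stacked gains \<open>(F, f)\<close>\<close>

definition loop_mat :: "safety_problem \<Rightarrow> real mat \<Rightarrow> real mat" where
  "loop_mat P Q = 1\<^sub>m (horizon P * nu P) + Q * bar_C P * mat_S P"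

definition stacked_F :: "safety_problem \<Rightarrow> real mat \<Rightarrow> real mat" where
  "stacked_F P Q = the (mat_inverse (loop_mat P Q)) * Q"

definition stacked_f :: "safety_problem \<Rightarrow> real mat \<Rightarrow> real vec \<Rightarrow> real vec" where
  "stacked_f P Q r = the (mat_inverse (loop_mat P Q)) *\<^sub>v r"

definition gain_F :: "safety_problem \<Rightarrow> real mat \<Rightarrow> nat \<Rightarrow> nat \<Rightarrow> real mat" where
  "gain_F P Q t \<tau> = mat_block (nu P) (ny P) t \<tau> (stacked_F P Q)"

definition gain_f :: "safety_problem \<Rightarrow> real mat \<Rightarrow> real vec \<Rightarrow> nat \<Rightarrow> real vec" where
  "gain_f P Q r t = vec_block (nu P) t (stacked_f P Q r)"

end

theory Submission
  imports Defs "Jordan_Normal_Form.Determinant"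
begin

text \<open>Substituting \<open>y = C\<^sub>b x + v\<close> and \<open>x = J x\<^sub>0 + H w + S u\<close> (with \<open>C\<^sub>b\<close> the matrix
  \<open>bar_C\<close>) into the control law \<open>u = f + F y\<close> and solving for \<open>u\<close> makes \<open>u\<close> and \<open>z\<close> affine in
  the disturbance \<open>(w, v, x\<^sub>0)\<close>, with coefficients that are themselves affine in \<open>(Q, r)\<close>. Feasibility
  thus says that affine functions of the disturbance are bounded on the nonempty polyhedron
  \<open>G \<xi> \<le> g\<close>, and Farkas' lemma turns every row of these bounds into a row of multipliers of
  \<open>\<Lambda>\<close> or \<open>\<Gamma>\<close>.

  The schedules are absorbed into the gains: an unmeasured output is a zero block column of \<open>F\<close>, and
  a held input repeats the previous block row of \<open>F\<close> and \<open>f\<close>. Because \<open>C\<^sub>b S\<close> is strictly block lower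
  triangular, \<open>1 - F C\<^sub>b S\<close> is invertible, and block triangularity, zero columns and repeated rows are
  inherited by \<open>Q\<close> from \<open>F\<close> and conversely.\<close>

section \<open>Farkas' lemma\<close>

text \<open>Different gains can produce the same inputs: \<open>f t\<close> and \<open>F t s\<close>
  never act at a time with \<open>\<sigma>c t = 0\<close>, nor does \<open>F t s\<close> when output
  \<open>s\<close> is missing. So (Q, r) cannot remember (f, F). It corresponds to the gains in
  force, and the original blocks come back only where they act.

  The schedule conditions stay linear in Q, although F is not linear in Q, because the loop can be
  closed from either side. With K = \<open>bar_C P * mat_S P\<close>, the form Q = (1 + Q K) F acts
  on the columns of F one by one, and Q = F (1 + K Q) acts on its rows one by one. Zero columns are
  therefore read off the one form, zero and repeated rows off the other.

  Trajectories are given by a relation, and safety quantifies over all of them, so it could hold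
  vacuously. The passage from safety to bounds on affine functions thus needs a trajectory for every
  disturbance, and the passage from these bounds to multipliers needs a point in the disturbance
  polyhedron.\<close>

lemma farkas_cone:
  fixes a :: "nat \<Rightarrow> nat \<Rightarrow> real"
  assumes "\<And>x. (\<forall>i<m. (\<Sum>j<n. a i j * x j) \<le> 0) \<Longrightarrow> (\<Sum>j<n. b j * x j) \<le> 0"
  shows "\<exists>l. (\<forall>i<m. 0 \<le> l i) \<and> (\<forall>j<n. b j = (\<Sum>i<m. l i * a i j))"
  using assms
proof (induction m arbitrary: a b)
  case 0
  have "b j = 0" if "j < n" for j
  proof -
    \<comment> \<open>Without constraints the bound holds at every point; the test point x = b turns
      it into a sum of squares.\<close>
    have "(\<Sum>j<n. b j * b j) \<le> 0" using "0.prems" by simp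
    then have "(\<Sum>j<n. b j * b j) = 0" by (simp add: order_antisym sum_nonneg)
    then show ?thesis using that by (simp add: sum_nonneg_eq_0_iff)
  qed
  then show ?case by simp
next
  case (Suc m)
  show ?case
  \<comment> \<open>If the constraints below \<open>m\<close> already imply the bound, the last
    multiplier is 0. Otherwise a point y witnessing the failure must violate the last constraint,
    and y serves as the direction along which that constraint is eliminated.\<close>
  proof (cases "\<forall>x. (\<forall>i<m. (\<Sum>j<n. a i j * x j) \<le> 0) \<longrightarrow> (\<Sum>j<n. b j * x j) \<le> 0")
    case True
    then obtain l where l: "\<forall>i<m. 0 \<le> l i" "\<forall>j<n. b j = (\<Sum>i<m. l i * a i j)"
      using Suc.IH[of a b] by blast
    then have "\<forall>i<Suc m. 0 \<le> (l(m := 0)) i"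
      "\<forall>j<n. b j = (\<Sum>i<Suc m. (l(m := 0)) i * a i j)"
      by auto
    then show ?thesis by blast
  next
    case False
    then obtain y where y: "\<forall>i<m. (\<Sum>j<n. a i j * y j) \<le> 0" "0 < (\<Sum>j<n. b j * y j)"
      by (auto simp: not_le)
    define c where "c = (\<Sum>j<n. a m j * y j)"
    have c: "c > 0"
    proof (rule ccontr)
      assume "\<not> c > 0"
      then have "\<forall>i<Suc m. (\<Sum>j<n. a i j * y j) \<le> 0"
        using y by (auto simp: less_Suc_eq c_def)
      then show False using Suc.prems y by force
    qed
    define al where "al i = (\<Sum>j<n. a i j * y j) / c" for i
    define be where "be = (\<Sum>j<n. b j * y j) / c"
    \<comment> \<open>The projection along y onto the hyperplane where the last row vanishes. By
      \<open>proj\<close>, composing a functional with it amounts to subtracting the multiple of the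
      last row that makes the functional vanish at y. The induction hypothesis is applied to these
      corrected functionals, since a projected point meets the last constraint with
      equality.\<close>
    let ?x = "\<lambda>x j. x j - (\<Sum>k<n. a m k * x k) / c * y j"
    have proj: "(\<Sum>j<n. (f j - e / c * a m j) * x j) = (\<Sum>j<n. f j * ?x x j)"
      if "e = (\<Sum>j<n. f j * y j)" for f e x
    proof -
      have "(\<Sum>j<n. f j * ?x x j) = (\<Sum>j<n. f j * x j) - (\<Sum>j<n. (\<Sum>k<n. a m k * x k) / c * (f j * y j))"
        by (simp add: sum_subtractf[symmetric] algebra_simps)
      also have "\<dots> = (\<Sum>j<n. f j * x j) - e / c * (\<Sum>k<n. a m k * x k)"
        by (simp only: sum_distrib_left[symmetric] that) simp
      also have "\<dots> = (\<Sum>j<n. (f j - e / c * a m j) * x j)"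
        by (simp add: sum_distrib_left sum_subtractf[symmetric] algebra_simps)
      finally show ?thesis by simp
    qed
    have "\<exists>l. (\<forall>i<m. 0 \<le> l i) \<and> (\<forall>j<n. b j - be * a m j = (\<Sum>i<m. l i * (a i j - al i * a m j)))"
    proof (rule Suc.IH)
      fix x
      assume *: "\<forall>i<m. (\<Sum>j<n. (a i j - al i * a m j) * x j) \<le> 0"
      have "(\<Sum>j<n. a i j * ?x x j) \<le> 0" if "i < Suc m" for i
      proof (cases "i = m")
        case True
        have "(\<Sum>j<n. a m j * ?x x j) = 0"
          using c by (subst proj[OF c_def, symmetric]) simp
        then show ?thesis using True by simp
      next
        case False
        then have "i < m" using that by simp
        then have "(\<Sum>j<n. (a i j - al i * a m j) * x j) \<le> 0" using * by blast
        then show ?thesis unfolding al_def by (subst (asm) proj) auto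
      qed
      then have "(\<Sum>j<n. b j * ?x x j) \<le> 0" by (intro Suc.prems) simp
      then show "(\<Sum>j<n. (b j - be * a m j) * x j) \<le> 0"
        unfolding be_def by (subst proj) auto
    qed
    then obtain l where l: "\<forall>i<m. 0 \<le> l i"
      "\<forall>j<n. b j - be * a m j = (\<Sum>i<m. l i * (a i j - al i * a m j))" by blast
    \<comment> \<open>The last multiplier collects all terms in \<open>a m\<close>. It is positive
      because y meets the constraints below \<open>m\<close>, which makes every \<open>al i\<close>
      nonpositive, and because \<open>be\<close> is positive.\<close>
    define l' where "l' = l(m := be - (\<Sum>i<m. l i * al i))"
    have "(\<Sum>i<m. l i * al i) \<le> 0"
      using l y c by (intro sum_nonpos) (auto simp: al_def mult_nonneg_nonpos divide_nonpos_pos)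
    moreover have "be > 0" using y c by (simp add: be_def)
    ultimately have "\<forall>i<Suc m. 0 \<le> l' i" using l by (auto simp: l'_def less_Suc_eq)
    moreover have "b j = (\<Sum>i<Suc m. l' i * a i j)" if "j < n" for j
    proof -
      have "b j = be * a m j + (\<Sum>i<m. l i * (a i j - al i * a m j))" using l that by force
      then show ?thesis
        by (simp add: l'_def algebra_simps sum_subtractf sum_distrib_left)
    qed
    ultimately show ?thesis by blast
  qed
qed

text \<open>The homogenization \<open>(x, s)\<close> with \<open>G x \<le> s g\<close>, \<open>s \<ge> 0\<close> reduces this to cones; at \<open>s = 0\<close>
  the point \<open>x0\<close> is needed, since then \<open>x0 + k x\<close> stays in the polyhedron for all \<open>k \<ge> 0\<close>.\<close>

lemma farkas_affine:
  fixes G :: "nat \<Rightarrow> nat \<Rightarrow> real"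
  assumes x0: "\<forall>i<m. (\<Sum>j<n. G i j * x0 j) \<le> g i"
    and bound: "\<And>x. (\<forall>i<m. (\<Sum>j<n. G i j * x j) \<le> g i) \<Longrightarrow> (\<Sum>j<n. a j * x j) \<le> \<beta>"
  shows "\<exists>l. (\<forall>i<m. 0 \<le> l i) \<and> (\<forall>j<n. a j = (\<Sum>i<m. l i * G i j)) \<and> (\<Sum>i<m. l i * g i) \<le> \<beta>"
proof -
  \<comment> \<open>Column \<open>n\<close> carries the homogenizing coordinate s and row
    \<open>m\<close> the constraint -s \<le> 0; the rows below \<open>m\<close> read G x - s g \<le>
    0, and the target reads a x - s \<beta> \<le> 0.\<close>
  let ?G = "\<lambda>i j. if i = m then (if j = n then -1 else 0) else if j = n then - g i else G i j"
  let ?a = "\<lambda>j. if j = n then - \<beta> else a j"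
  have "\<exists>l. (\<forall>i<Suc m. 0 \<le> l i) \<and> (\<forall>j<Suc n. ?a j = (\<Sum>i<Suc m. l i * ?G i j))"
  proof (rule farkas_cone)
    fix x
    assume *: "\<forall>i<Suc m. (\<Sum>j<Suc n. ?G i j * x j) \<le> 0"
    have s: "0 \<le> x n" using *[rule_format, of m] by simp
    have row: "(\<Sum>j<n. G i j * x j) \<le> x n * g i" if "i < m" for i
      using *[rule_format, of i] that by (simp add: mult.commute)
    have "(\<Sum>j<n. a j * x j) \<le> x n * \<beta>"
    proof (cases "x n = 0")
      case False
      with s have s: "x n > 0" by simp
      have "(\<Sum>j<n. a j * (x j / x n)) \<le> \<beta>"
        using row s by (intro bound) (simp add: sum_divide_distrib[symmetric] field_simps)
      then show ?thesis using s by (simp add: sum_divide_distrib[symmetric] field_simps)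
    next
      case True
      have ray: "(\<Sum>j<n. a j * x0 j) + k * (\<Sum>j<n. a j * x j) \<le> \<beta>" if "k \<ge> 0" for k
      proof -
        have "(\<Sum>j<n. G i j * (x0 j + k * x j)) \<le> g i" if "i < m" for i
        proof -
          have "k * (\<Sum>j<n. G i j * x j) \<le> 0"
            using row[OF that] True \<open>k \<ge> 0\<close> by (simp add: mult_nonneg_nonpos)
          moreover have "(\<Sum>j<n. G i j * (x0 j + k * x j)) =
              (\<Sum>j<n. G i j * x0 j) + k * (\<Sum>j<n. G i j * x j)"
            by (simp add: sum_distrib_left sum.distrib[symmetric] algebra_simps)
          ultimately show ?thesis using x0 that by force
        qed
        then have "(\<Sum>j<n. a j * (x0 j + k * x j)) \<le> \<beta>" by (intro bound) simp
        then show ?thesis by (simp add: sum_distrib_left sum.distrib[symmetric] algebra_simps)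
      qed
      have "(\<Sum>j<n. a j * x j) \<le> 0"
      proof (rule ccontr)
        let ?s = "\<Sum>j<n. a j * x j" and ?t = "\<beta> - (\<Sum>j<n. a j * x0 j)"
        assume "\<not> ?s \<le> 0"
        then have pos: "?s > 0" by simp
        have "0 \<le> ?t" using ray[of 0] by simp
        \<comment> \<open>This step length along the ray raises the objective by
          \<open>?t + 1\<close>, one more than the gap \<open>?t\<close> that the bound leaves at
          \<open>x0\<close>.\<close>
        then have "((?t + 1) / ?s) * ?s \<le> ?t" using ray[of "(?t + 1) / ?s"] pos by simp
        then show False using pos by simp
      qed
      then show ?thesis using True by simp
    qed
    then show "(\<Sum>j<Suc n. ?a j * x j) \<le> 0" by (simp add: mult.commute)
  qed
  then obtain l where l: "\<forall>i<Suc m. 0 \<le> l i" "\<forall>j<Suc n. ?a j = (\<Sum>i<Suc m. l i * ?G i j)"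
    by blast
  have "a j = (\<Sum>i<m. l i * G i j)" if "j < n" for j
    using l(2)[rule_format, of j] that by simp
  \<comment> \<open>The coefficient of the homogenizing coordinate. The multiplier
    \<open>l m\<close> is exactly the slack in the inequality for \<beta>.\<close>
  moreover have "- \<beta> = - (\<Sum>i<m. l i * g i) - l m"
    using l(2)[rule_format, of n] by (simp add: sum_negf[symmetric])
  then have "(\<Sum>i<m. l i * g i) \<le> \<beta>" using l(1)[rule_format, of m] by simp
  ultimately show ?thesis using l(1) by (intro exI[of _ l]) auto
qed

section \<open>Matrix form of the affine Farkas lemma\<close>

lemma scalar_prod_sum: "v \<bullet> w = (\<Sum>i<dim_vec w. v $ i * w $ i)"
  by (simp add: scalar_prod_def atLeast0LessThan)

lemma mult_mat_vec_sum:
  "A \<in> carrier_mat m n \<Longrightarrow> v \<in> carrier_vec n \<Longrightarrow> i < m \<Longrightarrow> (A *\<^sub>v v) $ i = (\<Sum>j<n. A $$ (i, j) * v $ j)"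
  by (simp add: scalar_prod_sum)

lemma mult_mat_sum:
  "A \<in> carrier_mat m k \<Longrightarrow> B \<in> carrier_mat k n \<Longrightarrow> i < m \<Longrightarrow> j < n \<Longrightarrow>
    (A * B) $$ (i, j) = (\<Sum>l<k. A $$ (i, l) * B $$ (l, j))"
  by (simp add: scalar_prod_sum)

text \<open>Each row of \<open>M x \<le> b\<close> is a scalar bound with multipliers of its own,
  and these rows are collected by choice into \<open>L\<close>. The converse is weak duality: M x =
  L (G x) \<le> L g \<le> b for nonnegative \<open>L\<close>.\<close>

lemma farkas_mat:
  fixes G M :: "real mat"
  assumes G: "G \<in> carrier_mat m n" and g: "g \<in> carrier_vec m"
    and M: "M \<in> carrier_mat p n" and b: "b \<in> carrier_vec p"
    and x0: "x0 \<in> carrier_vec n" "G *\<^sub>v x0 \<le> g"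
  shows "(\<forall>x\<in>carrier_vec n. G *\<^sub>v x \<le> g \<longrightarrow> M *\<^sub>v x \<le> b) \<longleftrightarrow>
    (\<exists>L\<in>carrier_mat p m. 0\<^sub>m p m \<le> L \<and> L * G = M \<and> L *\<^sub>v g \<le> b)"
proof
  assume bound: "\<forall>x\<in>carrier_vec n. G *\<^sub>v x \<le> g \<longrightarrow> M *\<^sub>v x \<le> b"
  have "\<exists>l. (\<forall>i<m. 0 \<le> l i) \<and> (\<forall>j<n. M $$ (k, j) = (\<Sum>i<m. l i * G $$ (i, j))) \<and>
      (\<Sum>i<m. l i * g $ i) \<le> b $ k" if k: "k < p" for k
  proof (rule farkas_affine)
    show "\<forall>i<m. (\<Sum>j<n. G $$ (i, j) * x0 $ j) \<le> g $ i"
      using x0 g unfolding less_eq_vec_def by (auto simp: mult_mat_vec_sum[OF G, symmetric])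
  next
    fix x
    assume *: "\<forall>i<m. (\<Sum>j<n. G $$ (i, j) * x j) \<le> g $ i"
    have "G *\<^sub>v vec n x \<le> g"
      using * G g unfolding less_eq_vec_def by (auto simp: mult_mat_vec_sum[OF G] simp del: index_mult_mat_vec)
    then have "M *\<^sub>v vec n x \<le> b" using bound by simp
    then show "(\<Sum>j<n. M $$ (k, j) * x j) \<le> b $ k"
      using k M b unfolding less_eq_vec_def by (auto simp: mult_mat_vec_sum[OF M] simp del: index_mult_mat_vec)
  qed
  then have "\<forall>k. \<exists>l. k < p \<longrightarrow> (\<forall>i<m. 0 \<le> l i) \<and>
      (\<forall>j<n. M $$ (k, j) = (\<Sum>i<m. l i * G $$ (i, j))) \<and> (\<Sum>i<m. l i * g $ i) \<le> b $ k"
    by blast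
  from choice[OF this] obtain l where l: "\<And>k. k < p \<Longrightarrow> (\<forall>i<m. 0 \<le> l k i) \<and>
      (\<forall>j<n. M $$ (k, j) = (\<Sum>i<m. l k i * G $$ (i, j))) \<and> (\<Sum>i<m. l k i * g $ i) \<le> b $ k"
    by blast
  define L where "L = mat p m (\<lambda>(k, i). l k i)"
  have L: "L \<in> carrier_mat p m" by (simp add: L_def)
  moreover have "0\<^sub>m p m \<le> L" using l by (auto simp: less_eq_mat_def L_def)
  moreover have "L * G = M"
  proof (rule eq_matI)
    fix i j
    assume "i < dim_row M" "j < dim_col M"
    then have ij: "i < p" "j < n" using M by auto
    have "(L * G) $$ (i, j) = (\<Sum>k<m. L $$ (i, k) * G $$ (k, j))" by (rule mult_mat_sum[OF L G ij])
    also have "\<dots> = (\<Sum>k<m. l i k * G $$ (k, j))" using ij by (simp add: L_def)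
    also have "\<dots> = M $$ (i, j)" using l ij by simp
    finally show "(L * G) $$ (i, j) = M $$ (i, j)" .
  qed (use L G M in auto)
  moreover have "L *\<^sub>v g \<le> b"
    using L b l unfolding less_eq_vec_def
    by (auto simp: mult_mat_vec_sum[OF L g] simp del: index_mult_mat_vec) (simp add: L_def)
  ultimately show "\<exists>L\<in>carrier_mat p m. 0\<^sub>m p m \<le> L \<and> L * G = M \<and> L *\<^sub>v g \<le> b" by blast
next
  assume "\<exists>L\<in>carrier_mat p m. 0\<^sub>m p m \<le> L \<and> L * G = M \<and> L *\<^sub>v g \<le> b"
  then obtain L where L: "L \<in> carrier_mat p m" "0\<^sub>m p m \<le> L" "L * G = M" "L *\<^sub>v g \<le> b" by blast
  show "\<forall>x\<in>carrier_vec n. G *\<^sub>v x \<le> g \<longrightarrow> M *\<^sub>v x \<le> b"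
  proof (intro ballI impI)
    fix x
    assume x: "x \<in> carrier_vec n" "G *\<^sub>v x \<le> g"
    have "(M *\<^sub>v x) $ k \<le> b $ k" if k: "k < p" for k
    proof -
      have Gx: "G *\<^sub>v x \<in> carrier_vec m" using G x by simp
      have "(M *\<^sub>v x) $ k = (L *\<^sub>v (G *\<^sub>v x)) $ k"
        using assoc_mult_mat_vec[OF L(1) G x(1)] L(3) by simp
      also have "\<dots> = (\<Sum>i<m. L $$ (k, i) * (G *\<^sub>v x) $ i)" by (rule mult_mat_vec_sum[OF L(1) Gx k])
      also have "\<dots> \<le> (\<Sum>i<m. L $$ (k, i) * g $ i)"
        using L x g k unfolding less_eq_mat_def less_eq_vec_def
        by (intro sum_mono mult_left_mono) auto
      also have "\<dots> = (L *\<^sub>v g) $ k" by (rule mult_mat_vec_sum[OF L(1) g k, symmetric])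
      also have "\<dots> \<le> b $ k" using L(4) b k unfolding less_eq_vec_def by auto
      finally show ?thesis .
    qed
    then show "M *\<^sub>v x \<le> b" using M b unfolding less_eq_vec_def by auto
  qed
qed

text \<open>Moving the constant \<open>L *\<^sub>v c\<close> to the right leaves a linear system
  with matrix \<open>L * E\<close>. In the MILP, \<open>E\<close> is a block row of closed-loop
  maps, \<open>c\<close> is \<open>tilde_z\<close> or \<open>tilde_u\<close>, and \<open>L\<close>
  is the Kronecker product with the constraint matrix.\<close>

lemma multipliers_iff_robust:
  fixes G :: "real mat"
  assumes G: "G \<in> carrier_mat m n" and g: "g \<in> carrier_vec m"
    and E: "E \<in> carrier_mat k n" and L: "L \<in> carrier_mat p k"
    and c: "c \<in> carrier_vec k" and h: "h \<in> carrier_vec p"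
    and x0: "x0 \<in> carrier_vec n" "G *\<^sub>v x0 \<le> g"
  shows "(\<exists>M\<in>carrier_mat p m. 0\<^sub>m p m \<le> M \<and> M * G = L * E \<and> M *\<^sub>v g \<le> h - L *\<^sub>v c) \<longleftrightarrow>
    (\<forall>x\<in>carrier_vec n. G *\<^sub>v x \<le> g \<longrightarrow> L *\<^sub>v (E *\<^sub>v x + c) \<le> h)"
proof -
  have LE: "L * E \<in> carrier_mat p n" by (rule mult_carrier_mat[OF L E])
  have Lc: "L *\<^sub>v c \<in> carrier_vec p" by (rule mult_mat_vec_carrier[OF L c])
  then have hc: "h - L *\<^sub>v c \<in> carrier_vec p" using h by simp
  have "L *\<^sub>v (E *\<^sub>v x + c) \<le> h \<longleftrightarrow> L * E *\<^sub>v x \<le> h - L *\<^sub>v c" if x: "x \<in> carrier_vec n" for x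
  proof -
    have Ex: "E *\<^sub>v x \<in> carrier_vec k" by (rule mult_mat_vec_carrier[OF E x])
    have "L *\<^sub>v (E *\<^sub>v x + c) = L * E *\<^sub>v x + L *\<^sub>v c"
      by (simp only: mult_add_distrib_mat_vec[OF L Ex c] assoc_mult_mat_vec[OF L E x])
    moreover have "a + b \<le> h \<longleftrightarrow> a \<le> h - b" if "a \<in> carrier_vec p" "b \<in> carrier_vec p" for a b
      using that h by (auto simp: less_eq_vec_def algebra_simps)
    ultimately show ?thesis using mult_mat_vec_carrier[OF LE x] Lc by simp
  qed
  then show ?thesis unfolding farkas_mat[OF G g LE hc x0, symmetric] by auto
qed

section \<open>Block vectors and block matrices\<close>

text \<open>The bridge between signals, which are functions of time, and the tall vectors of the
  MILP; \<open>vec_block\<close> undoes it.\<close>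

definition stack :: "nat \<Rightarrow> nat \<Rightarrow> (nat \<Rightarrow> real vec) \<Rightarrow> real vec" where
  "stack n k f = vec (k * n) (\<lambda>i. f (i div n) $ (i mod n))"

text \<open>The dimension is built in, so membership in the carrier holds without conditions on the
  summands, and every identity reduces to one about real sums.\<close>

definition vsum :: "nat \<Rightarrow> nat \<Rightarrow> (nat \<Rightarrow> real vec) \<Rightarrow> real vec" where
  "vsum n k f = vec n (\<lambda>i. \<Sum>j<k. f j $ i)"

lemma vsum_carrier[simp]: "vsum n k f \<in> carrier_vec n" "dim_vec (vsum n k f) = n"
  by (simp_all add: vsum_def)

lemma stack_carrier[simp]: "stack n k f \<in> carrier_vec (k * n)" "dim_vec (stack n k f) = k * n"
  by (simp_all add: stack_def)

lemma of_blocks_carrier[simp]: "of_blocks p q nr nc X \<in> carrier_mat (p * nr) (q * nc)"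
  "dim_row (of_blocks p q nr nc X) = p * nr" "dim_col (of_blocks p q nr nc X) = q * nc"
  by (simp_all add: of_blocks_def)

lemma block_index_less: "t < k \<Longrightarrow> a < n \<Longrightarrow> t * n + a < k * (n::nat)"
  by (metis add.commute div_less_iff_less_mult div_mult_self3 div_less gr_implies_not0 add_0 not_gr0)

lemma block_div_mod: "a < n \<Longrightarrow> (t * n + a) div n = t" "a < n \<Longrightarrow> (t * n + a) mod n = (a::nat)"
  by simp_all

text \<open>Entrywise arguments can then run over a block number and an offset, the form
  \<open>t * n + a\<close> in which the index rules are stated. That the block size is positive
  follows from the mere existence of \<open>i\<close>.\<close>

lemma block_cases:
  assumes "i < k * (n::nat)"
  obtains t a where "t < k" "a < n" "i = t * n + a"
proof
  have "n > 0" using assms by (cases n) auto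
  then show "i div n < k" "i mod n < n" "i = i div n * n + i mod n"
    using assms by (simp_all add: less_mult_imp_div_less)
qed

lemma stack_index[simp]: "t < k \<Longrightarrow> a < n \<Longrightarrow> stack n k f $ (t * n + a) = f t $ a"
  by (simp add: stack_def block_index_less)

lemma of_blocks_index[simp]:
  "i < p \<Longrightarrow> a < nr \<Longrightarrow> j < q \<Longrightarrow> b < nc \<Longrightarrow>
    of_blocks p q nr nc X $$ (i * nr + a, j * nc + b) = X i j $$ (a, b)"
  by (simp add: of_blocks_def block_index_less)

lemma eq_vec_blocksI:
  assumes "v \<in> carrier_vec (k * n)" "w \<in> carrier_vec (k * n)"
    and "\<And>t a. t < k \<Longrightarrow> a < n \<Longrightarrow> v $ (t * n + a) = w $ (t * n + a)"
  shows "v = w"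
proof (rule eq_vecI)
  fix i assume "i < dim_vec w"
  then have "i < k * n" using assms by simp
  then show "v $ i = w $ i" by (rule block_cases) (simp add: assms)
qed (use assms in simp)

lemma eq_mat_blocksI:
  assumes "A \<in> carrier_mat (p * nr) (q * nc)" "B \<in> carrier_mat (p * nr) (q * nc)"
    and "\<And>i a j b. i < p \<Longrightarrow> a < nr \<Longrightarrow> j < q \<Longrightarrow> b < nc \<Longrightarrow>
      A $$ (i * nr + a, j * nc + b) = B $$ (i * nr + a, j * nc + b)"
  shows "A = B"
proof (rule eq_matI)
  fix i j assume ij: "i < dim_row B" "j < dim_col B"
  then have "i < p * nr" "j < q * nc" using assms by auto
  then obtain i' a j' b where "i' < p" "a < nr" "i = i' * nr + a" "j' < q" "b < nc" "j = j' * nc + b"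
    by (meson block_cases)
  then show "A $$ (i, j) = B $$ (i, j)" using assms by simp
qed (use assms in auto)

lemma sum_blocks: "(\<Sum>i<k * n. g i) = (\<Sum>t<k. \<Sum>a<n. g (t * n + a))" for g :: "nat \<Rightarrow> real"
proof -
  have "sum g {t * n..<t * n + n} = (\<Sum>a<n. g (t * n + a))" for t
    using sum.shift_bounds_nat_ivl[of g 0 "t * n" n] by (simp add: atLeast0LessThan add.commute)
  then show ?thesis by (simp add: sum.nat_group[symmetric])
qed

lemma of_blocks_mult_stack:
  assumes "\<And>i j. i < p \<Longrightarrow> j < q \<Longrightarrow> X i j \<in> carrier_mat nr nc"
    and "\<And>j. j < q \<Longrightarrow> f j \<in> carrier_vec nc"
  shows "of_blocks p q nr nc X *\<^sub>v stack nc q f = stack nr p (\<lambda>i. vsum nr q (\<lambda>j. X i j *\<^sub>v f j))"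
proof (rule eq_vec_blocksI)
  fix i a assume i: "i < p" "a < nr"
  have "(of_blocks p q nr nc X *\<^sub>v stack nc q f) $ (i * nr + a) =
      (\<Sum>l<q * nc. of_blocks p q nr nc X $$ (i * nr + a, l) * stack nc q f $ l)"
    by (rule mult_mat_vec_sum[where m = "p * nr"]) (simp_all add: i block_index_less)
  also have "\<dots> = (\<Sum>j<q. \<Sum>b<nc. X i j $$ (a, b) * f j $ b)"
    by (simp add: sum_blocks i)
  also have "\<dots> = (\<Sum>j<q. (X i j *\<^sub>v f j) $ a)"
    using assms i by (intro sum.cong refl mult_mat_vec_sum[symmetric]) auto
  finally show "(of_blocks p q nr nc X *\<^sub>v stack nc q f) $ (i * nr + a) =
      stack nr p (\<lambda>i. vsum nr q (\<lambda>j. X i j *\<^sub>v f j)) $ (i * nr + a)"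
    using i by (simp add: vsum_def)
qed (rule mult_mat_vec_carrier[OF of_blocks_carrier(1) stack_carrier(1)], rule stack_carrier(1))

lemma vsum_delta:
  assumes "f i \<in> carrier_vec n"
  shows "vsum n k (\<lambda>j. if i = j then f j else 0\<^sub>v n) = (if i < k then f i else 0\<^sub>v n)"
proof (rule eq_vecI)
  fix a assume "a < dim_vec (if i < k then f i else 0\<^sub>v n)"
  then have a: "a < n" using assms by (auto split: if_splits)
  then have "(\<Sum>j<k. (if i = j then f j else 0\<^sub>v n) $ a) = (\<Sum>j<k. if i = j then f j $ a else 0)"
    by (intro sum.cong) auto
  then show "vsum n k (\<lambda>j. if i = j then f j else 0\<^sub>v n) $ a = (if i < k then f i else 0\<^sub>v n) $ a"
    using a by (simp add: vsum_def)
qed (use assms in auto)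

lemma vsum_cong: "(\<And>j. j < k \<Longrightarrow> f j = g j) \<Longrightarrow> vsum n k f = vsum n k g"
  by (simp add: vsum_def)

lemma stack_cong: "(\<And>j. j < k \<Longrightarrow> f j = g j) \<Longrightarrow> stack n k f = stack n k g"
  by (rule eq_vec_blocksI[of _ k n]) auto

section \<open>Kronecker products with the identity as block diagonal matrices\<close>

lemma kron_one_of_blocks:
  assumes "C \<in> carrier_mat nr nc"
  shows "1\<^sub>m k \<otimes>\<^sub>m C = of_blocks k k nr nc (\<lambda>i j. if i = j then C else 0\<^sub>m nr nc)"
  using assms by (intro eq_mat_blocksI) (auto simp: kron_mat_def block_index_less)

text \<open>The rectangular case \<open>p \<le> q\<close> is there for \<open>bar_C\<close>: it has
  one block column more than block rows, because the final state is not measured.\<close>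

lemma block_diag_mult_stack:
  assumes C: "C \<in> carrier_mat nr nc" and f: "\<And>j. j < q \<Longrightarrow> f j \<in> carrier_vec nc" and "p \<le> q"
  shows "of_blocks p q nr nc (\<lambda>i j. if i = j then C else 0\<^sub>m nr nc) *\<^sub>v stack nc q f =
    stack nr p (\<lambda>t. C *\<^sub>v f t)"
proof -
  have "of_blocks p q nr nc (\<lambda>i j. if i = j then C else 0\<^sub>m nr nc) *\<^sub>v stack nc q f =
      stack nr p (\<lambda>i. vsum nr q (\<lambda>j. (if i = j then C else 0\<^sub>m nr nc) *\<^sub>v f j))"
    using assms by (intro of_blocks_mult_stack) auto
  also have "\<dots> = stack nr p (\<lambda>t. C *\<^sub>v f t)"
  proof (rule stack_cong)
    fix i assume i: "i < p"
    have "vsum nr q (\<lambda>j. (if i = j then C else 0\<^sub>m nr nc) *\<^sub>v f j) =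
        vsum nr q (\<lambda>j. if i = j then C *\<^sub>v f j else 0\<^sub>v nr)"
      using f by (intro vsum_cong) auto
    also have "\<dots> = C *\<^sub>v f i" using i assms by (subst vsum_delta) auto
    finally show "vsum nr q (\<lambda>j. (if i = j then C else 0\<^sub>m nr nc) *\<^sub>v f j) = C *\<^sub>v f i" .
  qed
  finally show ?thesis .
qed

lemma kron_one_mult_stack:
  assumes "C \<in> carrier_mat nr nc" "\<And>j. j < k \<Longrightarrow> f j \<in> carrier_vec nc"
  shows "(1\<^sub>m k \<otimes>\<^sub>m C) *\<^sub>v stack nc k f = stack nr k (\<lambda>t. C *\<^sub>v f t)"
  using assms by (simp add: kron_one_of_blocks block_diag_mult_stack)

lemma kron_ones_stack: "ones_vec k \<otimes>\<^sub>v h = stack (dim_vec h) k (\<lambda>_. h)"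
proof (rule eq_vec_blocksI[of _ k "dim_vec h"])
  fix t a assume "t < k" "a < dim_vec h"
  then show "(ones_vec k \<otimes>\<^sub>v h) $ (t * dim_vec h + a) = stack (dim_vec h) k (\<lambda>_. h) $ (t * dim_vec h + a)"
    by (simp add: kron_vec_def ones_vec_def block_index_less block_div_mod)
qed (rule carrier_vecI, simp add: kron_vec_def ones_vec_def)+

lemma stack_le_iff:
  assumes "\<And>t. t < k \<Longrightarrow> f t \<in> carrier_vec n" "\<And>t. t < k \<Longrightarrow> g t \<in> carrier_vec n"
  shows "stack n k f \<le> stack n k g \<longleftrightarrow> (\<forall>t<k. f t \<le> g t)"
proof
  assume *: "stack n k f \<le> stack n k g"
  have "f t $ a \<le> g t $ a" if "t < k" "a < n" for t a
    using * that block_index_less[OF that] unfolding less_eq_vec_def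
    by (metis stack_index stack_carrier(2))
  moreover have "dim_vec (f t) = n" "dim_vec (g t) = n" if "t < k" for t
    using assms that by auto
  ultimately show "\<forall>t<k. f t \<le> g t" by (simp add: less_eq_vec_def)
next
  assume *: "\<forall>t<k. f t \<le> g t"
  have "stack n k f $ i \<le> stack n k g $ i" if i: "i < k * n" for i
  proof (rule block_cases[OF i])
    fix t a assume t: "t < k" "a < n" "i = t * n + a"
    then have "f t $ a \<le> g t $ a" using *[rule_format, of t] assms(2)[of t] by (auto simp: less_eq_vec_def)
    then show ?thesis using t by simp
  qed
  then show "stack n k f \<le> stack n k g" by (simp add: less_eq_vec_def)
qed

section \<open>Blocks of vectors and of matrices, and their entries\<close>

lemma vec_block_index: "a < n \<Longrightarrow> vec_block n t v $ a = v $ (t * n + a)"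
  by (simp add: vec_block_def)

lemma vec_block_carrier[simp]: "vec_block n t v \<in> carrier_vec n" "dim_vec (vec_block n t v) = n"
  by (simp_all add: vec_block_def)

lemma vec_block_stack: "t < k \<Longrightarrow> f t \<in> carrier_vec n \<Longrightarrow> vec_block n t (stack n k f) = f t"
  by (rule eq_vecI) (auto simp: vec_block_index)

lemma stack_vec_block: "v \<in> carrier_vec (k * n) \<Longrightarrow> stack n k (\<lambda>t. vec_block n t v) = v"
  by (rule eq_vec_blocksI) (auto simp: vec_block_index)

lemma stack_add:
  assumes "\<And>t. t < k \<Longrightarrow> g t \<in> carrier_vec n"
  shows "stack n k f + stack n k g = stack n k (\<lambda>t. f t + g t)"
proof (rule eq_vec_blocksI[of _ k n])
  fix t a assume ta: "t < k" "a < n"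
  then have "a < dim_vec (g t)" using assms[of t] by auto
  then show "(stack n k f + stack n k g) $ (t * n + a) = stack n k (\<lambda>t. f t + g t) $ (t * n + a)"
    using ta by (simp add: block_index_less)
qed simp_all

lemma stack_one: "v \<in> carrier_vec n \<Longrightarrow> stack n 1 (\<lambda>_. v) = v"
  by (rule eq_vecI) (auto simp: stack_def)

text \<open>\<open>pick\<close> enumerates a set in increasing order. A block is an interval, so
  exactly \<open>i\<close> of its elements lie below \<open>t * n + i\<close>, and this count
  determines the position.\<close>

lemma pick_block_idx:
  assumes "i < n"
  shows "pick (block_idx n t) i = t * n + i"
proof -
  have "{a \<in> block_idx n t. a < t * n + i} = {t * n..<t * n + i}"
    using assms by (auto simp: block_idx_def)
  then have "card {a \<in> block_idx n t. a < t * n + i} = i" by simp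
  moreover have "t * n + i \<in> block_idx n t" using assms by (simp add: block_idx_def)
  ultimately show ?thesis using pick_card_in_set by metis
qed

lemma card_block_idx:
  assumes "t < k"
  shows "card {i. i < k * n \<and> i \<in> block_idx n t} = n"
proof -
  have "t * n + n \<le> k * n" using assms mult_le_mono1[of "Suc t" k n] by simp
  then have "{i. i < k * n \<and> i \<in> block_idx n t} = {t * n..<t * n + n}"
    by (auto simp: block_idx_def)
  then show ?thesis by simp
qed

lemma mat_block_carrier:
  "M \<in> carrier_mat (p * nr) (q * nc) \<Longrightarrow> i < p \<Longrightarrow> j < q \<Longrightarrow> mat_block nr nc i j M \<in> carrier_mat nr nc"
  by (rule carrier_matI) (auto simp: mat_block_def dim_submatrix card_block_idx)

lemma mat_block_index:
  "M \<in> carrier_mat (p * nr) (q * nc) \<Longrightarrow> i < p \<Longrightarrow> j < q \<Longrightarrow> a < nr \<Longrightarrow> b < nc \<Longrightarrow>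
    mat_block nr nc i j M $$ (a, b) = M $$ (i * nr + a, j * nc + b)"
  unfolding mat_block_def
  by (subst submatrix_index) (auto simp: card_block_idx pick_block_idx)

lemma mat_block_of_blocks:
  "i < p \<Longrightarrow> j < q \<Longrightarrow> X i j \<in> carrier_mat nr nc \<Longrightarrow>
    mat_block nr nc i j (of_blocks p q nr nc X) = X i j"
  using mat_block_carrier[OF of_blocks_carrier(1), of i p j q nr nc X]
  by (intro eq_matI) (auto simp: mat_block_index[OF of_blocks_carrier(1)])

lemma of_blocks_mat_block:
  "M \<in> carrier_mat (p * nr) (q * nc) \<Longrightarrow> of_blocks p q nr nc (\<lambda>i j. mat_block nr nc i j M) = M"
  by (rule eq_mat_blocksI) (auto simp: mat_block_index)

lemma block_column_zero_iff:
  assumes M: "M \<in> carrier_mat m (q * nc)" and j: "j < q"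
  shows "submatrix M UNIV (block_idx nc j) = 0\<^sub>m m nc \<longleftrightarrow>
    (\<forall>i<m. \<forall>b<nc. M $$ (i, j * nc + b) = 0)"
proof -
  have ix: "submatrix M UNIV (block_idx nc j) $$ (i, b) = M $$ (i, j * nc + b)" if "i < m" "b < nc" for i b
    using that M j by (subst submatrix_index) (auto simp: card_block_idx pick_block_idx pick_UNIV)
  have "submatrix M UNIV (block_idx nc j) \<in> carrier_mat m nc"
    using M j by (intro carrier_matI) (auto simp: dim_submatrix card_block_idx)
  then show ?thesis using ix by (subst mat_eq_iff) auto
qed

lemma block_row_carrier:
  "M \<in> carrier_mat (p * nr) n \<Longrightarrow> i < p \<Longrightarrow> submatrix M (block_idx nr i) UNIV \<in> carrier_mat nr n"
  by (rule carrier_matI) (auto simp: dim_submatrix card_block_idx)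

lemma block_row_index:
  "M \<in> carrier_mat (p * nr) n \<Longrightarrow> i < p \<Longrightarrow> a < nr \<Longrightarrow> j < n \<Longrightarrow>
    submatrix M (block_idx nr i) UNIV $$ (a, j) = M $$ (i * nr + a, j)"
  by (subst submatrix_index) (auto simp: card_block_idx pick_block_idx pick_UNIV)

lemma block_row_zero_iff:
  assumes "M \<in> carrier_mat (p * nr) n" "i < p"
  shows "submatrix M (block_idx nr i) UNIV = 0\<^sub>m nr n \<longleftrightarrow>
    (\<forall>a<nr. \<forall>j<n. M $$ (i * nr + a, j) = 0)"
  using block_row_carrier[OF assms] block_row_index[OF assms] by (subst mat_eq_iff) auto

lemma block_row_eq_iff:
  assumes "M \<in> carrier_mat (p * nr) n" "i < p" "i' < p"
  shows "submatrix M (block_idx nr i) UNIV = submatrix M (block_idx nr i') UNIV \<longleftrightarrow>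
    (\<forall>a<nr. \<forall>j<n. M $$ (i * nr + a, j) = M $$ (i' * nr + a, j))"
  using block_row_carrier[OF assms(1,2)] block_row_carrier[OF assms(1,3)]
  by (subst mat_eq_iff) (auto simp: block_row_index[OF assms(1,2)] block_row_index[OF assms(1,3)])

section \<open>Sums, powers and concatenations needed for the stacked dynamics\<close>

lemma mult_vsum:
  assumes A: "A \<in> carrier_mat m n" and f: "\<And>j. j < k \<Longrightarrow> f j \<in> carrier_vec n"
  shows "A *\<^sub>v vsum n k f = vsum m k (\<lambda>j. A *\<^sub>v f j)"
proof (rule eq_vecI)
  fix i assume "i < dim_vec (vsum m k (\<lambda>j. A *\<^sub>v f j))"
  then have i: "i < m" by simp
  have "(A *\<^sub>v vsum n k f) $ i = (\<Sum>l<n. A $$ (i, l) * (\<Sum>j<k. f j $ l))"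
    unfolding mult_mat_vec_sum[OF A vsum_carrier(1) i] by (intro sum.cong) (auto simp: vsum_def)
  also have "\<dots> = (\<Sum>j<k. \<Sum>l<n. A $$ (i, l) * f j $ l)"
    by (subst sum.swap) (simp add: sum_distrib_left)
  also have "\<dots> = (\<Sum>j<k. (A *\<^sub>v f j) $ i)"
    using f by (intro sum.cong refl mult_mat_vec_sum[OF A _ i, symmetric]) auto
  finally show "(A *\<^sub>v vsum n k f) $ i = vsum m k (\<lambda>j. A *\<^sub>v f j) $ i"
    using i by (simp add: vsum_def)
qed (use A in auto)

lemma vsum_add:
  assumes "\<And>j. j < k \<Longrightarrow> g j \<in> carrier_vec n"
  shows "vsum n k f + vsum n k g = vsum n k (\<lambda>j. f j + g j)"
proof (rule eq_vecI)
  fix i assume "i < dim_vec (vsum n k (\<lambda>j. f j + g j))"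
  then have i: "i < n" by simp
  have "(f j + g j) $ i = f j $ i + g j $ i" if "j < k" for j
    using assms[OF that] i by simp
  then show "(vsum n k f + vsum n k g) $ i = vsum n k (\<lambda>j. f j + g j) $ i"
    using i by (simp add: vsum_def sum.distrib)
qed simp

text \<open>Matrix powers unfold by a factor on the right, whereas one step of the dynamics
  multiplies from the left.\<close>

lemma pow_mat_Suc_left:
  fixes A :: "real mat"
  assumes A: "A \<in> carrier_mat n n"
  shows "A * A ^\<^sub>m k = A ^\<^sub>m Suc k"
proof (induction k)
  case 0
  then show ?case using A by simp
next
  case (Suc k)
  have "A * A ^\<^sub>m Suc k = A * A ^\<^sub>m k * A" using A by (simp add: assoc_mult_mat[of _ n n _ n _ n])
  then show ?case using Suc by simp
qed

lemma append_cols_carrier[simp]: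
  "A \<in> carrier_mat m n \<Longrightarrow> B \<in> carrier_mat m k \<Longrightarrow> A @\<^sub>c B \<in> carrier_mat m (n + k)"
  unfolding append_cols_def by (rule carrier_matI) auto

lemma append_cols_mult_vec:
  assumes "A \<in> carrier_mat m n" "B \<in> carrier_mat m k" "a \<in> carrier_vec n" "b \<in> carrier_vec k"
  shows "(A @\<^sub>c B) *\<^sub>v (a @\<^sub>v b) = A *\<^sub>v a + B *\<^sub>v b"
proof -
  have "(A @\<^sub>c B) *\<^sub>v (a @\<^sub>v b) = (A *\<^sub>v a + B *\<^sub>v b) @\<^sub>v (0\<^sub>m 0 n *\<^sub>v a + 0\<^sub>m 0 k *\<^sub>v b)"
    unfolding append_cols_def using assms by (subst four_block_mat_mult_vec) auto
  also have "\<dots> = A *\<^sub>v a + B *\<^sub>v b" using assms by (intro eq_vecI) auto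
  finally show ?thesis .
qed

text \<open>The appended zeros form block column \<open>k\<close>. No row index \<open>i < k\<close>
  equals it, so the single rule \<open>i = j\<close> describes both parts.\<close>

lemma append_cols_zero_of_blocks:
  assumes "C \<in> carrier_mat nr nc"
  shows "(1\<^sub>m k \<otimes>\<^sub>m C) @\<^sub>c 0\<^sub>m (k * nr) nc =
    of_blocks k (k + 1) nr nc (\<lambda>i j. if i = j then C else 0\<^sub>m nr nc)"
proof (rule eq_mat_blocksI)
  have D: "1\<^sub>m k \<otimes>\<^sub>m C \<in> carrier_mat (k * nr) (k * nc)"
    unfolding kron_one_of_blocks[OF assms] by simp
  then have "(1\<^sub>m k \<otimes>\<^sub>m C) @\<^sub>c 0\<^sub>m (k * nr) nc \<in> carrier_mat (k * nr) (k * nc + nc)" by simp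
  then show "(1\<^sub>m k \<otimes>\<^sub>m C) @\<^sub>c 0\<^sub>m (k * nr) nc \<in> carrier_mat (k * nr) ((k + 1) * nc)"
    by (simp add: add.commute)
  fix i a j b assume ix: "i < k" "a < nr" "j < k + 1" "b < nc"
  have r: "i * nr + a < k * nr" using ix by (simp add: block_index_less)
  have c: "j * nc + b < k * nc + nc" using ix block_index_less[of j "k + 1" b nc] by (simp add: add.commute)
  show "((1\<^sub>m k \<otimes>\<^sub>m C) @\<^sub>c 0\<^sub>m (k * nr) nc) $$ (i * nr + a, j * nc + b) =
      of_blocks k (k + 1) nr nc (\<lambda>i j. if i = j then C else 0\<^sub>m nr nc) $$ (i * nr + a, j * nc + b)"
  proof (cases "j < k")
    case True
    then have "j * nc + b < k * nc" using ix by (simp add: block_index_less)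
    then have "((1\<^sub>m k \<otimes>\<^sub>m C) @\<^sub>c 0\<^sub>m (k * nr) nc) $$ (i * nr + a, j * nc + b) =
        (1\<^sub>m k \<otimes>\<^sub>m C) $$ (i * nr + a, j * nc + b)"
      using D r c unfolding append_cols_def by (subst index_mat_four_block) auto
    then show ?thesis unfolding kron_one_of_blocks[OF assms] using ix True by simp
  next
    case False
    then have j: "j = k" using ix by simp
    have "((1\<^sub>m k \<otimes>\<^sub>m C) @\<^sub>c 0\<^sub>m (k * nr) nc) $$ (i * nr + a, j * nc + b) = 0"
      using D r c j ix unfolding append_cols_def by (subst index_mat_four_block) auto
    then show ?thesis using ix j by simp
  qed
qed (rule of_blocks_carrier(1))

text \<open>Variation of constants. The sum has fixed length \<open>k\<close>, with zero matrices
  for \<open>j \<ge> t\<close>, so that its terms match a full block row of \<open>mat_H\<close> or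
  \<open>mat_S\<close>; the truncated subtraction \<open>t - 1 - j\<close> is evaluated only for
  \<open>j < t\<close>.\<close>

lemma linear_recurrence_solution:
  fixes A :: "real mat"
  assumes A: "A \<in> carrier_mat n n" and e: "\<And>j. j < k \<Longrightarrow> e j \<in> carrier_vec n"
    and x0: "x 0 \<in> carrier_vec n" and step: "\<And>t. t < k \<Longrightarrow> x (Suc t) = A *\<^sub>v x t + e t"
    and "t \<le> k"
  shows "x t = A ^\<^sub>m t *\<^sub>v x 0 +
    vsum n k (\<lambda>j. (if t > j then A ^\<^sub>m (t - 1 - j) else 0\<^sub>m n n) *\<^sub>v e j)"
  using \<open>t \<le> k\<close>
proof (induction t)
  case 0
  have "vsum n k (\<lambda>j. 0\<^sub>m n n *\<^sub>v e j) = 0\<^sub>v n" using e by (intro eq_vecI) (auto simp: vsum_def)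
  then show ?case using A x0 by simp
next
  case (Suc t)
  let ?\<Phi> = "\<lambda>t j. if t > j then A ^\<^sub>m (t - 1 - j) else 0\<^sub>m n n"
  have \<Phi>: "?\<Phi> t j \<in> carrier_mat n n" for t j using A by simp
  \<comment> \<open>The newest input is written as a sum with a single nonzero term, so that it can
    be merged termwise with the propagated older inputs.\<close>
  have et: "vsum n k (\<lambda>j. if t = j then e j else 0\<^sub>v n) = e t"
    using Suc.prems e by (subst vsum_delta) auto
  have At: "A ^\<^sub>m t *\<^sub>v x 0 \<in> carrier_vec n" using A x0 by (intro mult_mat_vec_carrier[of _ n n]) auto
  have "x (Suc t) = A *\<^sub>v x t + e t" using step Suc.prems by simp
  also have "A *\<^sub>v x t = A *\<^sub>v (A ^\<^sub>m t *\<^sub>v x 0) + A *\<^sub>v vsum n k (\<lambda>j. ?\<Phi> t j *\<^sub>v e j)"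
    using Suc mult_add_distrib_mat_vec[OF A At vsum_carrier(1)] by simp
  also have "A *\<^sub>v (A ^\<^sub>m t *\<^sub>v x 0) = A ^\<^sub>m Suc t *\<^sub>v x 0"
    using A x0 assoc_mult_mat_vec[of A n n "A ^\<^sub>m t" n "x 0"] pow_mat_Suc_left[OF A, of t] by simp
  also have "A *\<^sub>v vsum n k (\<lambda>j. ?\<Phi> t j *\<^sub>v e j) = vsum n k (\<lambda>j. A *\<^sub>v (?\<Phi> t j *\<^sub>v e j))"
    using A e \<Phi> by (intro mult_vsum) (auto intro: mult_mat_vec_carrier[of _ n n])
  also have "A ^\<^sub>m Suc t *\<^sub>v x 0 + vsum n k (\<lambda>j. A *\<^sub>v (?\<Phi> t j *\<^sub>v e j)) + e t =
      A ^\<^sub>m Suc t *\<^sub>v x 0 + (vsum n k (\<lambda>j. A *\<^sub>v (?\<Phi> t j *\<^sub>v e j)) + e t)"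
    using A x0 e Suc.prems
    by (intro assoc_add_vec[of _ n]) (auto intro!: mult_mat_vec_carrier[of _ n n] pow_carrier_mat simp del: pow_mat.simps)
  also have "vsum n k (\<lambda>j. A *\<^sub>v (?\<Phi> t j *\<^sub>v e j)) + e t =
      vsum n k (\<lambda>j. A *\<^sub>v (?\<Phi> t j *\<^sub>v e j) + (if t = j then e j else 0\<^sub>v n))"
    by (subst et[symmetric], rule vsum_add) (use e in auto)
  also have "\<dots> = vsum n k (\<lambda>j. ?\<Phi> (Suc t) j *\<^sub>v e j)"
  proof (rule vsum_cong)
    fix j assume j: "j < k"
    have as: "A *\<^sub>v (?\<Phi> t j *\<^sub>v e j) = (A * ?\<Phi> t j) *\<^sub>v e j"
      using assoc_mult_mat_vec[OF A \<Phi> e[OF j]] by simp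
    have zero: "0\<^sub>m n n *\<^sub>v e j = 0\<^sub>v n" "A *\<^sub>v 0\<^sub>v n = 0\<^sub>v n"
      using A e[OF j] by (intro eq_vecI; auto)+
    consider "j < t" | "j = t" | "j > t" by linarith
    then show "A *\<^sub>v (?\<Phi> t j *\<^sub>v e j) + (if t = j then e j else 0\<^sub>v n) = ?\<Phi> (Suc t) j *\<^sub>v e j"
    proof cases
      case 1
      then have "Suc (t - 1 - j) = t - j" by simp
      then have "A * A ^\<^sub>m (t - 1 - j) = A ^\<^sub>m (t - j)" using pow_mat_Suc_left[OF A] by metis
      then have "A *\<^sub>v (?\<Phi> t j *\<^sub>v e j) = A ^\<^sub>m (t - j) *\<^sub>v e j" using as 1 by simp
      moreover have "A ^\<^sub>m (t - j) *\<^sub>v e j \<in> carrier_vec n"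
        using A e[OF j] by (intro mult_mat_vec_carrier[of _ n n]) auto
      ultimately show ?thesis using 1 by simp
    next
      case 2
      then show ?thesis using A e[OF j] zero by simp
    next
      case 3
      then show ?thesis using A e[OF j] by (simp add: zero)
    qed
  qed
  finally show ?case .
qed

lemma polyhedron_stack_iff:
  assumes p: "is_hrep n p" and u: "\<And>t. t < k \<Longrightarrow> u t \<in> carrier_vec n"
  shows "(\<forall>t<k. u t \<in> polyhedron n p) \<longleftrightarrow>
    (1\<^sub>m k \<otimes>\<^sub>m fst p) *\<^sub>v stack n k u \<le> ones_vec k \<otimes>\<^sub>v snd p"
proof -
  have H: "fst p \<in> carrier_mat (dim_vec (snd p)) n" using p by (simp add: is_hrep_def)
  have "stack (dim_vec (snd p)) k (\<lambda>t. fst p *\<^sub>v u t) \<le> stack (dim_vec (snd p)) k (\<lambda>_. snd p) \<longleftrightarrow>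
      (\<forall>t<k. fst p *\<^sub>v u t \<le> snd p)"
    using H u by (intro stack_le_iff) (auto intro: mult_mat_vec_carrier carrier_vecI)
  moreover have "(1\<^sub>m k \<otimes>\<^sub>m fst p) *\<^sub>v stack n k u = stack (dim_vec (snd p)) k (\<lambda>t. fst p *\<^sub>v u t)"
    using u by (intro kron_one_mult_stack[OF H])
  ultimately show ?thesis unfolding kron_ones_stack using u by (auto simp: polyhedron_def)
qed

lemma kron_hrep_carrier:
  assumes "is_hrep n p"
  shows "1\<^sub>m k \<otimes>\<^sub>m fst p \<in> carrier_mat (k * nrows p) (k * n)" "ones_vec k \<otimes>\<^sub>v snd p \<in> carrier_vec (k * nrows p)"
proof -
  have H: "fst p \<in> carrier_mat (nrows p) n" "dim_vec (snd p) = nrows p"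
    using assms by (auto simp: is_hrep_def)
  show "1\<^sub>m k \<otimes>\<^sub>m fst p \<in> carrier_mat (k * nrows p) (k * n)"
    unfolding kron_one_of_blocks[OF H(1)] by (rule of_blocks_carrier)
  show "ones_vec k \<otimes>\<^sub>v snd p \<in> carrier_vec (k * nrows p)"
    unfolding kron_ones_stack H(2) by (rule stack_carrier)
qed

section \<open>Closing a causal feedback loop\<close>

text \<open>Block triangularity in terms of flat indices: \<open>i div a\<close> and
  \<open>j div b\<close> are the block times. No number of blocks is fixed, so rectangular matrices
  such as \<open>bar_C\<close> are covered.\<close>

definition causal :: "nat \<Rightarrow> nat \<Rightarrow> real mat \<Rightarrow> bool" where
  "causal a b M \<longleftrightarrow> (\<forall>i<dim_row M. \<forall>j<dim_col M. i div a < j div b \<longrightarrow> M $$ (i, j) = 0)"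

text \<open>The diagonal blocks vanish as well, which models a delay of at least one step.\<close>

definition strictly_causal :: "nat \<Rightarrow> nat \<Rightarrow> real mat \<Rightarrow> bool" where
  "strictly_causal a b M \<longleftrightarrow> (\<forall>i<dim_row M. \<forall>j<dim_col M. i div a \<le> j div b \<longrightarrow> M $$ (i, j) = 0)"

lemma block_lower_triangular_iff_causal:
  "block_lower_triangular k a b M \<longleftrightarrow> M \<in> carrier_mat (k * a) (k * b) \<and> causal a b M"
proof (cases "M \<in> carrier_mat (k * a) (k * b)")
  case M: True
  have "mat_block a b t s M = 0\<^sub>m a b \<longleftrightarrow> (\<forall>i<a. \<forall>j<b. M $$ (t * a + i, s * b + j) = 0)"
    if "t < k" "s < k" for t s
    using that mat_block_carrier[OF M that] by (subst mat_eq_iff) (auto simp: mat_block_index[OF M])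
  moreover have "causal a b M \<longleftrightarrow>
      (\<forall>t<k. \<forall>s<k. t < s \<longrightarrow> (\<forall>i<a. \<forall>j<b. M $$ (t * a + i, s * b + j) = 0))" (is "_ \<longleftrightarrow> ?blocks")
  proof
    assume "causal a b M"
    then show ?blocks using M unfolding causal_def by (auto simp: block_index_less)
  next
    assume *: ?blocks
    have "M $$ (i, j) = 0" if ij: "i < k * a" "j < k * b" "i div a < j div b" for i j
    proof -
      obtain t i' s j' where "t < k" "i' < a" "i = t * a + i'" "s < k" "j' < b" "j = s * b + j'"
        using ij by (meson block_cases)
      then show ?thesis using * ij by simp
    qed
    then show "causal a b M" using M unfolding causal_def by auto
  qed
  ultimately show ?thesis using M unfolding block_lower_triangular_def by auto
qed (simp add: block_lower_triangular_def)

text \<open>An intermediate index \<open>l\<close> either lies in a later block than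
  \<open>i\<close>, where \<open>A\<close> vanishes, or lies in a block no later than that of
  \<open>i\<close>, hence of \<open>j\<close>, where \<open>B\<close> vanishes.\<close>

lemma strictly_causal_mult:
  assumes A: "A \<in> carrier_mat m k" "causal a b A" and B: "B \<in> carrier_mat k n" "strictly_causal b c B"
  shows "strictly_causal a c (A * B)"
proof -
  have "(A * B) $$ (i, j) = 0" if ij: "i < m" "j < n" "i div a \<le> j div c" for i j
  proof -
    have "A $$ (i, l) * B $$ (l, j) = 0" if "l < k" for l
    proof (cases "i div a < l div b")
      case True
      then show ?thesis using that ij A unfolding causal_def by auto
    next
      case False
      then have "l div b \<le> j div c" using ij by simp
      then show ?thesis using that ij B unfolding strictly_causal_def by auto
    qed
    then show ?thesis unfolding mult_mat_sum[OF A(1) B(1) ij(1,2)] by (intro sum.neutral) simp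
  qed
  then show ?thesis using A B unfolding strictly_causal_def by auto
qed

lemma strictly_causal_uminus:
  "strictly_causal a b M \<Longrightarrow> strictly_causal a b (- M)"
  by (auto simp: strictly_causal_def)

text \<open>The equation determines \<open>X\<close> forward in time: \<open>L\<close> refers only
  to strictly earlier block rows, so the zeros propagate by induction on the row index.\<close>

lemma causal_fixpoint:
  assumes X: "X \<in> carrier_mat m n" "X = Y + L * X"
    and Y: "Y \<in> carrier_mat m n" "causal a b Y"
    and L: "L \<in> carrier_mat m m" "strictly_causal a a L"
  shows "causal a b X"
proof -
  have "X $$ (i, j) = 0" if "i < m" "j < n" "i div a < j div b" for i j
    using that
  proof (induction i rule: less_induct)
    case (less i)
    have "L $$ (i, l) * X $$ (l, j) = 0" if "l < m" for l
    proof (cases "i div a \<le> l div a")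
      case True
      then show ?thesis using L less.prems that unfolding strictly_causal_def by simp
    next
      case False
      then have "l < i" "l div a < j div b"
        using less.prems(3) div_le_mono[of i l a] by (metis not_le, simp)
      then show ?thesis using less that by simp
    qed
    then have "(L * X) $$ (i, j) = 0" unfolding mult_mat_sum[OF L(1) X(1) less.prems(1,2)]
      by (intro sum.neutral) simp
    moreover have "X $$ (i, j) = Y $$ (i, j) + (L * X) $$ (i, j)"
      using X L(1) less.prems by (metis index_add_mat(1) carrier_matD index_mult_mat(2,3))
    ultimately show ?case using Y less.prems unfolding causal_def by simp
  qed
  then show ?thesis using X unfolding causal_def by auto
qed

text \<open>Division is monotone, so \<open>L\<close> vanishes on and above the scalar diagonal.
  Hence 1 - L is lower triangular with unit diagonal and has determinant 1.\<close>

lemma one_minus_strictly_causal_invertible: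
  assumes L: "L \<in> carrier_mat m m" "strictly_causal a a L"
  obtains N where "N \<in> carrier_mat m m" "N * (1\<^sub>m m - L) = 1\<^sub>m m" "(1\<^sub>m m - L) * N = 1\<^sub>m m"
proof -
  have zero: "L $$ (i, j) = 0" if "i \<le> j" "j < m" for i j
    using that L div_le_mono[of i j a] unfolding strictly_causal_def by auto
  have C: "1\<^sub>m m - L \<in> carrier_mat m m" by (rule minus_carrier_mat[OF L(1)])
  have "det (1\<^sub>m m - L) = prod_list (diag_mat (1\<^sub>m m - L))"
    using L zero by (intro det_lower_triangular[OF _ C]) auto
  also have "diag_mat (1\<^sub>m m - L) = map (\<lambda>i. 1) [0..<m]"
    using L zero unfolding diag_mat_def by auto
  finally have "det (1\<^sub>m m - L) \<noteq> 0" by (simp add: map_replicate_const)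
  from det_non_zero_imp_unit[OF C this, of "()"] show thesis
    using that unfolding Units_def ring_mat_def by auto
qed

text \<open>\<open>Q\<close> is the closed loop of the gain \<open>F\<close> around the plant \<open>K\<close>, that is
  \<open>Q = F (1 - K F)\<^sup>-\<^sup>1 = (1 - F K)\<^sup>-\<^sup>1 F\<close>. Written as two fixed-point equations the relation
  is symmetric up to the sign of \<open>K\<close>, so structure passes from \<open>F\<close> to \<open>Q\<close> and back.\<close>

definition closed_loop :: "nat \<Rightarrow> nat \<Rightarrow> real mat \<Rightarrow> real mat \<Rightarrow> real mat \<Rightarrow> bool" where
  "closed_loop p q K F Q \<longleftrightarrow> K \<in> carrier_mat q p \<and> F \<in> carrier_mat p q \<and> Q \<in> carrier_mat p q \<and>
     Q = F + F * K * Q \<and> Q = F + Q * K * F"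

lemma add_mat_eq_iff_uminus:
  fixes A :: "real mat"
  assumes "A \<in> carrier_mat m n" "B \<in> carrier_mat m n" "C \<in> carrier_mat m n"
  shows "A = B + C \<longleftrightarrow> B = A + - C"
  using assms by (auto simp: mat_eq_iff)

lemma minus_mat_eqD:
  fixes A :: "real mat"
  assumes "A \<in> carrier_mat m n" "B \<in> carrier_mat m n" "A - B = C"
  shows "A = C + B"
  unfolding assms(3)[symmetric] using assms(1,2) by (intro eq_matI) auto

lemma add_minus_cancel_mat:
  fixes A :: "real mat"
  assumes "A \<in> carrier_mat m n" "B \<in> carrier_mat m n"
  shows "A + B - B = A"
  using assms by (intro eq_matI) auto

text \<open>Solving both equations for \<open>F\<close> swaps their roles: the second becomes the
  first fixed-point equation of the reversed loop, and the first becomes its second.\<close>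

lemma closed_loop_sym:
  assumes "closed_loop p q K F Q"
  shows "closed_loop p q (- K) Q F"
proof -
  have F: "F \<in> carrier_mat p q" and Q: "Q \<in> carrier_mat p q" and K: "K \<in> carrier_mat q p"
    and e1: "Q = F + F * K * Q" and e2: "Q = F + Q * K * F"
    using assms unfolding closed_loop_def by blast+
  have FK: "F * K * Q \<in> carrier_mat p q" and QK: "Q * K * F \<in> carrier_mat p q" using F Q K by auto
  have "Q * - K * F = - (Q * K * F)" "F * - K * Q = - (F * K * Q)" using F Q K by auto
  moreover have "F = Q + - (Q * K * F)" by (rule iffD1[OF add_mat_eq_iff_uminus[OF Q F QK] e2])
  moreover have "F = Q + - (F * K * Q)" by (rule iffD1[OF add_mat_eq_iff_uminus[OF Q F FK] e1])
  ultimately have "F = Q + Q * - K * F" "F = Q + F * - K * Q" by argo+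
  moreover have "- K \<in> carrier_mat q p" using K by simp
  ultimately show ?thesis using F Q unfolding closed_loop_def by blast
qed

text \<open>The witness is N F, where N inverts 1 - F K. That N is a left and a right inverse gives
  N = 1 + N F K and N = 1 + F K N; multiplying these by F from the right yields the two fixed-point
  equations.\<close>

lemma closed_loop_exists:
  assumes F: "F \<in> carrier_mat p q" "causal a b F" and K: "K \<in> carrier_mat q p" "strictly_causal b a K"
  obtains Q where "closed_loop p q K F Q"
proof -
  have FK: "F * K \<in> carrier_mat p p" "strictly_causal a a (F * K)"
    using strictly_causal_mult[OF F K] F K by auto
  then obtain N where N: "N \<in> carrier_mat p p" "N * (1\<^sub>m p - F * K) = 1\<^sub>m p" "(1\<^sub>m p - F * K) * N = 1\<^sub>m p"
    using one_minus_strictly_causal_invertible by blast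
  have "N - N * (F * K) = 1\<^sub>m p"
    using N mult_minus_distrib_mat[OF N(1) one_carrier_mat FK(1)] by simp
  then have "N = 1\<^sub>m p + N * (F * K)" by (intro minus_mat_eqD[of _ p p]) (use N FK in auto)
  then have l: "N = 1\<^sub>m p + N * F * K" using N F K by simp
  have "N - F * K * N = 1\<^sub>m p"
    using N minus_mult_distrib_mat[OF one_carrier_mat FK(1) N(1)] by simp
  then have r: "N = 1\<^sub>m p + F * K * N" by (intro minus_mat_eqD[of _ p p]) (use N FK in auto)
  have "N * F = (1\<^sub>m p + N * F * K) * F" using l by simp
  also have "\<dots> = F + N * F * K * F" using N F K by (subst add_mult_distrib_mat[of _ p p _ _ q]) auto
  finally have 1: "N * F = F + N * F * K * F" .
  have "N * F = (1\<^sub>m p + F * K * N) * F" using r by simp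
  also have "\<dots> = F + F * K * N * F" using N F K by (subst add_mult_distrib_mat[of _ p p _ _ q]) auto
  also have "F * K * N * F = F * K * (N * F)" using N F FK by (intro assoc_mult_mat) auto
  finally have 2: "N * F = F + F * K * (N * F)" .
  have "closed_loop p q K F (N * F)"
    unfolding closed_loop_def
  proof (intro conjI)
    show "N * F = F + F * K * (N * F)" by (rule 2)
    show "N * F = F + N * F * K * F" by (rule 1)
  qed (use N F K in auto)
  then show thesis by (rule that)
qed

text \<open>For A = Q K and B = F K the fixed-point equations read A = B + B A and A = B + A B,
  which is what remains after expanding the two products. This is the source of the explicit inverse
  of \<open>loop_mat\<close>.\<close>

lemma closed_loop_inverse:
  assumes "closed_loop p q K F Q"
  shows "(1\<^sub>m p + Q * K) * (1\<^sub>m p - F * K) = 1\<^sub>m p" "(1\<^sub>m p - F * K) * (1\<^sub>m p + Q * K) = 1\<^sub>m p"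
proof -
  have F: "F \<in> carrier_mat p q" and Q: "Q \<in> carrier_mat p q" and K: "K \<in> carrier_mat q p"
    and e1: "Q = F + F * K * Q" and e2: "Q = F + Q * K * F"
    using assms unfolding closed_loop_def by blast+
  let ?A = "Q * K" and ?B = "F * K"
  have A: "?A \<in> carrier_mat p p" and B: "?B \<in> carrier_mat p p" using F Q K by auto
  have "?A = (F + ?B * Q) * K" using e1 by simp
  also have "\<dots> = ?B + ?B * Q * K" using F Q K B by (intro add_mult_distrib_mat) auto
  finally have 1: "?A = ?B + ?B * ?A" using assoc_mult_mat[OF B Q K] by simp
  have "?A = (F + ?A * F) * K" using e2 by simp
  also have "\<dots> = ?B + ?A * F * K" using F Q K A by (intro add_mult_distrib_mat) auto
  finally have 2: "?A = ?B + ?A * ?B" using assoc_mult_mat[OF A F K] by simp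
  have cancel: "(1\<^sub>m p + ?A) - ?A = 1\<^sub>m p" by (rule add_minus_cancel_mat[OF one_carrier_mat A])
  have "(1\<^sub>m p + ?A) * (1\<^sub>m p - ?B) = (1\<^sub>m p + ?A) * 1\<^sub>m p - (1\<^sub>m p + ?A) * ?B"
    using A B by (intro mult_minus_distrib_mat[of _ p p]) auto
  also have "(1\<^sub>m p + ?A) * ?B = ?B + ?A * ?B"
    using A B by (subst add_mult_distrib_mat[of _ p p]) auto
  also have "(1\<^sub>m p + ?A) * 1\<^sub>m p = 1\<^sub>m p + ?A" using A by (intro right_mult_one_mat[of _ p]) auto
  finally show "(1\<^sub>m p + ?A) * (1\<^sub>m p - ?B) = 1\<^sub>m p" using 2 cancel by simp
  have "(1\<^sub>m p - ?B) * (1\<^sub>m p + ?A) = 1\<^sub>m p * (1\<^sub>m p + ?A) - ?B * (1\<^sub>m p + ?A)"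
    using A B by (intro minus_mult_distrib_mat[of _ p p _ _ p]) auto
  also have "?B * (1\<^sub>m p + ?A) = ?B + ?B * ?A"
    using A B by (subst mult_add_distrib_mat[of _ p p _ p]) auto
  also have "1\<^sub>m p * (1\<^sub>m p + ?A) = 1\<^sub>m p + ?A" using A by (intro left_mult_one_mat[of _ p p]) auto
  finally show "(1\<^sub>m p - ?B) * (1\<^sub>m p + ?A) = 1\<^sub>m p" using 1 cancel by simp
qed

lemma closed_loop_causal:
  assumes "closed_loop p q K F Q" "causal a b F" "strictly_causal b a K"
  shows "causal a b Q"
proof -
  have F: "F \<in> carrier_mat p q" and Q: "Q \<in> carrier_mat p q" and K: "K \<in> carrier_mat q p"
    and e: "Q = F + F * K * Q"
    using assms unfolding closed_loop_def by blast+
  show ?thesis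
    by (rule causal_fixpoint[OF Q e F assms(2)])
      (use F K strictly_causal_mult[OF F assms(2) K assms(3)] in auto)
qed

text \<open>In Q = F + Q K F, column \<open>j\<close> of Q is a linear image of column
  \<open>j\<close> of F alone.\<close>

lemma closed_loop_column_zero:
  assumes "closed_loop p q K F Q" and j: "j < q" and zero: "\<And>i. i < p \<Longrightarrow> F $$ (i, j) = 0"
    and i: "i < p"
  shows "Q $$ (i, j) = 0"
proof -
  have F: "F \<in> carrier_mat p q" and Q: "Q \<in> carrier_mat p q" and K: "K \<in> carrier_mat q p"
    and e: "Q = F + Q * K * F"
    using assms(1) unfolding closed_loop_def by blast+
  have QK: "Q * K \<in> carrier_mat p p" using Q K by simp
  have "Q $$ (i, j) = (F + Q * K * F) $$ (i, j)" using e by simp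
  also have "\<dots> = F $$ (i, j) + (Q * K * F) $$ (i, j)" using i j F QK by (intro index_add_mat) auto
  also have "(Q * K * F) $$ (i, j) = 0"
    unfolding mult_mat_sum[OF QK F i j] using zero by simp
  finally show ?thesis using zero i by simp
qed

text \<open>In Q = F + F (K Q), a row of Q is computed from the same row of F by a rule that does
  not depend on the row.\<close>

lemma closed_loop_row_eq:
  assumes "closed_loop p q K F Q" and j: "j < q" and i: "i < p" "i' < p"
    and eq: "\<And>j. j < q \<Longrightarrow> F $$ (i, j) = F $$ (i', j)"
  shows "Q $$ (i, j) = Q $$ (i', j)"
proof -
  have F: "F \<in> carrier_mat p q" and Q: "Q \<in> carrier_mat p q" and K: "K \<in> carrier_mat q p"
    and "Q = F + F * K * Q"
    using assms(1) unfolding closed_loop_def by blast+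
  then have e: "Q = F + F * (K * Q)" using assoc_mult_mat[OF F K Q] by argo
  have KQ: "K * Q \<in> carrier_mat q q" using Q K by simp
  have "Q $$ (l, j) = F $$ (l, j) + (\<Sum>k<q. F $$ (l, k) * (K * Q) $$ (k, j))" if l: "l < p" for l
  proof -
    have "Q $$ (l, j) = (F + F * (K * Q)) $$ (l, j)" using e by simp
    also have "\<dots> = F $$ (l, j) + (F * (K * Q)) $$ (l, j)" using l j F KQ by (intro index_add_mat) auto
    finally show ?thesis unfolding mult_mat_sum[OF F KQ l j] .
  qed
  then show ?thesis using i j eq by simp
qed

lemma closed_loop_row_zero:
  assumes "closed_loop p q K F Q" and j: "j < q" and i: "i < p"
    and zero: "\<And>j. j < q \<Longrightarrow> F $$ (i, j) = 0"
  shows "Q $$ (i, j) = 0"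
proof -
  have F: "F \<in> carrier_mat p q" and Q: "Q \<in> carrier_mat p q" and K: "K \<in> carrier_mat q p"
    and "Q = F + F * K * Q"
    using assms(1) unfolding closed_loop_def by blast+
  then have e: "Q = F + F * (K * Q)" using assoc_mult_mat[OF F K Q] by argo
  have KQ: "K * Q \<in> carrier_mat q q" using Q K by simp
  have "Q $$ (i, j) = (F + F * (K * Q)) $$ (i, j)" using e by simp
  also have "\<dots> = F $$ (i, j) + (F * (K * Q)) $$ (i, j)" using i j F KQ by (intro index_add_mat) auto
  finally show ?thesis unfolding mult_mat_sum[OF F KQ i j] using zero j by simp
qed

text \<open>The implicit law says (1 - F K) u = f + F e. Applying the inverse 1 + Q K and using (1 +
  Q K) F = Q gives \<open>u\<close> explicitly. In the application \<open>e\<close> is the output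
  that would occur under zero input.\<close>

lemma closed_loop_signal:
  assumes "closed_loop p q K F Q" and u: "u \<in> carrier_vec p" and f: "f \<in> carrier_vec p"
    and e: "e \<in> carrier_vec q" and eq: "u = f + F *\<^sub>v (K *\<^sub>v u + e)"
  shows "u = (1\<^sub>m p + Q * K) *\<^sub>v f + Q *\<^sub>v e"
proof -
  have F: "F \<in> carrier_mat p q" and Q: "Q \<in> carrier_mat p q" and K: "K \<in> carrier_mat q p"
    and e2: "Q = F + Q * K * F"
    using assms unfolding closed_loop_def by blast+
  let ?M = "1\<^sub>m p + Q * K" and ?N = "1\<^sub>m p - F * K"
  have M: "?M \<in> carrier_mat p p" and N: "?N \<in> carrier_mat p p" using F Q K by auto
  have Ku: "K *\<^sub>v u \<in> carrier_vec q" using K u by simp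
  have "?N *\<^sub>v u = u - F * K *\<^sub>v u" using F K u by (subst minus_mult_distrib_mat_vec[of _ p p]) auto
  also have "F * K *\<^sub>v u = F *\<^sub>v (K *\<^sub>v u)" using F K u by (intro assoc_mult_mat_vec) auto
  also have "u - F *\<^sub>v (K *\<^sub>v u) = (f + (F *\<^sub>v (K *\<^sub>v u) + F *\<^sub>v e)) - F *\<^sub>v (K *\<^sub>v u)"
    using eq mult_add_distrib_mat_vec[OF F Ku e] by simp
  also have "\<dots> = f + F *\<^sub>v e" using f F e K u by (intro eq_vecI) auto
  finally have Nu: "?N *\<^sub>v u = f + F *\<^sub>v e" .
  have "u = (?M * ?N) *\<^sub>v u" using closed_loop_inverse(1)[OF assms(1)] u by simp
  also have "\<dots> = ?M *\<^sub>v (f + F *\<^sub>v e)" using assoc_mult_mat_vec[OF M N u] Nu by simp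
  also have "\<dots> = ?M *\<^sub>v f + ?M *\<^sub>v (F *\<^sub>v e)" using F e f by (intro mult_add_distrib_mat_vec[OF M]) auto
  also have "?M *\<^sub>v (F *\<^sub>v e) = (?M * F) *\<^sub>v e" using F e M by (intro assoc_mult_mat_vec[symmetric]) auto
  also have "?M * F = F + Q * K * F" using F Q K by (subst add_mult_distrib_mat[of _ p p]) auto
  finally show ?thesis using e2 by simp
qed

lemma causal_of_blocks:
  assumes "\<And>i j. i < j \<Longrightarrow> X i j = 0\<^sub>m nr nc"
  shows "causal nr nc (of_blocks p q nr nc X)"
proof -
  have "of_blocks p q nr nc X $$ (i, j) = 0" if ij: "i < p * nr" "j < q * nc" "i div nr < j div nc" for i j
  proof -
    obtain t a s b where "t < p" "a < nr" "i = t * nr + a" "s < q" "b < nc" "j = s * nc + b"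
      using ij by (meson block_cases)
    then show ?thesis using ij assms by simp
  qed
  then show ?thesis unfolding causal_def by simp
qed

lemma strictly_causal_of_blocks:
  assumes "\<And>i j. i \<le> j \<Longrightarrow> X i j = 0\<^sub>m nr nc"
  shows "strictly_causal nr nc (of_blocks p q nr nc X)"
proof -
  have "of_blocks p q nr nc X $$ (i, j) = 0" if ij: "i < p * nr" "j < q * nc" "i div nr \<le> j div nc" for i j
  proof -
    obtain t a s b where "t < p" "a < nr" "i = t * nr + a" "s < q" "b < nc" "j = s * nc + b"
      using ij by (meson block_cases)
    then show ?thesis using ij assms by simp
  qed
  then show ?thesis unfolding strictly_causal_def by simp
qed

section \<open>Schedules and effective gains\<close>

text \<open>A zero-order hold: the value at the last active time up to \<open>t\<close>, or
  \<open>z\<close> if there was none, which reflects the convention of a zero input before time 0.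
  It is polymorphic because offsets and gain blocks are held alike.\<close>

primrec hold :: "(nat \<Rightarrow> nat) \<Rightarrow> 'a \<Rightarrow> (nat \<Rightarrow> 'a) \<Rightarrow> nat \<Rightarrow> 'a" where
  "hold \<sigma> z X 0 = (if \<sigma> 0 = 1 then X 0 else z)"
| "hold \<sigma> z X (Suc t) = (if \<sigma> (Suc t) = 1 then X (Suc t) else hold \<sigma> z X t)"

lemma hold_unique:
  assumes "\<And>t. t < k \<Longrightarrow> Y t = (if \<sigma> t = 1 then X t else if t = 0 then z else Y (t - 1))" and "t < k"
  shows "Y t = hold \<sigma> z X t"
  using \<open>t < k\<close> by (induction t) (simp_all add: assms(1))

lemma hold_unfold: "hold \<sigma> z X t = (if \<sigma> t = 1 then X t else if t = 0 then z else hold \<sigma> z X (t - 1))"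
  by (cases t) auto

lemma hold_induct:
  assumes "P z" "\<And>s. s \<le> t \<Longrightarrow> P (X s)"
  shows "P (hold \<sigma> z X t)"
  using assms by (induction t) auto

text \<open>The structural constraints of the MILP, written entrywise. The same predicate is imposed
  on (F, f) and on (Q, r), so one transfer lemma serves both directions.\<close>

definition respects_schedules ::
  "nat \<Rightarrow> nat \<Rightarrow> nat \<Rightarrow> (nat \<Rightarrow> nat) \<Rightarrow> (nat \<Rightarrow> nat) \<Rightarrow> real mat \<Rightarrow> real vec \<Rightarrow> bool" where
  "respects_schedules T p q \<sigma>m \<sigma>c M v \<longleftrightarrow>
     block_lower_triangular T p q M \<and> v \<in> carrier_vec (T * p) \<and>
     (\<forall>s<T. \<sigma>m s = 0 \<longrightarrow> (\<forall>i<T * p. \<forall>b<q. M $$ (i, s * q + b) = 0)) \<and>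
     (\<forall>t<T. \<sigma>c t = 0 \<longrightarrow> (\<forall>a<p.
        (\<forall>j<T * q. M $$ (t * p + a, j) = (if t = 0 then 0 else M $$ ((t - 1) * p + a, j))) \<and>
        v $ (t * p + a) = (if t = 0 then 0 else v $ ((t - 1) * p + a))))"

lemma respects_schedules_iff_blocks:
  "respects_schedules T p q \<sigma>m \<sigma>c M v \<longleftrightarrow>
    block_lower_triangular T p q M \<and> v \<in> carrier_vec (T * p) \<and>
    (\<forall>s<T. \<sigma>m s = 0 \<longrightarrow> submatrix M UNIV (block_idx q s) = 0\<^sub>m (T * p) q) \<and>
    (\<forall>t<T. \<sigma>c t = 0 \<longrightarrow>
       submatrix M (block_idx p t) UNIV =
         (if t = 0 then 0\<^sub>m p (T * q) else submatrix M (block_idx p (t - 1)) UNIV) \<and>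
       vec_block p t v = (if t = 0 then 0\<^sub>v p else vec_block p (t - 1) v))"
proof (cases "block_lower_triangular T p q M")
  case True
  then have M: "M \<in> carrier_mat (T * p) (T * q)" by (simp add: block_lower_triangular_def)
  have rows: "submatrix M (block_idx p t) UNIV =
      (if t = 0 then 0\<^sub>m p (T * q) else submatrix M (block_idx p (t - 1)) UNIV) \<longleftrightarrow>
      (\<forall>a<p. \<forall>j<T * q. M $$ (t * p + a, j) = (if t = 0 then 0 else M $$ ((t - 1) * p + a, j)))"
    if t: "t < T" for t
  proof (cases "t = 0")
    case True
    then show ?thesis using block_row_zero_iff[OF M t] by simp
  next
    case False
    then have "t - 1 < T" using t by simp
    then show ?thesis using block_row_eq_iff[OF M t, of "t - 1"] False by simp
  qed
  have offs: "vec_block p t v = (if t = 0 then 0\<^sub>v p else vec_block p (t - 1) v) \<longleftrightarrow>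
      (\<forall>a<p. v $ (t * p + a) = (if t = 0 then 0 else v $ ((t - 1) * p + a)))" for t
    by (cases "t = 0") (auto simp: vec_eq_iff vec_block_index)
  show ?thesis
    unfolding respects_schedules_def using block_column_zero_iff[OF M] rows offs by (auto; blast)
qed (simp add: respects_schedules_def)

text \<open>Since r = f + Q (K f), an entry of \<open>r\<close> is held whenever the entry of
  \<open>f\<close> and the row of Q are held; the conditions on Q come from the two fixed-point
  equations. With -K, and with F and Q exchanged, the lemma also leads from the MILP back to
  gains.\<close>

lemma respects_schedules_closed_loop:
  assumes cl: "closed_loop (T * p) (T * q) K F Q" and K: "strictly_causal q p K"
    and F: "respects_schedules T p q \<sigma>m \<sigma>c F f"
    and r: "r = (1\<^sub>m (T * p) + Q * K) *\<^sub>v f"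
  shows "respects_schedules T p q \<sigma>m \<sigma>c Q r"
proof -
  have cF: "F \<in> carrier_mat (T * p) (T * q)" and cQ: "Q \<in> carrier_mat (T * p) (T * q)"
    and cK: "K \<in> carrier_mat (T * q) (T * p)"
    using cl unfolding closed_loop_def by blast+
  have causal: "causal p q F" and f: "f \<in> carrier_vec (T * p)"
    and cols: "\<And>s i b. s < T \<Longrightarrow> \<sigma>m s = 0 \<Longrightarrow> i < T * p \<Longrightarrow> b < q \<Longrightarrow> F $$ (i, s * q + b) = 0"
    and rows: "\<And>t a j. t < T \<Longrightarrow> \<sigma>c t = 0 \<Longrightarrow> a < p \<Longrightarrow> j < T * q \<Longrightarrow>
        F $$ (t * p + a, j) = (if t = 0 then 0 else F $$ ((t - 1) * p + a, j))"
    and offs: "\<And>t a. t < T \<Longrightarrow> \<sigma>c t = 0 \<Longrightarrow> a < p \<Longrightarrow>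
        f $ (t * p + a) = (if t = 0 then 0 else f $ ((t - 1) * p + a))"
    using F unfolding respects_schedules_def block_lower_triangular_iff_causal by auto
  have Kf: "K *\<^sub>v f \<in> carrier_vec (T * q)" using cK f by simp
  have "(1\<^sub>m (T * p) + Q * K) *\<^sub>v f = f + Q * K *\<^sub>v f"
    using cQ cK f by (subst add_mult_distrib_mat_vec[of _ "T * p" "T * p"]) auto
  then have r': "r = f + Q *\<^sub>v (K *\<^sub>v f)" using r assoc_mult_mat_vec[OF cQ cK f] by simp
  have r_index: "r $ i = f $ i + (\<Sum>j<T * q. Q $$ (i, j) * (K *\<^sub>v f) $ j)" if "i < T * p" for i
  proof -
    have "r $ i = f $ i + (Q *\<^sub>v (K *\<^sub>v f)) $ i" unfolding r' using that cQ by simp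
    then show ?thesis unfolding mult_mat_vec_sum[OF cQ Kf that] .
  qed
  have Qrows: "Q $$ (t * p + a, j) = (if t = 0 then 0 else Q $$ ((t - 1) * p + a, j))"
    if t: "t < T" "\<sigma>c t = 0" "a < p" "j < T * q" for t a j
  proof (cases "t = 0")
    case True
    then show ?thesis
      using closed_loop_row_zero[OF cl t(4) block_index_less[OF t(1,3)]] rows[OF t(1-3)] by simp
  next
    case False
    then show ?thesis
      using closed_loop_row_eq[OF cl t(4), of "t * p + a" "(t - 1) * p + a"] rows[OF t(1-3)] t
      by (simp add: block_index_less)
  qed
  have "r $ (t * p + a) = (if t = 0 then 0 else r $ ((t - 1) * p + a))"
    if t: "t < T" "\<sigma>c t = 0" "a < p" for t a
    using Qrows[OF t] offs[OF t] t r_index[of "t * p + a"] r_index[of "(t - 1) * p + a"]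
    by (simp add: block_index_less)
  moreover have "Q $$ (i, s * q + b) = 0" if "s < T" "\<sigma>m s = 0" "i < T * p" "b < q" for s i b
    using closed_loop_column_zero[OF cl _ _ that(3), of "s * q + b"] cols[OF that(1,2)] that
    by (simp add: block_index_less)
  moreover have "causal p q Q" by (rule closed_loop_causal[OF cl causal K])
  moreover have "r \<in> carrier_vec (T * p)" using r' f cQ by (auto intro!: add_carrier_vec mult_mat_vec_carrier[OF cQ Kf])
  ultimately show ?thesis
    using Qrows cQ unfolding respects_schedules_def block_lower_triangular_iff_causal by auto
qed

section \<open>Gains in force under given schedules\<close>

definition eff_offset :: "nat \<Rightarrow> nat \<Rightarrow> (nat \<Rightarrow> nat) \<Rightarrow> (nat \<Rightarrow> real vec) \<Rightarrow> real vec" where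
  "eff_offset T p \<sigma>c f = stack p T (hold \<sigma>c (0\<^sub>v p) f)"

text \<open>The output index \<open>s\<close> stays fixed while the hold runs over time. Future and
  missing outputs are zeroed before holding, so only blocks with \<open>s \<le> t\<close> and a
  measured output are ever read from \<open>F\<close>.\<close>

definition eff_block ::
  "nat \<Rightarrow> nat \<Rightarrow> (nat \<Rightarrow> nat) \<Rightarrow> (nat \<Rightarrow> nat) \<Rightarrow> (nat \<Rightarrow> nat \<Rightarrow> real mat) \<Rightarrow> nat \<Rightarrow> nat \<Rightarrow> real mat" where
  "eff_block p q \<sigma>m \<sigma>c F t s =
     hold \<sigma>c (0\<^sub>m p q) (\<lambda>t. if s \<le> t \<and> \<sigma>m s = 1 then F t s else 0\<^sub>m p q) t"

definition eff_gain ::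
  "nat \<Rightarrow> nat \<Rightarrow> nat \<Rightarrow> (nat \<Rightarrow> nat) \<Rightarrow> (nat \<Rightarrow> nat) \<Rightarrow> (nat \<Rightarrow> nat \<Rightarrow> real mat) \<Rightarrow> real mat" where
  "eff_gain T p q \<sigma>m \<sigma>c F = of_blocks T T p q (eff_block p q \<sigma>m \<sigma>c F)"

lemma eff_block_unfold:
  "eff_block p q \<sigma>m \<sigma>c F t s =
    (if \<sigma>c t = 1 then if s \<le> t \<and> \<sigma>m s = 1 then F t s else 0\<^sub>m p q
     else if t = 0 then 0\<^sub>m p q else eff_block p q \<sigma>m \<sigma>c F (t - 1) s)"
  unfolding eff_block_def by (rule hold_unfold)

lemma eff_block_carrier:
  assumes "\<And>t s. t < T \<Longrightarrow> s \<le> t \<Longrightarrow> F t s \<in> carrier_mat p q" "t < T"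
  shows "eff_block p q \<sigma>m \<sigma>c F t s \<in> carrier_mat p q"
  unfolding eff_block_def using assms
  by (intro hold_induct[where P = "\<lambda>M. M \<in> carrier_mat p q"]) auto

lemma eff_block_zero:
  "t < s \<or> \<sigma>m s \<noteq> 1 \<Longrightarrow> eff_block p q \<sigma>m \<sigma>c F t s = 0\<^sub>m p q"
  by (induction t) (auto simp: eff_block_def)

lemma respects_schedules_eff:
  assumes "\<And>t. t < T \<Longrightarrow> \<sigma>c t \<in> {0, 1}"
    and F: "\<And>t s. t < T \<Longrightarrow> s \<le> t \<Longrightarrow> F t s \<in> carrier_mat p q"
    and f: "\<And>t. t < T \<Longrightarrow> f t \<in> carrier_vec p"
  shows "respects_schedules T p q \<sigma>m \<sigma>c (eff_gain T p q \<sigma>m \<sigma>c F) (eff_offset T p \<sigma>c f)"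
proof -
  let ?F = "eff_gain T p q \<sigma>m \<sigma>c F" and ?f = "eff_offset T p \<sigma>c f"
  have ix: "?F $$ (t * p + a, s * q + b) = eff_block p q \<sigma>m \<sigma>c F t s $$ (a, b)"
    if "t < T" "a < p" "s < T" "b < q" for t a s b
    using that by (simp add: eff_gain_def)
  have fx: "?f $ (t * p + a) = hold \<sigma>c (0\<^sub>v p) f t $ a" if "t < T" "a < p" for t a
    using that by (simp add: eff_offset_def)
  have "mat_block p q t s ?F = 0\<^sub>m p q" if "t < T" "s < T" "t < s" for t s
    using that eff_block_zero[of t s \<sigma>m p q \<sigma>c F] unfolding eff_gain_def
    by (subst mat_block_of_blocks) auto
  moreover have "?F $$ (i, s * q + b) = 0" if s: "s < T" "\<sigma>m s = 0" "i < T * p" "b < q" for s i b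
  proof (rule block_cases[OF s(3)])
    fix t a assume "t < T" "a < p" "i = t * p + a"
    then show ?thesis using s ix eff_block_zero[of t s \<sigma>m p q \<sigma>c F] by simp
  qed
  moreover have "?F $$ (t * p + a, j) = (if t = 0 then 0 else ?F $$ ((t - 1) * p + a, j))"
    if t: "t < T" "\<sigma>c t = 0" "a < p" "j < T * q" for t a j
  proof (rule block_cases[OF t(4)])
    fix s b assume "s < T" "b < q" "j = s * q + b"
    then show ?thesis
      using t ix[of t a s b] ix[of "t - 1" a s b] eff_block_unfold[of p q \<sigma>m \<sigma>c F t s] by auto
  qed
  moreover have "?f $ (t * p + a) = (if t = 0 then 0 else ?f $ ((t - 1) * p + a))"
    if t: "t < T" "\<sigma>c t = 0" "a < p" for t a
    using t fx[of t a] fx[of "t - 1" a] hold_unfold[of \<sigma>c "0\<^sub>v p" f t] by auto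
  moreover have "?F \<in> carrier_mat (T * p) (T * q)" "?f \<in> carrier_vec (T * p)"
    by (simp_all add: eff_gain_def eff_offset_def)
  ultimately show ?thesis unfolding respects_schedules_def block_lower_triangular_def by blast
qed

text \<open>Matrices that already have the required structure satisfy the recursion characterizing
  \<open>hold\<close>, so passing to effective gains changes nothing. Binary values matter here: the
  structural conditions speak about 0, the hold about being different from 1.\<close>

lemma eff_of_respects_schedules:
  assumes \<sigma>: "\<And>t. t < T \<Longrightarrow> \<sigma>m t \<in> {0, 1} \<and> \<sigma>c t \<in> {0, 1}"
    and R: "respects_schedules T p q \<sigma>m \<sigma>c F f"
  shows "eff_gain T p q \<sigma>m \<sigma>c (\<lambda>t s. mat_block p q t s F) = F"
    and "eff_offset T p \<sigma>c (\<lambda>t. vec_block p t f) = f"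
proof -
  have cF: "F \<in> carrier_mat (T * p) (T * q)" and f: "f \<in> carrier_vec (T * p)"
    and lower: "\<And>t s. t < T \<Longrightarrow> s < T \<Longrightarrow> t < s \<Longrightarrow> mat_block p q t s F = 0\<^sub>m p q"
    and cols: "\<And>s i b. s < T \<Longrightarrow> \<sigma>m s = 0 \<Longrightarrow> i < T * p \<Longrightarrow> b < q \<Longrightarrow> F $$ (i, s * q + b) = 0"
    and rows: "\<And>t a j. t < T \<Longrightarrow> \<sigma>c t = 0 \<Longrightarrow> a < p \<Longrightarrow> j < T * q \<Longrightarrow>
        F $$ (t * p + a, j) = (if t = 0 then 0 else F $$ ((t - 1) * p + a, j))"
    and offs: "\<And>t a. t < T \<Longrightarrow> \<sigma>c t = 0 \<Longrightarrow> a < p \<Longrightarrow>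
        f $ (t * p + a) = (if t = 0 then 0 else f $ ((t - 1) * p + a))"
    using R unfolding respects_schedules_def block_lower_triangular_def by auto
  have blk: "mat_block p q t s F = eff_block p q \<sigma>m \<sigma>c (\<lambda>t s. mat_block p q t s F) t s"
    if ts: "t < T" "s < T" for t s
    unfolding eff_block_def
  proof (rule hold_unique[OF _ ts(1)])
    fix t assume t: "t < T"
    note C = mat_block_carrier[OF cF t ts(2)]
    have 1: "mat_block p q t s F = 0\<^sub>m p q" if "\<sigma>m s \<noteq> 1"
    proof -
      have "\<sigma>m s = 0" using \<sigma>[OF ts(2)] that by simp
      then show ?thesis using C cols ts(2) t
        by (subst mat_eq_iff) (auto simp: mat_block_index[OF cF t ts(2)] block_index_less)
    qed
    have 2: "mat_block p q t s F = (if t = 0 then 0\<^sub>m p q else mat_block p q (t - 1) s F)" if "\<sigma>c t \<noteq> 1"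
    proof -
      have z: "\<sigma>c t = 0" using \<sigma>[OF t] that by simp
      show ?thesis
      proof (cases "t = 0")
        case True
        then show ?thesis using C rows[OF t z] mat_block_index[OF cF t ts(2)] ts(2)
          by (subst mat_eq_iff) (auto simp: block_index_less)
      next
        case False
        then have t': "t - 1 < T" using t by simp
        show ?thesis
          using C rows[OF t z] False mat_block_carrier[OF cF t' ts(2)]
            mat_block_index[OF cF t ts(2)] mat_block_index[OF cF t' ts(2)] ts(2)
          by (subst mat_eq_iff) (auto simp: block_index_less)
      qed
    qed
    show "mat_block p q t s F = (if \<sigma>c t = 1 then if s \<le> t \<and> \<sigma>m s = 1 then mat_block p q t s F else 0\<^sub>m p q
        else if t = 0 then 0\<^sub>m p q else mat_block p q (t - 1) s F)"
      using 1 2 lower[OF t ts(2)] by (auto simp: not_le)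
  qed
  have "eff_gain T p q \<sigma>m \<sigma>c (\<lambda>t s. mat_block p q t s F) = of_blocks T T p q (\<lambda>t s. mat_block p q t s F)"
    unfolding eff_gain_def by (rule eq_mat_blocksI) (auto simp: blk[symmetric])
  then show "eff_gain T p q \<sigma>m \<sigma>c (\<lambda>t s. mat_block p q t s F) = F"
    by (simp add: of_blocks_mat_block[OF cF])
  have "vec_block p t f = hold \<sigma>c (0\<^sub>v p) (\<lambda>t. vec_block p t f) t" if t: "t < T" for t
  proof (rule hold_unique[OF _ t])
    fix t assume t: "t < T"
    have "vec_block p t f = (if t = 0 then 0\<^sub>v p else vec_block p (t - 1) f)" if "\<sigma>c t \<noteq> 1"
      using offs[OF t] \<sigma>[OF t] that by (intro eq_vecI) (auto simp: vec_block_index)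
    then show "vec_block p t f = (if \<sigma>c t = 1 then vec_block p t f
        else if t = 0 then 0\<^sub>v p else vec_block p (t - 1) f)" by simp
  qed
  then have "eff_offset T p \<sigma>c (\<lambda>t. vec_block p t f) = stack p T (\<lambda>t. vec_block p t f)"
    unfolding eff_offset_def by (intro stack_cong) simp
  then show "eff_offset T p \<sigma>c (\<lambda>t. vec_block p t f) = f" by (simp add: stack_vec_block[OF f])
qed

lemma finsum_vec_eq_vec:
  assumes "finite S" "\<And>i. i \<in> S \<Longrightarrow> g i \<in> carrier_vec n"
  shows "finsum_vec TYPE(real) n g S = vec n (\<lambda>a. \<Sum>i\<in>S. g i $ a)"
  using assms finsum_vec_closed[of g S n] by (intro eq_vecI) (auto simp: index_finsum_vec)

text \<open>Holding an input repeats the whole affine expression of the previous time. At a hold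
  time the offset and all blocks equal those at \<open>t - 1\<close>, so the induction hypothesis
  carries over unchanged.\<close>

lemma control_stacked:
  assumes F: "\<And>t s. t < T \<Longrightarrow> s \<le> t \<Longrightarrow> F t s \<in> carrier_mat p q"
    and f: "\<And>t. t < T \<Longrightarrow> f t \<in> carrier_vec p"
    and y: "\<And>t. t < T \<Longrightarrow> y t \<in> carrier_vec q"
    and u: "\<And>t. t < T \<Longrightarrow> u t = (if \<sigma>c t = 1
         then f t + vec p (\<lambda>a. \<Sum>s | s \<le> t \<and> \<sigma>m s = 1. (F t s *\<^sub>v y s) $ a)
         else if t = 0 then 0\<^sub>v p else u (t - 1))"
  shows "stack p T u = eff_offset T p \<sigma>c f + eff_gain T p q \<sigma>m \<sigma>c F *\<^sub>v stack q T y"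
proof -
  let ?E = "eff_block p q \<sigma>m \<sigma>c F" and ?h = "hold \<sigma>c (0\<^sub>v p) f"
  have E: "?E t s \<in> carrier_mat p q" if "t < T" for t s
    using F that by (rule eff_block_carrier)
  have ut: "u t = ?h t + vsum p T (\<lambda>s. ?E t s *\<^sub>v y s)" if "t < T" for t
    using that
  proof (induction t rule: less_induct)
    case (less t)
    show ?case
    proof (cases "\<sigma>c t = 1")
      case True
      have "(\<Sum>s | s \<le> t \<and> \<sigma>m s = 1. (F t s *\<^sub>v y s) $ a) = (\<Sum>s<T. (?E t s *\<^sub>v y s) $ a)"
        if a: "a < p" for a
      \<comment> \<open>Extending the sum from the measured past to all times only adds zero blocks;
        on the original index set the effective block is \<open>F t s\<close> itself.\<close>
      proof (rule sum.mono_neutral_cong_left)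
        show "\<forall>i\<in>{..<T} - {s. s \<le> t \<and> \<sigma>m s = 1}. (?E t i *\<^sub>v y i) $ a = 0"
        proof
          fix i assume "i \<in> {..<T} - {s. s \<le> t \<and> \<sigma>m s = 1}"
          then have "?E t i = 0\<^sub>m p q" "y i \<in> carrier_vec q"
            using eff_block_zero[of t i \<sigma>m p q \<sigma>c F] y by auto
          then show "(?E t i *\<^sub>v y i) $ a = 0" using a by simp
        qed
      qed (use True less.prems in \<open>auto simp: eff_block_unfold[of _ _ _ _ _ t]\<close>)
      then have "vec p (\<lambda>a. \<Sum>s | s \<le> t \<and> \<sigma>m s = 1. (F t s *\<^sub>v y s) $ a) = vsum p T (\<lambda>s. ?E t s *\<^sub>v y s)"
        by (intro eq_vecI) (auto simp: vsum_def)
      then show ?thesis using u[OF less.prems] True hold_unfold[of \<sigma>c "0\<^sub>v p" f t] by simp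
    next
      case False
      show ?thesis
      proof (cases "t = 0")
        case True
        then show ?thesis using False u[OF less.prems] y
          by (intro eq_vecI) (auto simp: vsum_def eff_block_def)
      next
        case t: False
        then have "u (t - 1) = ?h (t - 1) + vsum p T (\<lambda>s. ?E (t - 1) s *\<^sub>v y s)"
          using less by simp
        moreover have "?E t s = ?E (t - 1) s" for s
          using False t eff_block_unfold[of p q \<sigma>m \<sigma>c F t s] by simp
        ultimately show ?thesis
          using u[OF less.prems] False t hold_unfold[of \<sigma>c "0\<^sub>v p" f t] by simp
      qed
    qed
  qed
  have "eff_offset T p \<sigma>c f + eff_gain T p q \<sigma>m \<sigma>c F *\<^sub>v stack q T y =
      stack p T ?h + stack p T (\<lambda>t. vsum p T (\<lambda>s. ?E t s *\<^sub>v y s))"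
    unfolding eff_offset_def eff_gain_def using E y by (subst of_blocks_mult_stack) auto
  also have "\<dots> = stack p T u"
    by (subst stack_add) (auto intro!: stack_cong simp: ut)
  finally show ?thesis by simp
qed

section \<open>The safety problem\<close>

context
  fixes P :: safety_problem
  assumes wd: "well_dimensioned P"
begin

section \<open>The plant in stacked form\<close>

lemma sys_carrier:
  "sysA P \<in> carrier_mat (nx P) (nx P)" "sysB P \<in> carrier_mat (nx P) (nu P)"
  "sysC P \<in> carrier_mat (ny P) (nx P)" "sysD P \<in> carrier_mat (nz P) (nx P)"
  "sysd P \<in> carrier_vec (nz P)"
  using wd unfolding well_dimensioned_def by auto

lemma bar_C_of_blocks:
  "bar_C P = of_blocks (horizon P) (horizon P + 1) (ny P) (nx P)
     (\<lambda>i j. if i = j then sysC P else 0\<^sub>m (ny P) (nx P))"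
  unfolding bar_C_def by (rule append_cols_zero_of_blocks[OF sys_carrier(3)])

lemma stacked_carrier:
  "bar_C P \<in> carrier_mat (horizon P * ny P) ((horizon P + 1) * nx P)"
  "bar_D P \<in> carrier_mat ((horizon P + 1) * nz P) ((horizon P + 1) * nx P)"
  "bar_d P \<in> carrier_vec ((horizon P + 1) * nz P)"
  "mat_J P \<in> carrier_mat ((horizon P + 1) * nx P) (nx P)"
  "mat_H P \<in> carrier_mat ((horizon P + 1) * nx P) (horizon P * nx P)"
  "mat_S P \<in> carrier_mat ((horizon P + 1) * nx P) (horizon P * nu P)"
proof -
  show "bar_C P \<in> carrier_mat (horizon P * ny P) ((horizon P + 1) * nx P)"
    unfolding bar_C_of_blocks by (rule of_blocks_carrier)
  show "bar_D P \<in> carrier_mat ((horizon P + 1) * nz P) ((horizon P + 1) * nx P)"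
    unfolding bar_D_def kron_one_of_blocks[OF sys_carrier(4)] by (rule of_blocks_carrier)
  show "bar_d P \<in> carrier_vec ((horizon P + 1) * nz P)"
    using sys_carrier(5) stack_carrier(1)[of "dim_vec (sysd P)" "horizon P + 1"]
    unfolding bar_d_def kron_ones_stack by auto
  show "mat_J P \<in> carrier_mat ((horizon P + 1) * nx P) (nx P)"
    using of_blocks_carrier(1)[of "horizon P + 1" 1 "nx P" "nx P"] unfolding mat_J_def by simp
  show "mat_H P \<in> carrier_mat ((horizon P + 1) * nx P) (horizon P * nx P)"
    unfolding mat_H_def by (rule of_blocks_carrier)
  show "mat_S P \<in> carrier_mat ((horizon P + 1) * nx P) (horizon P * nu P)"
    unfolding mat_S_def by (rule of_blocks_carrier)
qed

lemma plant_carrier: "bar_C P * mat_S P \<in> carrier_mat (horizon P * ny P) (horizon P * nu P)"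
  using stacked_carrier by (intro mult_carrier_mat)

text \<open>The one-step delay of the dynamics enters here: the output at a given time depends only
  on strictly earlier inputs, so feeding it back at once creates no algebraic loop.\<close>

lemma plant_strictly_causal: "strictly_causal (ny P) (nu P) (bar_C P * mat_S P)"
proof (rule strictly_causal_mult[OF stacked_carrier(1) _ stacked_carrier(6)])
  show "causal (ny P) (nx P) (bar_C P)" unfolding bar_C_of_blocks by (rule causal_of_blocks) simp
  show "strictly_causal (nx P) (nu P) (mat_S P)" unfolding mat_S_def by (rule strictly_causal_of_blocks) simp
qed

text \<open>The solved recursion with input \<open>B u + w\<close>, split by linearity: the
  disturbance part gives the rows of \<open>mat_H\<close>, the control part those of
  \<open>mat_S\<close>.\<close>

lemma state_stacked:
  assumes x0: "x 0 \<in> carrier_vec (nx P)"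
    and u: "\<And>t. t < horizon P \<Longrightarrow> u t \<in> carrier_vec (nu P)"
    and w: "\<And>t. t < horizon P \<Longrightarrow> w t \<in> carrier_vec (nx P)"
    and step: "\<And>t. t < horizon P \<Longrightarrow> x (Suc t) = sysA P *\<^sub>v x t + sysB P *\<^sub>v u t + w t"
    and x: "\<And>t. t \<le> horizon P \<Longrightarrow> x t \<in> carrier_vec (nx P)"
  shows "stack (nx P) (horizon P + 1) x =
    mat_J P *\<^sub>v x 0 + mat_H P *\<^sub>v stack (nx P) (horizon P) w + mat_S P *\<^sub>v stack (nu P) (horizon P) u"
proof -
  let ?n = "nx P" and ?T = "horizon P" and ?A = "sysA P" and ?B = "sysB P"
  let ?\<Phi> = "\<lambda>t j. if t > j then ?A ^\<^sub>m (t - 1 - j) else 0\<^sub>m ?n ?n"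
  let ?e = "\<lambda>j. ?B *\<^sub>v u j + w j"
  have A: "?A \<in> carrier_mat ?n ?n" and B: "?B \<in> carrier_mat ?n (nu P)" by (rule sys_carrier)+
  have Bu: "?B *\<^sub>v u j \<in> carrier_vec ?n" and e: "?e j \<in> carrier_vec ?n" if "j < ?T" for j
    using B u[OF that] w[OF that] by auto
  have \<Phi>: "?\<Phi> t j \<in> carrier_mat ?n ?n" for t j using A by simp
  have sol: "x t = ?A ^\<^sub>m t *\<^sub>v x 0 + vsum ?n ?T (\<lambda>j. ?\<Phi> t j *\<^sub>v ?e j)" if "t \<le> ?T" for t
  proof (rule linear_recurrence_solution[where x = x, OF A e x0 _ that])
    fix t assume t: "t < ?T"
    have "?A *\<^sub>v x t + ?B *\<^sub>v u t + w t = ?A *\<^sub>v x t + ?e t"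
      using A x[of t] t Bu[OF t] w[OF t] by (intro assoc_add_vec[of _ ?n]) auto
    then show "x (Suc t) = ?A *\<^sub>v x t + ?e t" using step[OF t] by simp
  qed
  have J: "mat_J P *\<^sub>v x 0 = stack ?n (?T + 1) (\<lambda>t. ?A ^\<^sub>m t *\<^sub>v x 0)"
  proof -
    \<comment> \<open>\<open>mat_J\<close> is a block matrix with one block column, so the initial
      state is regarded as a stack of a single block.\<close>
    have "mat_J P *\<^sub>v x 0 = mat_J P *\<^sub>v stack ?n 1 (\<lambda>_. x 0)" by (simp only: stack_one[OF x0])
    also have "\<dots> = stack ?n (?T + 1) (\<lambda>t. vsum ?n 1 (\<lambda>_. ?A ^\<^sub>m t *\<^sub>v x 0))"
      unfolding mat_J_def using A x0 by (intro of_blocks_mult_stack) auto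
    also have "\<dots> = stack ?n (?T + 1) (\<lambda>t. ?A ^\<^sub>m t *\<^sub>v x 0)"
      using A by (intro stack_cong eq_vecI) (auto simp: vsum_def)
    finally show ?thesis .
  qed
  have H: "mat_H P *\<^sub>v stack ?n ?T w = stack ?n (?T + 1) (\<lambda>t. vsum ?n ?T (\<lambda>j. ?\<Phi> t j *\<^sub>v w j))"
    unfolding mat_H_def using A w by (intro of_blocks_mult_stack) auto
  have "mat_S P *\<^sub>v stack (nu P) ?T u =
      stack ?n (?T + 1) (\<lambda>t. vsum ?n ?T (\<lambda>j. (if t > j then ?A ^\<^sub>m (t - 1 - j) * ?B else 0\<^sub>m ?n (nu P)) *\<^sub>v u j))"
    unfolding mat_S_def using A B u by (intro of_blocks_mult_stack) (auto intro: mult_carrier_mat[of _ ?n ?n])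
  also have "\<dots> = stack ?n (?T + 1) (\<lambda>t. vsum ?n ?T (\<lambda>j. ?\<Phi> t j *\<^sub>v (?B *\<^sub>v u j)))"
  proof (intro stack_cong vsum_cong)
    fix t j assume j: "j < ?T"
    have z: "0\<^sub>m ?n (nu P) *\<^sub>v u j = 0\<^sub>v ?n" "0\<^sub>m ?n ?n *\<^sub>v (?B *\<^sub>v u j) = 0\<^sub>v ?n"
      using u[OF j] Bu[OF j] by (intro eq_vecI; auto)+
    show "(if t > j then ?A ^\<^sub>m (t - 1 - j) * ?B else 0\<^sub>m ?n (nu P)) *\<^sub>v u j = ?\<Phi> t j *\<^sub>v (?B *\<^sub>v u j)"
      using assoc_mult_mat_vec[OF pow_carrier_mat[OF A] B u[OF j]] z by simp
  qed
  finally have S: "mat_S P *\<^sub>v stack (nu P) ?T u =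
      stack ?n (?T + 1) (\<lambda>t. vsum ?n ?T (\<lambda>j. ?\<Phi> t j *\<^sub>v (?B *\<^sub>v u j)))" .
  have "?A ^\<^sub>m t *\<^sub>v x 0 + vsum ?n ?T (\<lambda>j. ?\<Phi> t j *\<^sub>v w j) + vsum ?n ?T (\<lambda>j. ?\<Phi> t j *\<^sub>v (?B *\<^sub>v u j)) = x t"
    if t: "t < ?T + 1" for t
  proof -
    have "?\<Phi> t j *\<^sub>v (?B *\<^sub>v u j) + ?\<Phi> t j *\<^sub>v w j = ?\<Phi> t j *\<^sub>v ?e j" if "j < ?T" for j
      by (rule mult_add_distrib_mat_vec[OF \<Phi> Bu[OF that] w[OF that], symmetric])
    moreover have "?\<Phi> t j *\<^sub>v w j \<in> carrier_vec ?n" if "j < ?T" for j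
      by (rule mult_mat_vec_carrier[OF \<Phi> w[OF that]])
    ultimately have "vsum ?n ?T (\<lambda>j. ?\<Phi> t j *\<^sub>v (?B *\<^sub>v u j)) + vsum ?n ?T (\<lambda>j. ?\<Phi> t j *\<^sub>v w j) =
        vsum ?n ?T (\<lambda>j. ?\<Phi> t j *\<^sub>v ?e j)"
      by (subst vsum_add) (auto intro: vsum_cong)
    then have "x t = ?A ^\<^sub>m t *\<^sub>v x 0 +
        (vsum ?n ?T (\<lambda>j. ?\<Phi> t j *\<^sub>v (?B *\<^sub>v u j)) + vsum ?n ?T (\<lambda>j. ?\<Phi> t j *\<^sub>v w j))"
      using sol[of t] t by simp
    then show ?thesis by (intro eq_vecI) auto
  qed
  then show ?thesis
    unfolding J H S by (subst stack_add, simp)+ (intro stack_cong, simp)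
qed

section \<open>Inputs and outputs as affine functions of the disturbance\<close>

lemma closed_form_u:
  assumes Q: "Q \<in> carrier_mat (horizon P * nu P) (horizon P * ny P)" and r: "r \<in> carrier_vec (horizon P * nu P)"
    and W: "W \<in> carrier_vec (horizon P * nx P)" and V: "V \<in> carrier_vec (horizon P * ny P)"
    and x0: "x0 \<in> carrier_vec (nx P)"
  shows "(P_uw P Q @\<^sub>c P_uv P Q @\<^sub>c P_ux0 P Q) *\<^sub>v (W @\<^sub>v V @\<^sub>v x0) + tilde_u P r =
    r + Q *\<^sub>v (bar_C P *\<^sub>v (mat_J P *\<^sub>v x0 + mat_H P *\<^sub>v W) + V)"
proof -
  note C = stacked_carrier(1) and J = stacked_carrier(4) and H = stacked_carrier(5)
  have QC: "Q * bar_C P \<in> carrier_mat (horizon P * nu P) ((horizon P + 1) * nx P)" by (rule mult_carrier_mat[OF Q C])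
  have QCH: "Q * bar_C P * mat_H P \<in> carrier_mat (horizon P * nu P) (horizon P * nx P)" by (rule mult_carrier_mat[OF QC H])
  have QCJ: "Q * bar_C P * mat_J P \<in> carrier_mat (horizon P * nu P) (nx P)" by (rule mult_carrier_mat[OF QC J])
  have Jx: "mat_J P *\<^sub>v x0 \<in> carrier_vec ((horizon P + 1) * nx P)" by (rule mult_mat_vec_carrier[OF J x0])
  have HW: "mat_H P *\<^sub>v W \<in> carrier_vec ((horizon P + 1) * nx P)" by (rule mult_mat_vec_carrier[OF H W])
  have CJx: "bar_C P *\<^sub>v (mat_J P *\<^sub>v x0) \<in> carrier_vec (horizon P * ny P)" by (rule mult_mat_vec_carrier[OF C Jx])
  have CHW: "bar_C P *\<^sub>v (mat_H P *\<^sub>v W) \<in> carrier_vec (horizon P * ny P)" by (rule mult_mat_vec_carrier[OF C HW])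
  have "(P_uw P Q @\<^sub>c P_uv P Q @\<^sub>c P_ux0 P Q) *\<^sub>v (W @\<^sub>v V @\<^sub>v x0) =
      Q * bar_C P * mat_H P *\<^sub>v W + (Q *\<^sub>v V + Q * bar_C P * mat_J P *\<^sub>v x0)"
    unfolding P_uw_def P_uv_def P_ux0_def
    by (subst append_cols_mult_vec[OF QCH append_cols_carrier[OF Q QCJ] W append_carrier_vec[OF V x0]],
      subst append_cols_mult_vec[OF Q QCJ V x0]) (rule refl)
  also have "Q * bar_C P * mat_H P *\<^sub>v W = Q *\<^sub>v (bar_C P *\<^sub>v (mat_H P *\<^sub>v W))"
    by (simp only: assoc_mult_mat_vec[OF QC H W] assoc_mult_mat_vec[OF Q C HW])
  also have "Q * bar_C P * mat_J P *\<^sub>v x0 = Q *\<^sub>v (bar_C P *\<^sub>v (mat_J P *\<^sub>v x0))"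
    by (simp only: assoc_mult_mat_vec[OF QC J x0] assoc_mult_mat_vec[OF Q C Jx])
  finally have l: "(P_uw P Q @\<^sub>c P_uv P Q @\<^sub>c P_ux0 P Q) *\<^sub>v (W @\<^sub>v V @\<^sub>v x0) =
      Q *\<^sub>v (bar_C P *\<^sub>v (mat_H P *\<^sub>v W)) + (Q *\<^sub>v V + Q *\<^sub>v (bar_C P *\<^sub>v (mat_J P *\<^sub>v x0)))" .
  have "Q *\<^sub>v (bar_C P *\<^sub>v (mat_J P *\<^sub>v x0 + mat_H P *\<^sub>v W) + V) =
      Q *\<^sub>v (bar_C P *\<^sub>v (mat_J P *\<^sub>v x0)) + Q *\<^sub>v (bar_C P *\<^sub>v (mat_H P *\<^sub>v W)) + Q *\<^sub>v V"
    by (simp only: mult_add_distrib_mat_vec[OF C Jx HW] mult_add_distrib_mat_vec[OF Q CJx CHW]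
      mult_add_distrib_mat_vec[OF Q add_carrier_vec[OF CJx CHW] V])
  then show ?thesis unfolding l tilde_u_def using Q r V by (intro eq_vecI) auto
qed

text \<open>The hypothesis on \<open>U\<close> is the solved control law. Substituting it into the
  state and sorting the terms by \<open>W\<close>, \<open>V\<close> and \<open>x0\<close> produces
  the coefficient matrices; what remains is \<open>tilde_z\<close>.\<close>

lemma closed_form_z:
  assumes Q: "Q \<in> carrier_mat (horizon P * nu P) (horizon P * ny P)" and r: "r \<in> carrier_vec (horizon P * nu P)"
    and W: "W \<in> carrier_vec (horizon P * nx P)" and V: "V \<in> carrier_vec (horizon P * ny P)"
    and x0: "x0 \<in> carrier_vec (nx P)"
    and U: "U = r + Q *\<^sub>v (bar_C P *\<^sub>v (mat_J P *\<^sub>v x0 + mat_H P *\<^sub>v W) + V)"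
  shows "(P_zw P Q @\<^sub>c P_zv P Q @\<^sub>c P_zx0 P Q) *\<^sub>v (W @\<^sub>v V @\<^sub>v x0) + tilde_z P r =
    bar_D P *\<^sub>v (mat_J P *\<^sub>v x0 + mat_H P *\<^sub>v W + mat_S P *\<^sub>v U) + bar_d P"
proof -
  note C = stacked_carrier(1) and D = stacked_carrier(2) and d = stacked_carrier(3)
    and J = stacked_carrier(4) and H = stacked_carrier(5) and S = stacked_carrier(6)
  let ?C = "bar_C P" and ?D = "bar_D P" and ?J = "mat_J P" and ?H = "mat_H P" and ?S = "mat_S P"
  let ?N = "(horizon P + 1) * nx P" and ?M = "(horizon P + 1) * nz P"
  have SQ: "?S * Q \<in> carrier_mat ?N (horizon P * ny P)" by (rule mult_carrier_mat[OF S Q])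
  have SQC: "?S * Q * ?C \<in> carrier_mat ?N ?N" by (rule mult_carrier_mat[OF SQ C])
  have SQCH: "?S * Q * ?C * ?H \<in> carrier_mat ?N (horizon P * nx P)" by (rule mult_carrier_mat[OF SQC H])
  have HS: "?H + ?S * Q * ?C * ?H \<in> carrier_mat ?N (horizon P * nx P)" using H SQCH by simp
  have IS: "1\<^sub>m ?N + ?S * Q * ?C \<in> carrier_mat ?N ?N" using SQC by simp
  have DIS: "?D * (1\<^sub>m ?N + ?S * Q * ?C) \<in> carrier_mat ?M ?N" by (rule mult_carrier_mat[OF D IS])
  have Pw: "P_zw P Q \<in> carrier_mat ?M (horizon P * nx P)"
    unfolding P_zw_def by (rule mult_carrier_mat[OF D HS])
  have DS: "?D * ?S \<in> carrier_mat ?M (horizon P * nu P)" by (rule mult_carrier_mat[OF D S])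
  have Pv: "P_zv P Q \<in> carrier_mat ?M (horizon P * ny P)"
    unfolding P_zv_def by (rule mult_carrier_mat[OF DS Q])
  have Px: "P_zx0 P Q \<in> carrier_mat ?M (nx P)"
    unfolding P_zx0_def by (rule mult_carrier_mat[OF DIS J])
  have Jx: "?J *\<^sub>v x0 \<in> carrier_vec ?N" by (rule mult_mat_vec_carrier[OF J x0])
  have HW: "?H *\<^sub>v W \<in> carrier_vec ?N" by (rule mult_mat_vec_carrier[OF H W])
  have CJx: "?C *\<^sub>v (?J *\<^sub>v x0) \<in> carrier_vec (horizon P * ny P)" by (rule mult_mat_vec_carrier[OF C Jx])
  have CHW: "?C *\<^sub>v (?H *\<^sub>v W) \<in> carrier_vec (horizon P * ny P)" by (rule mult_mat_vec_carrier[OF C HW])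
  note QV = mult_mat_vec_carrier[OF Q V] and QCJx = mult_mat_vec_carrier[OF Q CJx]
    and QCHW = mult_mat_vec_carrier[OF Q CHW]
  note SQV = mult_mat_vec_carrier[OF S QV] and SQCJx = mult_mat_vec_carrier[OF S QCJx]
    and SQCHW = mult_mat_vec_carrier[OF S QCHW] and Sr = mult_mat_vec_carrier[OF S r]
  have w: "P_zw P Q *\<^sub>v W = ?D *\<^sub>v (?H *\<^sub>v W) + ?D *\<^sub>v (?S *\<^sub>v (Q *\<^sub>v (?C *\<^sub>v (?H *\<^sub>v W))))"
    unfolding P_zw_def
    by (simp only: assoc_mult_mat_vec[OF D HS W] add_mult_distrib_mat_vec[OF H SQCH W]
      assoc_mult_mat_vec[OF SQC H W] assoc_mult_mat_vec[OF SQ C HW] assoc_mult_mat_vec[OF S Q CHW]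
      mult_add_distrib_mat_vec[OF D HW SQCHW])
  have v: "P_zv P Q *\<^sub>v V = ?D *\<^sub>v (?S *\<^sub>v (Q *\<^sub>v V))"
    unfolding P_zv_def by (simp only: assoc_mult_mat_vec[OF DS Q V] assoc_mult_mat_vec[OF D S QV])
  have x: "P_zx0 P Q *\<^sub>v x0 = ?D *\<^sub>v (?J *\<^sub>v x0) + ?D *\<^sub>v (?S *\<^sub>v (Q *\<^sub>v (?C *\<^sub>v (?J *\<^sub>v x0))))"
    unfolding P_zx0_def
    by (simp only: assoc_mult_mat_vec[OF DIS J x0] assoc_mult_mat_vec[OF D IS Jx]
      add_mult_distrib_mat_vec[OF one_carrier_mat SQC Jx] one_mult_mat_vec[OF Jx]
      assoc_mult_mat_vec[OF SQ C Jx] assoc_mult_mat_vec[OF S Q CJx]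
      mult_add_distrib_mat_vec[OF D Jx SQCJx])
  have l: "(P_zw P Q @\<^sub>c P_zv P Q @\<^sub>c P_zx0 P Q) *\<^sub>v (W @\<^sub>v V @\<^sub>v x0) =
      P_zw P Q *\<^sub>v W + (P_zv P Q *\<^sub>v V + P_zx0 P Q *\<^sub>v x0)"
    by (subst append_cols_mult_vec[OF Pw append_cols_carrier[OF Pv Px] W append_carrier_vec[OF V x0]],
      subst append_cols_mult_vec[OF Pv Px V x0]) (rule refl)
  have CE: "?C *\<^sub>v (?J *\<^sub>v x0) + ?C *\<^sub>v (?H *\<^sub>v W) \<in> carrier_vec (horizon P * ny P)"
    using CJx CHW by simp
  have QE: "Q *\<^sub>v (?C *\<^sub>v (?J *\<^sub>v x0)) + Q *\<^sub>v (?C *\<^sub>v (?H *\<^sub>v W)) \<in> carrier_vec (horizon P * nu P)"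
    using QCJx QCHW by simp
  have SU: "?S *\<^sub>v U = ?S *\<^sub>v r + (?S *\<^sub>v (Q *\<^sub>v (?C *\<^sub>v (?J *\<^sub>v x0))) + ?S *\<^sub>v (Q *\<^sub>v (?C *\<^sub>v (?H *\<^sub>v W))) + ?S *\<^sub>v (Q *\<^sub>v V))"
    unfolding U
    by (simp only: mult_add_distrib_mat_vec[OF C Jx HW] mult_add_distrib_mat_vec[OF Q CE V]
      mult_add_distrib_mat_vec[OF Q CJx CHW] mult_add_distrib_mat_vec[OF S r add_carrier_vec[OF QE QV]]
      mult_add_distrib_mat_vec[OF S QE QV] mult_add_distrib_mat_vec[OF S QCJx QCHW])
  have S1: "?S *\<^sub>v (Q *\<^sub>v (?C *\<^sub>v (?J *\<^sub>v x0))) + ?S *\<^sub>v (Q *\<^sub>v (?C *\<^sub>v (?H *\<^sub>v W))) \<in> carrier_vec ?N"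
    using SQCJx SQCHW by simp
  have S2: "?S *\<^sub>v (Q *\<^sub>v (?C *\<^sub>v (?J *\<^sub>v x0))) + ?S *\<^sub>v (Q *\<^sub>v (?C *\<^sub>v (?H *\<^sub>v W))) + ?S *\<^sub>v (Q *\<^sub>v V) \<in> carrier_vec ?N"
    using S1 SQV by simp
  have "?D *\<^sub>v (?J *\<^sub>v x0 + ?H *\<^sub>v W + ?S *\<^sub>v U) = ?D *\<^sub>v (?J *\<^sub>v x0) + ?D *\<^sub>v (?H *\<^sub>v W) +
      (?D *\<^sub>v (?S *\<^sub>v r) + (?D *\<^sub>v (?S *\<^sub>v (Q *\<^sub>v (?C *\<^sub>v (?J *\<^sub>v x0)))) +
        ?D *\<^sub>v (?S *\<^sub>v (Q *\<^sub>v (?C *\<^sub>v (?H *\<^sub>v W)))) + ?D *\<^sub>v (?S *\<^sub>v (Q *\<^sub>v V))))"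
    unfolding SU
    by (simp only: mult_add_distrib_mat_vec[OF D add_carrier_vec[OF Jx HW] add_carrier_vec[OF Sr S2]]
      mult_add_distrib_mat_vec[OF D Jx HW] mult_add_distrib_mat_vec[OF D Sr S2]
      mult_add_distrib_mat_vec[OF D S1 SQV] mult_add_distrib_mat_vec[OF D SQCJx SQCHW])
  moreover have "tilde_z P r = ?D *\<^sub>v (?S *\<^sub>v r) + bar_d P"
    unfolding tilde_z_def by (simp only: assoc_mult_mat_vec[OF D S r])
  ultimately show ?thesis unfolding l w v x using D d by (intro eq_vecI) auto
qed

section \<open>The polyhedron of stacked disturbances\<close>

lemma hreps:
  "is_hrep (nx P) (hX0 P)" "is_hrep (nx P) (hW P)" "is_hrep (ny P) (hV P)"
  "is_hrep (nu P) (hU P)" "is_hrep (nz P) (hZ P)"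
  using wd unfolding well_dimensioned_def by auto

text \<open>Nested to the right in the same way as the disturbance vector, so the product splits
  into its three components by two applications of the rule for four blocks.\<close>

lemma mat_G_eq:
  "mat_G P = four_block_mat (1\<^sub>m (horizon P) \<otimes>\<^sub>m fst (hW P))
     (0\<^sub>m (horizon P * nrows (hW P)) (horizon P * ny P + nx P))
     (0\<^sub>m (horizon P * nrows (hV P) + nrows (hX0 P)) (horizon P * nx P))
     (four_block_mat (1\<^sub>m (horizon P) \<otimes>\<^sub>m fst (hV P)) (0\<^sub>m (horizon P * nrows (hV P)) (nx P))
       (0\<^sub>m (nrows (hX0 P)) (horizon P * ny P)) (fst (hX0 P)))"
  using kron_hrep_carrier(1)[OF hreps(2), of "horizon P"] kron_hrep_carrier(1)[OF hreps(3), of "horizon P"]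
    hreps(1)
  unfolding mat_G_def diag_block_mat.simps(2)[of _ "M # Ms" for M Ms] diag_block_mat_singleton
  by (simp add: Let_def is_hrep_def)

lemma G_carrier:
  "mat_G P \<in> carrier_mat (horizon P * (nrows (hW P) + nrows (hV P)) + nrows (hX0 P))
     (horizon P * nx P + (horizon P * ny P + nx P))"
  "vec_g P \<in> carrier_vec (horizon P * (nrows (hW P) + nrows (hV P)) + nrows (hX0 P))"
proof -
  have X: "fst (hX0 P) \<in> carrier_mat (nrows (hX0 P)) (nx P)" "snd (hX0 P) \<in> carrier_vec (nrows (hX0 P))"
    using hreps(1) by (auto simp: is_hrep_def)
  have m: "horizon P * (nrows (hW P) + nrows (hV P)) + nrows (hX0 P) =
      horizon P * nrows (hW P) + (horizon P * nrows (hV P) + nrows (hX0 P))"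
    by (simp add: algebra_simps)
  show "mat_G P \<in> carrier_mat (horizon P * (nrows (hW P) + nrows (hV P)) + nrows (hX0 P))
     (horizon P * nx P + (horizon P * ny P + nx P))"
    unfolding mat_G_eq m
    by (intro four_block_carrier_mat kron_hrep_carrier(1)[OF hreps(2)] kron_hrep_carrier(1)[OF hreps(3)] X)
  show "vec_g P \<in> carrier_vec (horizon P * (nrows (hW P) + nrows (hV P)) + nrows (hX0 P))"
    unfolding vec_g_def m
    by (intro append_carrier_vec kron_hrep_carrier(2)[OF hreps(2)] kron_hrep_carrier(2)[OF hreps(3)] X)
qed

lemma disturbance_le_iff:
  assumes w: "\<And>t. t < horizon P \<Longrightarrow> w t \<in> carrier_vec (nx P)"
    and v: "\<And>t. t < horizon P \<Longrightarrow> v t \<in> carrier_vec (ny P)" and x0: "x0 \<in> carrier_vec (nx P)"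
  shows "mat_G P *\<^sub>v (stack (nx P) (horizon P) w @\<^sub>v stack (ny P) (horizon P) v @\<^sub>v x0) \<le> vec_g P \<longleftrightarrow>
    x0 \<in> polyhedron (nx P) (hX0 P) \<and>
    (\<forall>t<horizon P. w t \<in> polyhedron (nx P) (hW P) \<and> v t \<in> polyhedron (ny P) (hV P))"
proof -
  let ?T = "horizon P"
  let ?W = "stack (nx P) ?T w" and ?V = "stack (ny P) ?T v"
  have X: "fst (hX0 P) \<in> carrier_mat (nrows (hX0 P)) (nx P)" "snd (hX0 P) \<in> carrier_vec (nrows (hX0 P))"
    using hreps(1) by (auto simp: is_hrep_def)
  note HW = kron_hrep_carrier[OF hreps(2), of ?T] and HV = kron_hrep_carrier[OF hreps(3), of ?T]
  have Wc: "?W \<in> carrier_vec (?T * nx P)" and Vc: "?V \<in> carrier_vec (?T * ny P)" by (rule stack_carrier)+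
  note VX = four_block_carrier_mat[OF HV(1) X(1)] and vx = append_carrier_vec[OF Vc x0]
  have "mat_G P *\<^sub>v (?W @\<^sub>v ?V @\<^sub>v x0) =
      (1\<^sub>m ?T \<otimes>\<^sub>m fst (hW P)) *\<^sub>v ?W @\<^sub>v (1\<^sub>m ?T \<otimes>\<^sub>m fst (hV P)) *\<^sub>v ?V @\<^sub>v fst (hX0 P) *\<^sub>v x0"
  proof -
    have z: "0\<^sub>m i j *\<^sub>v y = 0\<^sub>v i" if "y \<in> carrier_vec j" for i j and y :: "real vec"
      using that by (intro eq_vecI) auto
    have "mat_G P *\<^sub>v (?W @\<^sub>v ?V @\<^sub>v x0) =
        ((1\<^sub>m ?T \<otimes>\<^sub>m fst (hW P)) *\<^sub>v ?W + 0\<^sub>v (?T * nrows (hW P))) @\<^sub>v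
        (0\<^sub>v (?T * nrows (hV P) + nrows (hX0 P)) +
          (((1\<^sub>m ?T \<otimes>\<^sub>m fst (hV P)) *\<^sub>v ?V + 0\<^sub>v (?T * nrows (hV P))) @\<^sub>v
           (0\<^sub>v (nrows (hX0 P)) + fst (hX0 P) *\<^sub>v x0)))"
      unfolding mat_G_eq
      by (simp only: four_block_mat_mult_vec[OF HW(1) zero_carrier_mat zero_carrier_mat VX Wc vx]
        four_block_mat_mult_vec[OF HV(1) zero_carrier_mat zero_carrier_mat X(1) Vc x0]
        z[OF Wc] z[OF Vc] z[OF vx] z[OF x0])
    then show ?thesis
      using mult_mat_vec_carrier[OF HW(1) Wc] mult_mat_vec_carrier[OF HV(1) Vc] mult_mat_vec_carrier[OF X(1) x0]
      by simp
  qed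
  then have "mat_G P *\<^sub>v (?W @\<^sub>v ?V @\<^sub>v x0) \<le> vec_g P \<longleftrightarrow>
      (1\<^sub>m ?T \<otimes>\<^sub>m fst (hW P)) *\<^sub>v ?W \<le> ones_vec ?T \<otimes>\<^sub>v snd (hW P) \<and>
      (1\<^sub>m ?T \<otimes>\<^sub>m fst (hV P)) *\<^sub>v ?V \<le> ones_vec ?T \<otimes>\<^sub>v snd (hV P) \<and> fst (hX0 P) *\<^sub>v x0 \<le> snd (hX0 P)"
    unfolding vec_g_def
    by (simp only: append_vec_le[OF mult_mat_vec_carrier[OF HW(1) Wc] HW(2)]
      append_vec_le[OF mult_mat_vec_carrier[OF HV(1) Vc] HV(2)])
  also have "\<dots> \<longleftrightarrow> x0 \<in> polyhedron (nx P) (hX0 P) \<and>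
    (\<forall>t<?T. w t \<in> polyhedron (nx P) (hW P) \<and> v t \<in> polyhedron (ny P) (hV P))"
    using polyhedron_stack_iff[OF hreps(2), of ?T w] polyhedron_stack_iff[OF hreps(3), of ?T v] w v x0
    by (auto simp: polyhedron_def[of _ "hX0 P"])
  finally show ?thesis .
qed

lemma disturbance_cases:
  assumes "\<xi> \<in> carrier_vec (horizon P * nx P + (horizon P * ny P + nx P))" "mat_G P *\<^sub>v \<xi> \<le> vec_g P"
  obtains w v x0 where "\<xi> = stack (nx P) (horizon P) w @\<^sub>v stack (ny P) (horizon P) v @\<^sub>v x0"
    "x0 \<in> polyhedron (nx P) (hX0 P)"
    "\<forall>t<horizon P. w t \<in> polyhedron (nx P) (hW P) \<and> v t \<in> polyhedron (ny P) (hV P)"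
proof -
  let ?T = "horizon P"
  obtain W Y where W: "W \<in> carrier_vec (?T * nx P)" and Y: "Y \<in> carrier_vec (?T * ny P + nx P)" and "\<xi> = W @\<^sub>v Y"
    \<comment> \<open>The rule for universal statements about concatenations is used with a
      predicate that fails exactly at \<xi>; hence some concatenation equals \<xi>.\<close>
    using assms(1) all_vec_append[of "?T * nx P" "?T * ny P + nx P" "\<lambda>x. x \<noteq> \<xi>"] by blast
  moreover obtain V x0 where V: "V \<in> carrier_vec (?T * ny P)" and x0: "x0 \<in> carrier_vec (nx P)" and "Y = V @\<^sub>v x0"
    using Y all_vec_append[of "?T * ny P" "nx P" "\<lambda>x. x \<noteq> Y"] by blast
  ultimately have \<xi>: "\<xi> = stack (nx P) ?T (\<lambda>t. vec_block (nx P) t W) @\<^sub>v stack (ny P) ?T (\<lambda>t. vec_block (ny P) t V) @\<^sub>v x0"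
    by (simp add: stack_vec_block)
  show thesis
    using that[OF \<xi>] assms(2)
      disturbance_le_iff[of "\<lambda>t. vec_block (nx P) t W" "\<lambda>t. vec_block (ny P) t V" x0] x0
    unfolding \<xi>[symmetric] by simp
qed

section \<open>Existence of trajectories and their closed form\<close>

lemma trajectory_exists:
  assumes F: "\<And>t s. t < horizon P \<Longrightarrow> s \<le> t \<Longrightarrow> F t s \<in> carrier_mat (nu P) (ny P)"
  shows "\<exists>x u y z. trajectory P \<sigma>m \<sigma>c f F x0 w v x u y z"
proof -
  let ?S = "\<lambda>t. {s. s \<le> t \<and> \<sigma>m s = 1}"
  \<comment> \<open>\<open>r\<close> is the candidate pair of state and input at time
    \<open>t\<close>, and \<open>st\<close> supplies the earlier pairs. The input may use the output
    at the current time, whose state is the first component of \<open>r\<close> itself; hence the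
    case distinction on \<open>s < t\<close>.\<close>
  let ?R = "\<lambda>st t r.
     fst r = (if t = 0 then x0 else sysA P *\<^sub>v fst (st (t - 1)) + sysB P *\<^sub>v snd (st (t - 1)) + w (t - 1)) \<and>
     snd r = (if \<sigma>c t = 1
       then f t + finsum_vec TYPE(real) (nu P)
         (\<lambda>s. F t s *\<^sub>v (sysC P *\<^sub>v fst (if s < t then st s else r) + v s)) (?S t)
       else if t = 0 then 0\<^sub>v (nu P) else snd (st (t - 1)))"
  have "\<exists>st. \<forall>t. ?R st t (st t)"
  \<comment> \<open>The two obligations are that the condition at time \<open>t\<close> reads
    \<open>st\<close> only at earlier times, and that it can be met: the state is fixed by the past,
    and the input by the past together with that state.\<close>
  proof (rule dependent_wellorder_choice)
    fix r :: "real vec \<times> real vec" and st st' :: "nat \<Rightarrow> real vec \<times> real vec" and t :: nat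
    assume *: "\<And>s. s < t \<Longrightarrow> st s = st' s"
    then have 1: "(if s < t then st s else r) = (if s < t then st' s else r)" for s by simp
    show "?R st t r = ?R st' t r"
    proof (cases "t = 0")
      case True
      then show ?thesis by simp
    next
      case False
      then have "st (t - 1) = st' (t - 1)" using * by simp
      then show ?thesis by (simp only: 1)
    qed
  next
    fix t :: nat and st :: "nat \<Rightarrow> real vec \<times> real vec"
    let ?x = "if t = 0 then x0 else sysA P *\<^sub>v fst (st (t - 1)) + sysB P *\<^sub>v snd (st (t - 1)) + w (t - 1)"
    have "?R st t (?x, if \<sigma>c t = 1
       then f t + finsum_vec TYPE(real) (nu P)
         (\<lambda>s. F t s *\<^sub>v (sysC P *\<^sub>v (if s < t then fst (st s) else ?x) + v s)) (?S t)
       else if t = 0 then 0\<^sub>v (nu P) else snd (st (t - 1)))"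
      by (simp add: if_distrib[of fst] cong: if_cong)
    then show "\<exists>r. ?R st t r" by blast
  qed
  then obtain st where st: "\<And>t. ?R st t (st t)" by blast
  let ?y = "\<lambda>t. if \<sigma>m t = 1 then Some (sysC P *\<^sub>v fst (st t) + v t) else None"
  have sum_eq: "finsum_vec TYPE(real) (nu P)
        (\<lambda>s. F t s *\<^sub>v (sysC P *\<^sub>v fst (if s < t then st s else st t) + v s)) (?S t) =
      finsum_vec TYPE(real) (nu P) (\<lambda>s. F t s *\<^sub>v the (?y s)) (?S t)" if t: "t < horizon P" for t
  proof -
    have "F t s *\<^sub>v y \<in> carrier_vec (nu P)" if "s \<in> ?S t" for s y
      using F[OF t, of s] that by (auto intro!: carrier_vecI)
    moreover have "finite (?S t)" by simp
    ultimately have fin: "finsum_vec TYPE(real) (nu P) (\<lambda>s. F t s *\<^sub>v g s) (?S t) =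
        vec (nu P) (\<lambda>a. \<Sum>s\<in>?S t. (F t s *\<^sub>v g s) $ a)" for g
      by (intro finsum_vec_eq_vec)
    have "sysC P *\<^sub>v fst (if s < t then st s else st t) + v s = the (?y s)" if "s \<in> ?S t" for s
      using that by (auto simp: not_less)
    then have "(\<Sum>s\<in>?S t. (F t s *\<^sub>v (sysC P *\<^sub>v fst (if s < t then st s else st t) + v s)) $ a) =
        (\<Sum>s\<in>?S t. (F t s *\<^sub>v the (?y s)) $ a)" for a
      by (intro sum.cong refl) (simp only:)
    then show ?thesis unfolding fin by (simp only:)
  qed
  have "trajectory P \<sigma>m \<sigma>c f F x0 w v (\<lambda>t. fst (st t)) (\<lambda>t. snd (st t)) ?y
      (\<lambda>t. sysD P *\<^sub>v fst (st t) + sysd P)"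
    unfolding trajectory_def
  proof (intro conjI allI impI)
    show "fst (st 0) = x0" using conjunct1[OF st[of 0]] by simp
    show "fst (st (Suc t)) = sysA P *\<^sub>v fst (st t) + sysB P *\<^sub>v snd (st t) + w t" for t
      using conjunct1[OF st[of "Suc t"]] by (simp only: nat.distinct if_False diff_Suc_1)
    show "snd (st t) = (if \<sigma>c t = 1
        then f t + finsum_vec TYPE(real) (nu P) (\<lambda>s. F t s *\<^sub>v the (?y s)) (?S t)
        else if t = 0 then 0\<^sub>v (nu P) else snd (st (t - 1)))" if "t < horizon P" for t
      using conjunct2[OF st[of t]] unfolding sum_eq[OF that] .
  qed (rule refl)+
  then show ?thesis by blast
qed

text \<open>The stacked dynamics and the stacked control law together give an implicit equation for
  the inputs with plant \<open>bar_C P * mat_S P\<close>. \<open>closed_loop_signal\<close> solves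
  it, and the outputs follow by substitution.\<close>

lemma trajectory_closed_loop:
  assumes tr: "trajectory P \<sigma>m \<sigma>c f F x0 w v x u y z"
    and F: "\<And>t s. t < horizon P \<Longrightarrow> s \<le> t \<Longrightarrow> F t s \<in> carrier_mat (nu P) (ny P)"
    and f: "\<And>t. t < horizon P \<Longrightarrow> f t \<in> carrier_vec (nu P)"
    and w: "\<And>t. t < horizon P \<Longrightarrow> w t \<in> carrier_vec (nx P)"
    and v: "\<And>t. t < horizon P \<Longrightarrow> v t \<in> carrier_vec (ny P)" and x0: "x0 \<in> carrier_vec (nx P)"
    and cl: "closed_loop (horizon P * nu P) (horizon P * ny P) (bar_C P * mat_S P)
      (eff_gain (horizon P) (nu P) (ny P) \<sigma>m \<sigma>c F) Q"
    and r: "r = (1\<^sub>m (horizon P * nu P) + Q * (bar_C P * mat_S P)) *\<^sub>v eff_offset (horizon P) (nu P) \<sigma>c f"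
  defines "\<xi> \<equiv> stack (nx P) (horizon P) w @\<^sub>v stack (ny P) (horizon P) v @\<^sub>v x0"
  shows "\<And>t. t < horizon P \<Longrightarrow> u t \<in> carrier_vec (nu P)"
    and "\<And>t. t < horizon P + 1 \<Longrightarrow> z t \<in> carrier_vec (nz P)"
    and "stack (nu P) (horizon P) u = (P_uw P Q @\<^sub>c P_uv P Q @\<^sub>c P_ux0 P Q) *\<^sub>v \<xi> + tilde_u P r"
    and "stack (nz P) (horizon P + 1) z = (P_zw P Q @\<^sub>c P_zv P Q @\<^sub>c P_zx0 P Q) *\<^sub>v \<xi> + tilde_z P r"
proof -
  let ?T = "horizon P"
  let ?W = "stack (nx P) ?T w" and ?V = "stack (ny P) ?T v" and ?X = "stack (nx P) (?T + 1) x"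
    and ?U = "stack (nu P) ?T u"
  let ?fs = "eff_offset ?T (nu P) \<sigma>c f" and ?Fs = "eff_gain ?T (nu P) (ny P) \<sigma>m \<sigma>c F"
  note C = stacked_carrier(1) and J = stacked_carrier(4) and H = stacked_carrier(5)
    and S = stacked_carrier(6)
  have xS: "x (Suc t) = sysA P *\<^sub>v x t + sysB P *\<^sub>v u t + w t" if "t < ?T" for t
    using tr that unfolding trajectory_def by blast
  have x0': "x 0 = x0" using tr unfolding trajectory_def by blast
  have x: "x t \<in> carrier_vec (nx P)" if "t \<le> ?T" for t
    using that x0 x0' xS w by (cases t) (auto intro!: carrier_vecI)
  have y: "y t = (if \<sigma>m t = 1 then Some (sysC P *\<^sub>v x t + v t) else None)" if "t < ?T" for t
    using tr that unfolding trajectory_def by blast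
  have zt: "z t = sysD P *\<^sub>v x t + sysd P" if "t \<le> ?T" for t
    using tr that unfolding trajectory_def by blast
  \<comment> \<open>A fictitious output, defined at every time. Where no measurement is taken it
    meets only zero blocks of the effective gain, so the law can be stacked without options.\<close>
  let ?y = "\<lambda>t. sysC P *\<^sub>v x t + v t"
  have yc: "?y t \<in> carrier_vec (ny P)" if "t < ?T" for t
    using v[OF that] by (auto intro!: carrier_vecI)
  have ueq: "u t = (if \<sigma>c t = 1
         then f t + vec (nu P) (\<lambda>a. \<Sum>s | s \<le> t \<and> \<sigma>m s = 1. (F t s *\<^sub>v ?y s) $ a)
         else if t = 0 then 0\<^sub>v (nu P) else u (t - 1))" if t: "t < ?T" for t
  proof -
    have "finsum_vec TYPE(real) (nu P) (\<lambda>s. F t s *\<^sub>v the (y s)) {s. s \<le> t \<and> \<sigma>m s = 1} =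
        vec (nu P) (\<lambda>a. \<Sum>s | s \<le> t \<and> \<sigma>m s = 1. (F t s *\<^sub>v the (y s)) $ a)"
      by (intro finsum_vec_eq_vec) (auto intro!: carrier_vecI simp: carrier_matD(1)[OF F[OF t]])
    also have "\<dots> = vec (nu P) (\<lambda>a. \<Sum>s | s \<le> t \<and> \<sigma>m s = 1. (F t s *\<^sub>v ?y s) $ a)"
      using y t by (intro eq_vecI) (auto intro!: sum.cong)
    finally show ?thesis using tr t unfolding trajectory_def by simp
  qed
  show u: "u t \<in> carrier_vec (nu P)" if "t < ?T" for t
    using that
  proof (induction t)
    case 0
    then show ?case using ueq[OF 0] f[OF 0] by (auto intro!: carrier_vecI)
  next
    case (Suc t)
    then show ?case using ueq[OF Suc.prems] f[OF Suc.prems] by (auto intro!: carrier_vecI)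
  qed
  show z: "z t \<in> carrier_vec (nz P)" if "t < ?T + 1" for t
    using zt[of t] that sys_carrier(5) by (auto intro!: carrier_vecI)
  have cF: "?Fs \<in> carrier_mat (?T * nu P) (?T * ny P)" and cf: "?fs \<in> carrier_vec (?T * nu P)"
    by (simp_all add: eff_gain_def eff_offset_def)
  have cQ: "Q \<in> carrier_mat (?T * nu P) (?T * ny P)" using cl unfolding closed_loop_def by blast
  have W: "?W \<in> carrier_vec (?T * nx P)" and V: "?V \<in> carrier_vec (?T * ny P)" and U: "?U \<in> carrier_vec (?T * nu P)"
    by (rule stack_carrier)+
  have cr: "r \<in> carrier_vec (?T * nu P)"
    unfolding r using cf mult_carrier_mat[OF cQ plant_carrier]
    by (intro mult_mat_vec_carrier[of _ _ "?T * nu P"]) auto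
  \<comment> \<open>The state response under zero input. The output then splits into the plant
    applied to the inputs and an external term \<open>bar_C P *\<^sub>v ?p + ?V\<close>.\<close>
  let ?p = "mat_J P *\<^sub>v x0 + mat_H P *\<^sub>v ?W"
  have p: "?p \<in> carrier_vec ((?T + 1) * nx P)"
    using mult_mat_vec_carrier[OF J x0] mult_mat_vec_carrier[OF H W] by simp
  have SU: "mat_S P *\<^sub>v ?U \<in> carrier_vec ((?T + 1) * nx P)" by (rule mult_mat_vec_carrier[OF S U])
  have X: "?X = ?p + mat_S P *\<^sub>v ?U"
    using state_stacked[of x u w] x0 x0' u w xS x by simp
  have "bar_C P *\<^sub>v ?X = stack (ny P) ?T (\<lambda>t. sysC P *\<^sub>v x t)"
    unfolding bar_C_of_blocks using x
    by (intro block_diag_mult_stack sys_carrier(3)) auto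
  then have "bar_C P *\<^sub>v ?X + ?V = stack (ny P) ?T ?y" using v by (simp add: stack_add)
  then have "?U = ?fs + ?Fs *\<^sub>v (bar_C P *\<^sub>v ?X + ?V)"
    using control_stacked[of ?T F "nu P" "ny P" f ?y u \<sigma>c \<sigma>m] F f yc ueq by simp
  also have "bar_C P *\<^sub>v ?X + ?V = bar_C P * mat_S P *\<^sub>v ?U + (bar_C P *\<^sub>v ?p + ?V)"
  proof -
    have "bar_C P *\<^sub>v ?X = bar_C P *\<^sub>v ?p + bar_C P * mat_S P *\<^sub>v ?U"
      unfolding X by (simp only: mult_add_distrib_mat_vec[OF C p SU] assoc_mult_mat_vec[OF C S U])
    then show ?thesis
      using mult_mat_vec_carrier[OF C p] mult_mat_vec_carrier[OF plant_carrier U] V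
      by (simp only:) (intro eq_vecI; simp)
  qed
  finally have "?U = ?fs + ?Fs *\<^sub>v (bar_C P * mat_S P *\<^sub>v ?U + (bar_C P *\<^sub>v ?p + ?V))" .
  moreover have "bar_C P *\<^sub>v ?p + ?V \<in> carrier_vec (?T * ny P)" using mult_mat_vec_carrier[OF C p] V by simp
  ultimately have U_eq: "?U = r + Q *\<^sub>v (bar_C P *\<^sub>v ?p + ?V)"
    unfolding r by (rule closed_loop_signal[OF cl U cf, rotated])
  show "?U = (P_uw P Q @\<^sub>c P_uv P Q @\<^sub>c P_ux0 P Q) *\<^sub>v \<xi> + tilde_u P r"
    unfolding \<xi>_def closed_form_u[OF cQ cr W V x0] by (rule U_eq)
  have "stack (nz P) (?T + 1) z = stack (nz P) (?T + 1) (\<lambda>t. sysD P *\<^sub>v x t) + stack (nz P) (?T + 1) (\<lambda>_. sysd P)"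
    using zt sys_carrier(5) by (subst stack_add) (auto intro!: stack_cong)
  also have "stack (nz P) (?T + 1) (\<lambda>t. sysD P *\<^sub>v x t) = bar_D P *\<^sub>v ?X"
    unfolding bar_D_def using x by (intro kron_one_mult_stack[symmetric] sys_carrier(4)) auto
  also have "stack (nz P) (?T + 1) (\<lambda>_. sysd P) = bar_d P"
    unfolding bar_d_def kron_ones_stack using sys_carrier(5) by simp
  finally show "stack (nz P) (?T + 1) z = (P_zw P Q @\<^sub>c P_zv P Q @\<^sub>c P_zx0 P Q) *\<^sub>v \<xi> + tilde_z P r"
    unfolding \<xi>_def closed_form_z[OF cQ cr W V x0 U_eq] X .
qed

section \<open>The worst-case form of the constraints, shared by both problems\<close>

lemma closed_form_carrier:
  assumes Q: "Q \<in> carrier_mat (horizon P * nu P) (horizon P * ny P)" and r: "r \<in> carrier_vec (horizon P * nu P)"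
  shows "P_zw P Q @\<^sub>c P_zv P Q @\<^sub>c P_zx0 P Q \<in>
      carrier_mat ((horizon P + 1) * nz P) (horizon P * nx P + (horizon P * ny P + nx P))"
    "P_uw P Q @\<^sub>c P_uv P Q @\<^sub>c P_ux0 P Q \<in>
      carrier_mat (horizon P * nu P) (horizon P * nx P + (horizon P * ny P + nx P))"
    "tilde_z P r \<in> carrier_vec ((horizon P + 1) * nz P)"
    "tilde_u P r \<in> carrier_vec (horizon P * nu P)"
proof -
  note C = stacked_carrier(1) and D = stacked_carrier(2) and d = stacked_carrier(3)
    and J = stacked_carrier(4) and H = stacked_carrier(5) and S = stacked_carrier(6)
  note QC = mult_carrier_mat[OF Q C] and SQC = mult_carrier_mat[OF mult_carrier_mat[OF S Q] C]
    and DS = mult_carrier_mat[OF D S]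
  show "P_zw P Q @\<^sub>c P_zv P Q @\<^sub>c P_zx0 P Q \<in>
      carrier_mat ((horizon P + 1) * nz P) (horizon P * nx P + (horizon P * ny P + nx P))"
    unfolding P_zw_def P_zv_def P_zx0_def
    by (intro append_cols_carrier mult_carrier_mat[OF D add_carrier_mat[OF mult_carrier_mat[OF SQC H]]]
      mult_carrier_mat[OF DS Q] mult_carrier_mat[OF mult_carrier_mat[OF D add_carrier_mat[OF SQC]] J])
  show "P_uw P Q @\<^sub>c P_uv P Q @\<^sub>c P_ux0 P Q \<in>
      carrier_mat (horizon P * nu P) (horizon P * nx P + (horizon P * ny P + nx P))"
    unfolding P_uw_def P_uv_def P_ux0_def
    by (intro append_cols_carrier mult_carrier_mat[OF QC H] Q mult_carrier_mat[OF QC J])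
  show "tilde_z P r \<in> carrier_vec ((horizon P + 1) * nz P)"
    unfolding tilde_z_def by (intro add_carrier_vec mult_mat_vec_carrier[OF DS r] d)
  show "tilde_u P r \<in> carrier_vec (horizon P * nu P)" unfolding tilde_u_def by (rule r)
qed

text \<open>The meeting point of the two problems: it mentions neither multipliers nor trajectories,
  and the gains enter only through (Q, r).\<close>

definition robust_z :: "real mat \<Rightarrow> real vec \<Rightarrow> bool" where
  "robust_z Q r \<longleftrightarrow> (\<forall>\<xi>\<in>carrier_vec (horizon P * nx P + (horizon P * ny P + nx P)). mat_G P *\<^sub>v \<xi> \<le> vec_g P \<longrightarrow>
     (1\<^sub>m (horizon P + 1) \<otimes>\<^sub>m fst (hZ P)) *\<^sub>v
       ((P_zw P Q @\<^sub>c P_zv P Q @\<^sub>c P_zx0 P Q) *\<^sub>v \<xi> + tilde_z P r) \<le> ones_vec (horizon P + 1) \<otimes>\<^sub>v snd (hZ P))"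

definition robust_u :: "real mat \<Rightarrow> real vec \<Rightarrow> bool" where
  "robust_u Q r \<longleftrightarrow> (\<forall>\<xi>\<in>carrier_vec (horizon P * nx P + (horizon P * ny P + nx P)). mat_G P *\<^sub>v \<xi> \<le> vec_g P \<longrightarrow>
     (1\<^sub>m (horizon P) \<otimes>\<^sub>m fst (hU P)) *\<^sub>v
       ((P_uw P Q @\<^sub>c P_uv P Q @\<^sub>c P_ux0 P Q) *\<^sub>v \<xi> + tilde_u P r) \<le> ones_vec (horizon P) \<otimes>\<^sub>v snd (hU P))"

lemma disturbance_nonempty:
  assumes "polyhedron (nx P) (hX0 P) \<noteq> {}" "polyhedron (nx P) (hW P) \<noteq> {}" "polyhedron (ny P) (hV P) \<noteq> {}"
  obtains \<xi> where "\<xi> \<in> carrier_vec (horizon P * nx P + (horizon P * ny P + nx P))" "mat_G P *\<^sub>v \<xi> \<le> vec_g P"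
proof -
  obtain x0 w v where m: "x0 \<in> polyhedron (nx P) (hX0 P)" "w \<in> polyhedron (nx P) (hW P)" "v \<in> polyhedron (ny P) (hV P)"
    using assms by blast
  then have c: "x0 \<in> carrier_vec (nx P)" "w \<in> carrier_vec (nx P)" "v \<in> carrier_vec (ny P)"
    by (auto simp: polyhedron_def)
  show thesis
  proof (rule that)
    show "stack (nx P) (horizon P) (\<lambda>_. w) @\<^sub>v stack (ny P) (horizon P) (\<lambda>_. v) @\<^sub>v x0 \<in>
        carrier_vec (horizon P * nx P + (horizon P * ny P + nx P))"
      by (intro append_carrier_vec stack_carrier c)
    show "mat_G P *\<^sub>v (stack (nx P) (horizon P) (\<lambda>_. w) @\<^sub>v stack (ny P) (horizon P) (\<lambda>_. v) @\<^sub>v x0) \<le> vec_g P"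
      using disturbance_le_iff[of "\<lambda>_. w" "\<lambda>_. v" x0] c m by blast
  qed
qed

text \<open>For fixed (Q, r) the multipliers \<open>\<Lambda>\<close> and \<open>\<Gamma>\<close>
  occur in separate constraints, so their existence splits into two instances of the Farkas
  equivalence.\<close>

lemma milp_feasible_iff_robust:
  assumes ne: "polyhedron (nx P) (hX0 P) \<noteq> {}" "polyhedron (nx P) (hW P) \<noteq> {}" "polyhedron (ny P) (hV P) \<noteq> {}"
  shows "(\<exists>\<Lambda> \<Gamma>. milp_feasible P \<sigma>m \<sigma>c Q r \<Lambda> \<Gamma>) \<longleftrightarrow> admissible_schedules P \<sigma>m \<sigma>c \<and>
    respects_schedules (horizon P) (nu P) (ny P) \<sigma>m \<sigma>c Q r \<and> robust_z Q r \<and> robust_u Q r"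
proof (cases "respects_schedules (horizon P) (nu P) (ny P) \<sigma>m \<sigma>c Q r")
  case True
  then have Q: "Q \<in> carrier_mat (horizon P * nu P) (horizon P * ny P)" and r: "r \<in> carrier_vec (horizon P * nu P)"
    by (auto simp: respects_schedules_def block_lower_triangular_def)
  obtain \<xi> where \<xi>: "\<xi> \<in> carrier_vec (horizon P * nx P + (horizon P * ny P + nx P))" "mat_G P *\<^sub>v \<xi> \<le> vec_g P"
    using disturbance_nonempty[OF ne] by blast
  note c = closed_form_carrier[OF Q r] and G = G_carrier and h = hreps
  note Z = multipliers_iff_robust[OF G c(1) kron_hrep_carrier(1)[OF h(5)] c(3) kron_hrep_carrier(2)[OF h(5)] \<xi>]
  note U = multipliers_iff_robust[OF G c(2) kron_hrep_carrier(1)[OF h(4)] c(4) kron_hrep_carrier(2)[OF h(4)] \<xi>]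
  show ?thesis
    unfolding robust_z_def robust_u_def Z[symmetric] U[symmetric] milp_feasible_def Let_def
    using True r unfolding respects_schedules_iff_blocks by blast
next
  case False
  then show ?thesis unfolding respects_schedules_iff_blocks milp_feasible_def Let_def by blast
qed

text \<open>All trajectories of one disturbance share the same closed form, and there is at least
  one, so the quantifier over trajectories disappears. The remaining disturbances are in
  correspondence with the points of the stacked polyhedron.\<close>

lemma safety_feasible_iff_robust:
  assumes F: "\<And>t s. t < horizon P \<Longrightarrow> s \<le> t \<Longrightarrow> F t s \<in> carrier_mat (nu P) (ny P)"
    and f: "\<And>t. t < horizon P \<Longrightarrow> f t \<in> carrier_vec (nu P)"
    and cl: "closed_loop (horizon P * nu P) (horizon P * ny P) (bar_C P * mat_S P)
      (eff_gain (horizon P) (nu P) (ny P) \<sigma>m \<sigma>c F) Q"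
    and r: "r = (1\<^sub>m (horizon P * nu P) + Q * (bar_C P * mat_S P)) *\<^sub>v eff_offset (horizon P) (nu P) \<sigma>c f"
  shows "safety_feasible P \<sigma>m \<sigma>c f F \<longleftrightarrow> admissible_schedules P \<sigma>m \<sigma>c \<and> robust_z Q r \<and> robust_u Q r"
proof -
  let ?T = "horizon P"
  let ?safe = "\<lambda>u z. (\<forall>t\<le>?T. z t \<in> polyhedron (nz P) (hZ P)) \<and> (\<forall>t<?T. u t \<in> polyhedron (nu P) (hU P))"
  let ?\<xi> = "\<lambda>w v x0. stack (nx P) ?T w @\<^sub>v stack (ny P) ?T v @\<^sub>v x0"
  let ?Z = "\<lambda>\<xi>. (1\<^sub>m (?T + 1) \<otimes>\<^sub>m fst (hZ P)) *\<^sub>v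
       ((P_zw P Q @\<^sub>c P_zv P Q @\<^sub>c P_zx0 P Q) *\<^sub>v \<xi> + tilde_z P r) \<le> ones_vec (?T + 1) \<otimes>\<^sub>v snd (hZ P)"
  let ?U = "\<lambda>\<xi>. (1\<^sub>m ?T \<otimes>\<^sub>m fst (hU P)) *\<^sub>v
       ((P_uw P Q @\<^sub>c P_uv P Q @\<^sub>c P_ux0 P Q) *\<^sub>v \<xi> + tilde_u P r) \<le> ones_vec ?T \<otimes>\<^sub>v snd (hU P)"
  let ?dist = "\<lambda>w v x0. x0 \<in> polyhedron (nx P) (hX0 P) \<and>
      (\<forall>t<?T. w t \<in> polyhedron (nx P) (hW P) \<and> v t \<in> polyhedron (ny P) (hV P))"
  have dist: "x0 \<in> carrier_vec (nx P)" "\<And>t. t < ?T \<Longrightarrow> w t \<in> carrier_vec (nx P)"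
    "\<And>t. t < ?T \<Longrightarrow> v t \<in> carrier_vec (ny P)" if "?dist w v x0" for w v x0
    using that by (auto simp: polyhedron_def)
  have safe: "?safe u z \<longleftrightarrow> ?Z (?\<xi> w v x0) \<and> ?U (?\<xi> w v x0)"
    if d: "?dist w v x0" and tr: "trajectory P \<sigma>m \<sigma>c f F x0 w v x u y z" for w v x0 x u y z
  proof -
    note T = trajectory_closed_loop[OF tr F f dist(2,3,1)[OF d] cl r]
    have u: "stack (nu P) ?T u = (P_uw P Q @\<^sub>c P_uv P Q @\<^sub>c P_ux0 P Q) *\<^sub>v ?\<xi> w v x0 + tilde_u P r"
      by (rule T(3))
    have z: "stack (nz P) (?T + 1) z = (P_zw P Q @\<^sub>c P_zv P Q @\<^sub>c P_zx0 P Q) *\<^sub>v ?\<xi> w v x0 + tilde_z P r"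
      by (rule T(4))
    have "(\<forall>t<?T + 1. z t \<in> polyhedron (nz P) (hZ P)) \<longleftrightarrow> ?Z (?\<xi> w v x0)"
      unfolding z[symmetric] by (rule polyhedron_stack_iff[OF hreps(5)]) (rule T(2))
    moreover have "(\<forall>t<?T. u t \<in> polyhedron (nu P) (hU P)) \<longleftrightarrow> ?U (?\<xi> w v x0)"
      unfolding u[symmetric] by (rule polyhedron_stack_iff[OF hreps(4)]) (rule T(1))
    ultimately show ?thesis by (simp add: less_Suc_eq_le)
  qed
  have "safety_feasible P \<sigma>m \<sigma>c f F \<longleftrightarrow> admissible_schedules P \<sigma>m \<sigma>c \<and>
      (\<forall>x0 w v x u y z. ?dist w v x0 \<longrightarrow> trajectory P \<sigma>m \<sigma>c f F x0 w v x u y z \<longrightarrow> ?safe u z)"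
    unfolding safety_feasible_def using F f by blast
  also have "\<dots> \<longleftrightarrow> admissible_schedules P \<sigma>m \<sigma>c \<and>
      (\<forall>x0 w v. ?dist w v x0 \<longrightarrow> ?Z (?\<xi> w v x0) \<and> ?U (?\<xi> w v x0))"
  proof -
    have "(\<forall>x u y z. ?dist w v x0 \<longrightarrow> trajectory P \<sigma>m \<sigma>c f F x0 w v x u y z \<longrightarrow> ?safe u z) \<longleftrightarrow>
        (?dist w v x0 \<longrightarrow> ?Z (?\<xi> w v x0) \<and> ?U (?\<xi> w v x0))" for x0 w v
    proof (cases "?dist w v x0")
      case True
      have "\<exists>x u y z. trajectory P \<sigma>m \<sigma>c f F x0 w v x u y z"
        by (rule trajectory_exists) (rule F)
      then obtain x u y z where "trajectory P \<sigma>m \<sigma>c f F x0 w v x u y z" by blast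
      then show ?thesis using safe[OF True] by blast
    qed blast
    then show ?thesis by (simp only:)
  qed
  also have "(\<forall>x0 w v. ?dist w v x0 \<longrightarrow> ?Z (?\<xi> w v x0) \<and> ?U (?\<xi> w v x0)) \<longleftrightarrow>
      (\<forall>\<xi>\<in>carrier_vec (?T * nx P + (?T * ny P + nx P)). mat_G P *\<^sub>v \<xi> \<le> vec_g P \<longrightarrow> ?Z \<xi> \<and> ?U \<xi>)"
    (is "?l \<longleftrightarrow> ?r")
  proof
    assume l: ?l
    show ?r
    proof (intro ballI impI)
      fix \<xi> assume "\<xi> \<in> carrier_vec (?T * nx P + (?T * ny P + nx P))" "mat_G P *\<^sub>v \<xi> \<le> vec_g P"
      then obtain w v x0 where "\<xi> = ?\<xi> w v x0" "?dist w v x0"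
        using disturbance_cases by metis
      then show "?Z \<xi> \<and> ?U \<xi>" using l by blast
    qed
  next
    assume r: ?r
    show ?l
    proof (intro allI impI)
      fix x0 w v assume d: "?dist w v x0"
      have "?\<xi> w v x0 \<in> carrier_vec (?T * nx P + (?T * ny P + nx P))"
        by (intro append_carrier_vec stack_carrier dist(1)[OF d])
      moreover have "mat_G P *\<^sub>v ?\<xi> w v x0 \<le> vec_g P"
        by (rule iffD2[OF disturbance_le_iff[OF dist(2,3,1)[OF d]]]) (use d in blast)+
      ultimately show "?Z (?\<xi> w v x0) \<and> ?U (?\<xi> w v x0)" using r by blast
    qed
  qed
  finally show ?thesis unfolding robust_z_def robust_u_def by blast
qed

section \<open>The inverse in the transformation from (Q, r) to gains\<close>

lemma loop_mat_inverse:
  assumes cl: "closed_loop (horizon P * nu P) (horizon P * ny P) (bar_C P * mat_S P) F Q"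
  shows "invertible_mat (loop_mat P Q)"
    and "the (mat_inverse (loop_mat P Q)) = 1\<^sub>m (horizon P * nu P) - F * (bar_C P * mat_S P)"
proof -
  let ?n = "horizon P * nu P" and ?K = "bar_C P * mat_S P"
  have Q: "Q \<in> carrier_mat ?n (horizon P * ny P)" and F: "F \<in> carrier_mat ?n (horizon P * ny P)"
    using cl unfolding closed_loop_def by blast+
  have L: "loop_mat P Q = 1\<^sub>m ?n + Q * ?K"
    unfolding loop_mat_def
    by (simp only: assoc_mult_mat[OF Q stacked_carrier(1) stacked_carrier(6)])
  have Lc: "loop_mat P Q \<in> carrier_mat ?n ?n"
    unfolding L using mult_carrier_mat[OF Q plant_carrier] by simp
  have Nc: "1\<^sub>m ?n - F * ?K \<in> carrier_mat ?n ?n"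
    by (rule minus_carrier_mat[OF mult_carrier_mat[OF F plant_carrier]])
  note inv = closed_loop_inverse[OF cl, folded L]
  show "invertible_mat (loop_mat P Q)"
    unfolding invertible_mat_def inverts_mat_def using inv Lc Nc
    by (intro conjI exI[of _ "1\<^sub>m ?n - F * ?K"]) auto
  \<comment> \<open>Being a unit rules out that \<open>mat_inverse\<close> returns
    \<open>None\<close>; uniqueness of inverses then identifies the matrix it returns.\<close>
  have "loop_mat P Q \<in> Units (ring_mat TYPE(real) ?n ())"
    unfolding Units_def ring_mat_def using inv Lc Nc by auto
  then obtain N where N: "mat_inverse (loop_mat P Q) = Some N"
    using mat_inverse(1)[OF Lc, of "()"] by (cases "mat_inverse (loop_mat P Q)") auto
  note N' = mat_inverse(2)[OF Lc N]
  have "N = N * (loop_mat P Q * (1\<^sub>m ?n - F * ?K))" using inv N' right_mult_one_mat[of N ?n ?n] by simp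
  also have "\<dots> = N * loop_mat P Q * (1\<^sub>m ?n - F * ?K)"
    using N' Lc Nc by (intro assoc_mult_mat[symmetric]) auto
  also have "\<dots> = 1\<^sub>m ?n - F * ?K" using N' left_mult_one_mat[OF Nc] by simp
  finally show "the (mat_inverse (loop_mat P Q)) = 1\<^sub>m ?n - F * ?K" unfolding N by simp
qed

text \<open>With the inverse known to be 1 - F K, the product with Q is Q - F K Q, which is F by the
  first fixed-point equation.\<close>

lemma stacked_F_closed_loop:
  assumes cl: "closed_loop (horizon P * nu P) (horizon P * ny P) (bar_C P * mat_S P) F Q"
  shows "stacked_F P Q = F"
proof -
  let ?n = "horizon P * nu P" and ?K = "bar_C P * mat_S P"
  have Q: "Q \<in> carrier_mat ?n (horizon P * ny P)" and F: "F \<in> carrier_mat ?n (horizon P * ny P)"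
    and e: "Q = F + F * ?K * Q"
    using cl unfolding closed_loop_def by blast+
  have FK: "F * ?K \<in> carrier_mat ?n ?n" by (rule mult_carrier_mat[OF F plant_carrier])
  have "stacked_F P Q = 1\<^sub>m ?n * Q - F * ?K * Q"
    unfolding stacked_F_def loop_mat_inverse(2)[OF cl]
    by (rule minus_mult_distrib_mat[OF one_carrier_mat FK Q])
  also have "1\<^sub>m ?n * Q = Q" by (rule left_mult_one_mat[OF Q])
  also have "Q - F * ?K * Q = F"
    using add_minus_cancel_mat[OF F mult_carrier_mat[OF FK Q]] e by simp
  finally show ?thesis .
qed

end

text \<open>Given gains are compared with the reconstructed ones only at active control times and
  measured outputs: all other entries are arbitrary in the safety problem and leave no trace in (Q,
  r).\<close>

theorem theorem1:
  fixes P :: safety_problem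
  assumes "horizon P \<ge> 1"
    and "well_dimensioned P"
    and "polyhedron (nx P) (hX0 P) \<noteq> {}"
    and "polyhedron (nx P) (hW P) \<noteq> {}"
    and "polyhedron (ny P) (hV P) \<noteq> {}"
  shows
    "((\<exists>\<sigma>m \<sigma>c f F. safety_feasible P \<sigma>m \<sigma>c f F) \<longleftrightarrow>
      (\<exists>\<sigma>m \<sigma>c Q r \<Lambda> \<Gamma>. milp_feasible P \<sigma>m \<sigma>c Q r \<Lambda> \<Gamma>)) \<and>
     (\<forall>\<sigma>m \<sigma>c. (\<exists>f F. safety_feasible P \<sigma>m \<sigma>c f F) \<longleftrightarrow>
               (\<exists>Q r \<Lambda> \<Gamma>. milp_feasible P \<sigma>m \<sigma>c Q r \<Lambda> \<Gamma>)) \<and>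
     (\<forall>\<sigma>m \<sigma>c Q r \<Lambda> \<Gamma>. milp_feasible P \<sigma>m \<sigma>c Q r \<Lambda> \<Gamma> \<longrightarrow>
        invertible_mat (loop_mat P Q) \<and>
        block_lower_triangular (horizon P) (nu P) (ny P) (stacked_F P Q) \<and>
        safety_feasible P \<sigma>m \<sigma>c (gain_f P Q r) (gain_F P Q)) \<and>
     (\<forall>\<sigma>m \<sigma>c f F. safety_feasible P \<sigma>m \<sigma>c f F \<longrightarrow>
        (\<exists>Q r \<Lambda> \<Gamma>. milp_feasible P \<sigma>m \<sigma>c Q r \<Lambda> \<Gamma> \<and>
           (\<forall>t<horizon P. \<sigma>c t = 1 \<longrightarrow>
              gain_f P Q r t = f t \<and>
              (\<forall>\<tau>\<le>t. \<sigma>m \<tau> = 1 \<longrightarrow> gain_F P Q t \<tau> = F t \<tau>))))"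
proof -
  let ?T = "horizon P"
  let ?n = "?T * nu P" and ?m = "?T * ny P" and ?K = "bar_C P * mat_S P"
  note wd = assms(2) and milp_iff = milp_feasible_iff_robust[OF assms(2-5)]
  note K = plant_carrier[OF wd] and Ksc = plant_strictly_causal[OF wd]
  have to_safety: "invertible_mat (loop_mat P Q) \<and> block_lower_triangular ?T (nu P) (ny P) (stacked_F P Q) \<and>
      safety_feasible P \<sigma>m \<sigma>c (gain_f P Q r) (gain_F P Q)"
    if milp: "milp_feasible P \<sigma>m \<sigma>c Q r \<Lambda> \<Gamma>" for \<sigma>m \<sigma>c Q r \<Lambda> \<Gamma>
  proof -
    have adm: "admissible_schedules P \<sigma>m \<sigma>c" and R: "respects_schedules ?T (nu P) (ny P) \<sigma>m \<sigma>c Q r"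
      and rob: "robust_z P Q r" "robust_u P Q r"
      using milp milp_iff by blast+
    have Q: "Q \<in> carrier_mat ?n ?m" "causal (nu P) (ny P) Q" and r: "r \<in> carrier_vec ?n"
      using R unfolding respects_schedules_def block_lower_triangular_iff_causal by auto
    have mK: "- ?K \<in> carrier_mat ?m ?n" using K by simp
    \<comment> \<open>The gain is found by closing the loop around -K, starting from Q; symmetry
      then makes Q the closed loop of this gain around K.\<close>
    obtain F where "closed_loop ?n ?m (- ?K) Q F"
      using closed_loop_exists[OF Q mK strictly_causal_uminus[OF Ksc]] by blast
    then have cl': "closed_loop ?n ?m (- ?K) Q F" and cl: "closed_loop ?n ?m ?K F Q"
      using closed_loop_sym[of ?n ?m "- ?K" Q F] by simp_all
    let ?f = "(1\<^sub>m ?n - F * ?K) *\<^sub>v r"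
    have F: "F \<in> carrier_mat ?n ?m" using cl unfolding closed_loop_def by blast
    have FK: "F * ?K \<in> carrier_mat ?n ?n" and QK: "Q * ?K \<in> carrier_mat ?n ?n"
      using F Q(1) K by auto
    have N: "1\<^sub>m ?n - F * ?K \<in> carrier_mat ?n ?n" by (rule minus_carrier_mat[OF FK])
    have M: "1\<^sub>m ?n + Q * ?K \<in> carrier_mat ?n ?n" using QK by simp
    have sF: "stacked_F P Q = F" by (rule stacked_F_closed_loop[OF wd cl])
    have sf: "stacked_f P Q r = ?f" unfolding stacked_f_def loop_mat_inverse(2)[OF wd cl] ..
    \<comment> \<open>In this form the offset \<open>?f\<close> is the image of \<open>r\<close>
      under the transfer for the reversed loop.\<close>
    have "1\<^sub>m ?n - F * ?K = 1\<^sub>m ?n + F * - ?K"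
      using FK F K by (intro eq_matI) auto
    then have RF: "respects_schedules ?T (nu P) (ny P) \<sigma>m \<sigma>c F ?f"
      using respects_schedules_closed_loop[OF cl' strictly_causal_uminus[OF Ksc] R, of ?f] by simp
    have \<sigma>: "\<And>t. t < ?T \<Longrightarrow> \<sigma>m t \<in> {0, 1} \<and> \<sigma>c t \<in> {0, 1}"
      using adm unfolding admissible_schedules_def by blast
    \<comment> \<open>The reconstructed gains already respect the schedules, so their effective
      versions are the stacked matrices themselves and the closed loop found above is the right
      one.\<close>
    have eff: "eff_gain ?T (nu P) (ny P) \<sigma>m \<sigma>c (gain_F P Q) = F" "eff_offset ?T (nu P) \<sigma>c (gain_f P Q r) = ?f"
      using eff_of_respects_schedules[OF \<sigma> RF] unfolding gain_F_def gain_f_def sF sf by simp_all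
    have "r = (1\<^sub>m ?n + Q * ?K) *\<^sub>v ?f"
      using closed_loop_inverse(1)[OF cl] r assoc_mult_mat_vec[OF M N r] by simp
    moreover have "gain_F P Q t s \<in> carrier_mat (nu P) (ny P)" if "t < ?T" "s \<le> t" for t s
      unfolding gain_F_def sF using that by (intro mat_block_carrier[OF F]) auto
    moreover have "gain_f P Q r t \<in> carrier_vec (nu P)" for t by (simp add: gain_f_def)
    ultimately have "safety_feasible P \<sigma>m \<sigma>c (gain_f P Q r) (gain_F P Q) \<longleftrightarrow>
        admissible_schedules P \<sigma>m \<sigma>c \<and> robust_z P Q r \<and> robust_u P Q r"
      using cl by (intro safety_feasible_iff_robust[OF wd]) (simp_all only: eff)
    then have "safety_feasible P \<sigma>m \<sigma>c (gain_f P Q r) (gain_F P Q)" using adm rob by blast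
    moreover have "block_lower_triangular ?T (nu P) (ny P) F" using RF unfolding respects_schedules_def by blast
    ultimately show ?thesis using loop_mat_inverse(1)[OF wd cl] sF by simp
  qed
  have to_milp: "\<exists>Q r \<Lambda> \<Gamma>. milp_feasible P \<sigma>m \<sigma>c Q r \<Lambda> \<Gamma> \<and>
      (\<forall>t<?T. \<sigma>c t = 1 \<longrightarrow> gain_f P Q r t = f t \<and>
        (\<forall>\<tau>\<le>t. \<sigma>m \<tau> = 1 \<longrightarrow> gain_F P Q t \<tau> = F t \<tau>))"
    if safe: "safety_feasible P \<sigma>m \<sigma>c f F" for \<sigma>m \<sigma>c f F
  proof -
    have adm: "admissible_schedules P \<sigma>m \<sigma>c"
      and F: "\<And>t s. t < ?T \<Longrightarrow> s \<le> t \<Longrightarrow> F t s \<in> carrier_mat (nu P) (ny P)"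
      and f: "\<And>t. t < ?T \<Longrightarrow> f t \<in> carrier_vec (nu P)"
      using safe unfolding safety_feasible_def by blast+
    have \<sigma>: "\<And>t. t < ?T \<Longrightarrow> \<sigma>c t \<in> {0, 1}"
      using adm unfolding admissible_schedules_def by blast
    let ?F = "eff_gain ?T (nu P) (ny P) \<sigma>m \<sigma>c F" and ?f = "eff_offset ?T (nu P) \<sigma>c f"
    have R: "respects_schedules ?T (nu P) (ny P) \<sigma>m \<sigma>c ?F ?f" by (rule respects_schedules_eff[OF \<sigma> F f])
    then have cF: "?F \<in> carrier_mat ?n ?m" "causal (nu P) (ny P) ?F" and cf: "?f \<in> carrier_vec ?n"
      unfolding respects_schedules_def block_lower_triangular_iff_causal by auto
    \<comment> \<open>The loop is closed around the effective gain rather than the given blocks,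
      which may be arbitrary where they do not act.\<close>
    obtain Q where cl: "closed_loop ?n ?m ?K ?F Q" using closed_loop_exists[OF cF K Ksc] by blast
    define r where "r = (1\<^sub>m ?n + Q * ?K) *\<^sub>v ?f"
    have "robust_z P Q r" "robust_u P Q r"
      using safety_feasible_iff_robust[OF wd F f cl r_def] safe by blast+
    moreover have "respects_schedules ?T (nu P) (ny P) \<sigma>m \<sigma>c Q r"
      by (rule respects_schedules_closed_loop[OF cl Ksc R r_def])
    ultimately obtain \<Lambda> \<Gamma> where milp: "milp_feasible P \<sigma>m \<sigma>c Q r \<Lambda> \<Gamma>"
      using milp_iff adm by blast
    have Q: "Q \<in> carrier_mat ?n ?m" using cl unfolding closed_loop_def by blast
    have N: "1\<^sub>m ?n - ?F * ?K \<in> carrier_mat ?n ?n"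
      by (rule minus_carrier_mat[OF mult_carrier_mat[OF cF(1) K]])
    have M: "1\<^sub>m ?n + Q * ?K \<in> carrier_mat ?n ?n" using mult_carrier_mat[OF Q K] by simp
    have sF: "stacked_F P Q = ?F" by (rule stacked_F_closed_loop[OF wd cl])
    have sf: "stacked_f P Q r = ?f"
      unfolding stacked_f_def loop_mat_inverse(2)[OF wd cl] r_def
      using closed_loop_inverse(2)[OF cl] assoc_mult_mat_vec[OF N M cf] cf by simp
    have "gain_f P Q r t = f t" if "t < ?T" "\<sigma>c t = 1" for t
      using vec_block_stack[OF that(1), of "hold \<sigma>c (0\<^sub>v (nu P)) f"] hold_unfold[of \<sigma>c "0\<^sub>v (nu P)" f t] f that
      unfolding gain_f_def sf eff_offset_def by simp
    moreover have "gain_F P Q t s = F t s" if "t < ?T" "\<sigma>c t = 1" "s \<le> t" "\<sigma>m s = 1" for t s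
      using mat_block_of_blocks[of t ?T s ?T "eff_block (nu P) (ny P) \<sigma>m \<sigma>c F"]
        eff_block_unfold[of "nu P" "ny P" \<sigma>m \<sigma>c F t s] F that
      unfolding gain_F_def sF eff_gain_def by simp
    ultimately show ?thesis using milp by blast
  qed
  have "(\<exists>f F. safety_feasible P \<sigma>m \<sigma>c f F) \<longleftrightarrow> (\<exists>Q r \<Lambda> \<Gamma>. milp_feasible P \<sigma>m \<sigma>c Q r \<Lambda> \<Gamma>)" for \<sigma>m \<sigma>c
    using to_safety to_milp by meson
  then show ?thesis using to_safety to_milp by meson
qed

end
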